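(* Let $h>0$, and let $S$ be a one-dimensional random walk with i.i.d. increments $X_1,X_2,\ldots$ satisfying $\mathbb{E}|X_1|\in(0,\infty)$ and $\mathbb{E}X_1=0$, such that the distribution of $X_1$ is either arithmetic or spread out. Then the chain $(O^{(h)}_n)_{n\ge0}$ of entrances into $[0,h]$ satisfies $$\lim_{n\to\infty}\bigl\|\mathbb{P}_x(O_n^{(h)}\in\cdot)-\pi_h(\cdot)\bigr\|_{\mathrm{TV}}=0\qquad\text{for all }x\in\mathcal{Z}_d.$$ If, in addition, either $\mathbb{E}X_1^2<\infty$ or $X_1\in\mathcal{D}(\alpha,\beta)$ for some $(\alpha,\beta)$ with $1<\alpha<2$ and $|\beta|<1$, then there exist constants $r\in(0,1)$ and $c>0$ such that $$\bigl\|\mathbb{P}_x(O_n^{(h)}\in\cdot)-\pi_h(\cdot)\bigr\|_{\mathrm{TV}}\le c\,r^n\qquad\text{for all }x\in\mathcal{Z}_d^+\text{ and } n\in\mathbb{N}.$$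
   Context: $S_n=S_0+X_1+\cdots+X_n$, with $S_0$ independent of the i.i.d. real increments; $\mathbb{P}_x$ is the law under which $S_0=x$. Let $\mathcal{Z}_0=\mathbb{R}$ and $\mathcal{Z}_a=a\mathbb{Z}$ for $a>0$. The span of the distribution of $X_1$ is $d:=\sup\{a\in[0,\infty):\mathbb{P}(X_1\in\mathcal{Z}_a)=1\}\in[0,\infty)$; the distribution is arithmetic if $d>0$. It is spread out if for some $k\ge1$ the law $\mathbb{P}_0(S_k\in\cdot)$ is non-singular with respect to Lebesgue measure. The walk takes values in $\mathcal{Z}_d$; $\mathcal{Z}_d^+=\mathcal{Z}_d\cap[0,\infty)$. Let $\lambda_0$ be Lebesgue measure on $\mathbb{R}$ and $\lambda_d(B)=d\cdot\#B$ for $B\subset\mathcal{Z}_d$ if $d>0$. Entrance times into $[0,h]$: $T_0^{(h)}=0$, $T_n^{(h)}=\inf\{k>T_{n-1}^{(h)}:S_{k-1}\notin[0,h],\ S_k\in[0,h]\}$ for $n\ge1$; $O_n^{(h)}:=S_{T_n^{(h)}}$ for $n\ge0$. The probability measure $\pi_h$ on $\mathcal{Z}_d$ is $$\pi_h(dx)=c_h\,\mathbf{1}_{[0,h]}(x)\bigl(1-\mathbb{P}(x-h\le X_1\le x)\bigr)\lambda_d(dx),$$ where $c_h>0$ is the normalizing constant. $\|\mu-\nu\|_{\mathrm{TV}}=\sup_B|\mu(B)-\nu(B)|$ over Borel sets $B$. $X\in\mathcal{D}(\alpha,\beta)$ means that the distribution of $X$ belongs to the domain of attraction of a strictly stable law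 with characteristic function $\chi_{\alpha,\beta}(t)=\exp\bigl(-c_0|t|^\alpha(1-i\beta\,\mathrm{sign}(t)\tan(\pi\alpha/2))\bigr)$ for some $c_0>0$. *)

theory Defs
  imports "HOL-Probability.Probability"
begin

definition lattice_set :: "real \<Rightarrow> real set" where
  "lattice_set a = (if a = 0 then UNIV else range (\<lambda>k::int. a * of_int k))"

definition law_span :: "real measure \<Rightarrow> real" where
  "law_span \<mu> = Sup {a. 0 \<le> a \<and> measure \<mu> (lattice_set a) = 1}"

definition arithmetic_law :: "real measure \<Rightarrow> bool" where
  "arithmetic_law \<mu> \<longleftrightarrow> law_span \<mu> > 0"

text \<open>
  The increments are \<open>X 1, X 2, \<dots>\<close>; the value \<open>X 0\<close> is never used. The law
  \<open>P\<^sub>x\<close> is obtained by starting the walk deterministically at \<open>x\<close>.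
\<close>

definition iid_increments :: "'a measure \<Rightarrow> (nat \<Rightarrow> 'a \<Rightarrow> real) \<Rightarrow> bool" where
  "iid_increments M X \<longleftrightarrow>
     prob_space M \<and>
     prob_space.indep_vars M (\<lambda>_. borel) X {1..} \<and>
     (\<forall>i\<ge>1. distr M borel (X i) = distr M borel (X 1))"

definition walk :: "(nat \<Rightarrow> 'a \<Rightarrow> real) \<Rightarrow> real \<Rightarrow> 'a \<Rightarrow> nat \<Rightarrow> real" where
  "walk X x \<omega> n = x + (\<Sum>k=1..n. X k \<omega>)"

definition mutually_singular :: "'a measure \<Rightarrow> 'a measure \<Rightarrow> bool" where
  "mutually_singular \<mu> \<nu> \<longleftrightarrow>
     (\<exists>A \<in> sets \<mu> \<inter> sets \<nu>. emeasure \<mu> A = 0 \<and> emeasure \<nu> (space \<nu> - A) = 0)"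

definition spread_out :: "'a measure \<Rightarrow> (nat \<Rightarrow> 'a \<Rightarrow> real) \<Rightarrow> bool" where
  "spread_out M X \<longleftrightarrow>
     (\<exists>k\<ge>1. \<not> mutually_singular (distr M borel (\<lambda>\<omega>. walk X 0 \<omega> k)) lborel)"

definition haar_lattice :: "real \<Rightarrow> real measure" where
  "haar_lattice d =
     (if d = 0 then lborel
      else scale_measure (ennreal d) (distr (count_space (lattice_set d)) borel (\<lambda>x. x)))"

text \<open>The infimum of the empty set is \<open>\<infinity>\<close>, and \<open>k - 1\<close> is only used for \<open>k > 0\<close>.\<close>

primrec entrance_time :: "real \<Rightarrow> (nat \<Rightarrow> real) \<Rightarrow> nat \<Rightarrow> enat" where
  "entrance_time h s 0 = 0"
| "entrance_time h s (Suc n) =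
     Inf {enat k | k. entrance_time h s n < enat k \<and> s (k - 1) \<notin> {0..h} \<and> s k \<in> {0..h}}"

text \<open>
  The law of the \<open>n\<close>-th entrance position \<open>O\<^sub>n\<close> under \<open>P\<^sub>x\<close>, on the event that the
  \<open>n\<close>-th entrance time is finite. A priori it is only a sub-probability measure.
\<close>

definition entrance_law ::
  "'a measure \<Rightarrow> (nat \<Rightarrow> 'a \<Rightarrow> real) \<Rightarrow> real \<Rightarrow> real \<Rightarrow> nat \<Rightarrow> real measure" where
  "entrance_law M X h x n =
     distr (restrict_space M {\<omega> \<in> space M. entrance_time h (walk X x \<omega>) n < \<infinity>}) borel
       (\<lambda>\<omega>. walk X x \<omega> (the_enat (entrance_time h (walk X x \<omega>) n)))"

definition entrance_weight :: "real measure \<Rightarrow> real \<Rightarrow> real measure" where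
  "entrance_weight \<mu> h =
     density (haar_lattice (law_span \<mu>))
       (\<lambda>x. ennreal (indicator {0..h} x * (1 - measure \<mu> {x - h..x})))"

definition entrance_stationary :: "real measure \<Rightarrow> real \<Rightarrow> real measure" where
  "entrance_stationary \<mu> h =
     scale_measure (1 / emeasure (entrance_weight \<mu> h) UNIV) (entrance_weight \<mu> h)"

definition tv_dist :: "real measure \<Rightarrow> real measure \<Rightarrow> real" where
  "tv_dist \<mu> \<nu> = (SUP B\<in>sets borel. \<bar>measure \<mu> B - measure \<nu> B\<bar>)"

definition stable_char :: "real \<Rightarrow> real \<Rightarrow> real \<Rightarrow> real \<Rightarrow> complex" where
  "stable_char c0 \<alpha> \<beta> t =
     exp (- (of_real (c0 * \<bar>t\<bar> powr \<alpha>) * (1 - \<i> * of_real (\<beta> * sgn t * tan (pi * \<alpha> / 2)))))"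

definition in_stable_domain ::
  "'a measure \<Rightarrow> (nat \<Rightarrow> 'a \<Rightarrow> real) \<Rightarrow> real \<Rightarrow> real \<Rightarrow> bool" where
  "in_stable_domain M X \<alpha> \<beta> \<longleftrightarrow>
     (\<exists>c0 \<nu> a b. c0 > 0 \<and> real_distribution \<nu> \<and> char \<nu> = stable_char c0 \<alpha> \<beta> \<and>
        (\<forall>n. a n > 0) \<and>
        weak_conv_m (\<lambda>n. distr M borel (\<lambda>\<omega>. (walk X 0 \<omega> n - b n) / a n)) \<nu>)"

end

theory Submission
  imports Defs
begin

text \<open>
  Split the transition operator of the walk as \<open>P = E + N\<close>, where \<open>E\<close> collects the steps that enter
  \<open>A = [0, h]\<close> from outside; then \<open>Q = \<Sum>k. N\<^sup>k E\<close> is the transition operator of the chain of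
  entrances. If \<open>0 \<le> u \<le> 1\<close> and \<open>u \<le> P u\<close>, then \<open>u\<^sup>2 \<le> P\<^sup>j u\<^sup>2\<close> as well, and the sums of
  \<open>P\<^sup>k (P\<^sup>j u\<^sup>2 - u\<^sup>2)\<close> telescope; as the Green function of a centred walk is infinite, these
  differences, and with them the variances of \<open>u\<close> along the walk, vanish almost everywhere, so
  that \<open>u\<close> is constant. Applied to \<open>u = 1 - Q 1\<close> this gives \<open>Q 1 = 1\<close>. Since \<open>P\<close> preserves the
  Haar measure \<open>\<lambda>\<close>, the functional \<open>g \<mapsto> \<integral> E g d\<lambda>\<close>, which is \<open>\<pi>\<^sub>h\<close> up to a factor, is invariant
  under \<open>Q\<close>. Finally, a walk with truncated steps dominates a multiple of \<open>\<lambda>\<close> on any given window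
  after boundedly many steps; preceding this by a climb far above \<open>h\<close> and following it by a
  descent produces exactly one entrance, hence a Doeblin minorization of \<open>Q\<^sup>2\<close> on \<open>A\<close>.
\<close>

subsection \<open>Step operators\<close>

text \<open>The second power of the chain is minorized, not the chain itself: a path that climbs,
  spreads out and descends ends in \<open>A\<close>, but its endpoint need not be a place of
  entrance. Only the next entrance after it has a law that is bounded below independently of the
  start. Two infinities shape the computations. The Haar measure has infinite mass, so invariance of
  the flux is first shown for partial sums with finite integrals. And all operators take values in
  \<open>ennreal\<close>, where sums and integrals may be exchanged freely but only finite terms
  cancel; subtractions are therefore rewritten as additions throughout. Constancy of subharmonic
  functions holds only almost everywhere, while the claims concern every start in \<open>Z\<close>;
  a separate argument removes the exceptional set. From any such start one application of the chain
  leads into \<open>A\<close>, so the constants of the geometric bound do not depend on the start.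
  Recurrence is used only as divergence of the expected number of visits to
  \<open>{-1..1}\<close>.\<close>

definition step_op ::
  "real measure \<Rightarrow> (real \<Rightarrow> real \<Rightarrow> ennreal) \<Rightarrow> (real \<Rightarrow> ennreal) \<Rightarrow> real \<Rightarrow> ennreal" where
  "step_op \<mu> w f x = (\<integral>\<^sup>+ z. w x z * f (x + z) \<partial>\<mu>)"

abbreviation free_op :: "real measure \<Rightarrow> (real \<Rightarrow> ennreal) \<Rightarrow> real \<Rightarrow> ennreal" where
  "free_op \<mu> \<equiv> step_op \<mu> (\<lambda>_ _. 1)"

abbreviation enter_op :: "real measure \<Rightarrow> real set \<Rightarrow> (real \<Rightarrow> ennreal) \<Rightarrow> real \<Rightarrow> ennreal" where
  "enter_op \<mu> A \<equiv> step_op \<mu> (\<lambda>x z. if x \<notin> A \<and> x + z \<in> A then 1 else 0)"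

abbreviation stay_op :: "real measure \<Rightarrow> real set \<Rightarrow> (real \<Rightarrow> ennreal) \<Rightarrow> real \<Rightarrow> ennreal" where
  "stay_op \<mu> A \<equiv> step_op \<mu> (\<lambda>x z. if x \<notin> A \<and> x + z \<in> A then 0 else 1)"

abbreviation into_op :: "real measure \<Rightarrow> real set \<Rightarrow> (real \<Rightarrow> ennreal) \<Rightarrow> real \<Rightarrow> ennreal" where
  "into_op \<mu> B \<equiv> step_op \<mu> (\<lambda>x z. indicator B z)"

abbreviation weight_measurable :: "(real \<Rightarrow> real \<Rightarrow> ennreal) \<Rightarrow> bool" where
  "weight_measurable w \<equiv> case_prod w \<in> borel_measurable (borel \<Otimes>\<^sub>M borel)"

lemma weight_measurable_enter [measurable]:
  assumes [measurable]: "A \<in> sets borel"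
  shows "weight_measurable (\<lambda>x z. if x \<notin> A \<and> x + z \<in> A then 1 else 0)"
    and "weight_measurable (\<lambda>x z. if x \<notin> A \<and> x + z \<in> A then 0 else 1)"
  by measurable

lemma weight_measurable_into [measurable]:
  assumes [measurable]: "B \<in> sets borel"
  shows "weight_measurable (\<lambda>x z. indicator B z)"
  by measurable

lemma weight_measurable_free [measurable]: "weight_measurable (\<lambda>_ _. 1)"
  by measurable

context real_distribution
begin

lemma step_op_measurable [measurable]:
  assumes [measurable]: "weight_measurable w" "f \<in> borel_measurable borel"
  shows "step_op M w f \<in> borel_measurable borel"
  unfolding step_op_def by measurable

lemma step_op_funpow_measurable [measurable]:
  assumes "weight_measurable w" "f \<in> borel_measurable borel"
  shows "(step_op M w ^^ k) f \<in> borel_measurable borel"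
  using assms by (induction k) (auto intro: step_op_measurable)

lemma weight_section:
  assumes "weight_measurable w"
  shows "w x \<in> borel_measurable borel"
  using measurable_compose_Pair1[OF _ assms, of x] by simp

lemma step_op_add:
  assumes [measurable]: "weight_measurable w" "f \<in> borel_measurable borel" "g \<in> borel_measurable borel"
  shows "step_op M w (\<lambda>y. f y + g y) x = step_op M w f x + step_op M w g x"
  using weight_section[OF assms(1), of x, measurable] unfolding step_op_def distrib_left by (intro nn_integral_add) measurable

lemma step_op_cmult:
  assumes [measurable]: "weight_measurable w" "f \<in> borel_measurable borel"
  shows "step_op M w (\<lambda>y. c * f y) x = c * step_op M w f x"
  using weight_section[OF assms(1), of x, measurable] unfolding step_op_def by (subst nn_integral_cmult[symmetric]) (auto simp: mult.left_commute)

lemma step_op_sum: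
  assumes [measurable]: "weight_measurable w" "\<And>i. i \<in> I \<Longrightarrow> f i \<in> borel_measurable borel"
  shows "step_op M w (\<lambda>y. \<Sum>i\<in>I. f i y) x = (\<Sum>i\<in>I. step_op M w (f i) x)"
  using weight_section[OF assms(1), of x, measurable] unfolding step_op_def sum_distrib_left by (intro nn_integral_sum) measurable

lemma step_op_suminf:
  assumes [measurable]: "weight_measurable w" "\<And>i. f i \<in> borel_measurable borel"
  shows "step_op M w (\<lambda>y. \<Sum>i. f i y) x = (\<Sum>i. step_op M w (f i) x)"
  using weight_section[OF assms(1), of x, measurable] unfolding step_op_def ennreal_suminf_cmult[symmetric] by (intro nn_integral_suminf) measurable

text \<open>Almost every step lies in \<open>Z\<close> and \<open>Z\<close> is closed under
  addition, so a walk started in \<open>Z\<close> stays there and \<open>f\<close>, \<open>g\<close>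
  are compared only on \<open>Z\<close>. This localization is needed because lower bounds such as
  \<open>spread\<close> are available only for starting points in \<open>Z\<close>.\<close>

lemma step_op_mono_on:
  assumes Z: "AE z in M. z \<in> Z" "\<And>x z. x \<in> Z \<Longrightarrow> z \<in> Z \<Longrightarrow> x + z \<in> Z" "x \<in> Z"
    and w: "\<And>z. w x z \<le> w' x z" and f: "\<And>y. y \<in> Z \<Longrightarrow> f y \<le> g y"
  shows "step_op M w f x \<le> step_op M w' g x"
  unfolding step_op_def
  by (rule nn_integral_mono_AE) (use Z f w in \<open>auto intro!: mult_mono\<close>)

lemma step_op_mono:
  assumes "\<And>z. w x z \<le> w' x z" "\<And>y. f y \<le> g y"
  shows "step_op M w f x \<le> step_op M w' g x"
  by (rule step_op_mono_on[of UNIV]) (use assms in auto)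

lemma step_op_funpow_mono_on:
  assumes Z: "AE z in M. z \<in> Z" "\<And>x z. x \<in> Z \<Longrightarrow> z \<in> Z \<Longrightarrow> x + z \<in> Z" "x \<in> Z"
    and w: "\<And>x z. w x z \<le> w' x z" and f: "\<And>y. y \<in> Z \<Longrightarrow> f y \<le> g y"
  shows "(step_op M w ^^ k) f x \<le> (step_op M w' ^^ k) g x"
  using Z(3)
proof (induction k arbitrary: x)
  case (Suc k)
  show ?case by (simp, rule step_op_mono_on[OF Z(1,2)]) (use Suc w in auto)
qed (use f in auto)

lemma step_op_funpow_mono:
  assumes "\<And>x z. w x z \<le> w' x z" "\<And>y. f y \<le> g y"
  shows "(step_op M w ^^ k) f x \<le> (step_op M w' ^^ k) g x"
  by (rule step_op_funpow_mono_on[of UNIV]) (use assms in auto)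

lemma step_op_funpow_cmult:
  assumes "weight_measurable w" "f \<in> borel_measurable borel"
  shows "(step_op M w ^^ k) (\<lambda>y. c * f y) x = c * (step_op M w ^^ k) f x"
proof (induction k arbitrary: x)
  case (Suc k)
  have "(step_op M w ^^ Suc k) (\<lambda>y. c * f y) x = step_op M w (\<lambda>y. c * (step_op M w ^^ k) f y) x"
    by (simp add: Suc[abs_def])
  then show ?case using assms by (simp add: step_op_cmult)
qed auto

lemma step_op_funpow_add:
  assumes "weight_measurable w" "f \<in> borel_measurable borel" "g \<in> borel_measurable borel"
  shows "(step_op M w ^^ k) (\<lambda>y. f y + g y) x = (step_op M w ^^ k) f x + (step_op M w ^^ k) g x"
proof (induction k arbitrary: x)
  case (Suc k)
  have "(step_op M w ^^ Suc k) (\<lambda>y. f y + g y) x =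
      step_op M w (\<lambda>y. (step_op M w ^^ k) f y + (step_op M w ^^ k) g y) x"
    by (simp add: Suc[abs_def])
  then show ?case using assms by (simp add: step_op_add)
qed auto

lemma step_op_funpow_sum:
  assumes "weight_measurable w" "\<And>i. i \<in> I \<Longrightarrow> f i \<in> borel_measurable borel" "finite I"
  shows "(step_op M w ^^ k) (\<lambda>y. \<Sum>i\<in>I. f i y) x = (\<Sum>i\<in>I. (step_op M w ^^ k) (f i) x)"
proof (induction k arbitrary: x)
  case (Suc k)
  have "(step_op M w ^^ Suc k) (\<lambda>y. \<Sum>i\<in>I. f i y) x =
      step_op M w (\<lambda>y. \<Sum>i\<in>I. (step_op M w ^^ k) (f i) y) x"
    by (simp add: Suc[abs_def])
  then show ?case using assms by (simp add: step_op_sum)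
qed auto

lemma free_op_const [simp]: "free_op M (\<lambda>_. c) x = c"
  by (simp add: step_op_def emeasure_space_1 del: space_eq_univ)

lemma free_op_funpow_const [simp]: "(free_op M ^^ k) (\<lambda>_. c) x = c"
proof (induction k arbitrary: x)
  case (Suc k)
  then have "(free_op M ^^ k) (\<lambda>_. c) = (\<lambda>_. c)" by blast
  then show ?case by simp
qed simp

lemma enter_add_stay:
  assumes [measurable]: "A \<in> sets borel" "f \<in> borel_measurable borel"
  shows "enter_op M A f x + stay_op M A f x = free_op M f x"
  unfolding step_op_def
  by (subst nn_integral_add[symmetric]) (auto intro!: nn_integral_cong)

end

section \<open>Counting entrances and the operator of the chain\<close>

text \<open>Iterated kernel that integrates \<open>f\<close> over the position after
  \<open>k\<close> steps on the event of exactly \<open>n\<close> entrances into \<open>A\<close>.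
  The recursion splits off the first step, which either enters, lowering the number of entrances
  still due, or does not.\<close>

primrec passage_op ::
  "real measure \<Rightarrow> real set \<Rightarrow> nat \<Rightarrow> nat \<Rightarrow> (real \<Rightarrow> ennreal) \<Rightarrow> real \<Rightarrow> ennreal" where
  "passage_op \<mu> A 0 n f = (if n = 0 then f else (\<lambda>_. 0))"
| "passage_op \<mu> A (Suc k) n f = (\<lambda>x. stay_op \<mu> A (passage_op \<mu> A k n f) x +
     (if n = 0 then 0 else enter_op \<mu> A (passage_op \<mu> A k (n - 1) f) x))"

text \<open>The transition operator of the chain of entrances into \<open>A\<close>.\<close>

definition chain_op :: "real measure \<Rightarrow> real set \<Rightarrow> (real \<Rightarrow> ennreal) \<Rightarrow> real \<Rightarrow> ennreal" where
  "chain_op \<mu> A f x = (\<Sum>k. (stay_op \<mu> A ^^ k) (enter_op \<mu> A f) x)"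

lemma step_op_zero [simp]: "step_op \<mu> w (\<lambda>_. 0) x = 0"
  by (simp add: step_op_def)

lemma ennreal_add_right_mono_cancel:
  fixes a b c :: ennreal
  assumes "a + c \<le> b + c" "c < top"
  shows "a \<le> b"
  using assms ennreal_add_left_cancel_le[of c a b] by (auto simp: add.commute)

lemma suminf_swap_ennreal:
  fixes f :: "nat \<Rightarrow> nat \<Rightarrow> ennreal"
  shows "(\<Sum>i. \<Sum>k. f i k) = (\<Sum>k. \<Sum>i. f i k)"
proof -
  have "(\<integral>\<^sup>+i. (\<Sum>k. f i k) \<partial>count_space UNIV) = (\<Sum>k. \<integral>\<^sup>+i. f i k \<partial>count_space UNIV)"
    by (intro nn_integral_suminf) auto
  then show ?thesis by (simp add: nn_integral_count_space_nat)
qed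

lemma suminf_Suc_ennreal: "(\<Sum>k. f k) = f 0 + (\<Sum>k. f (Suc k) :: ennreal)"
  using suminf_offset[of f 1] by simp

text \<open>Tonelli on the triangle \<open>i \<le> k\<close> with \<open>j = k - i\<close>. Later
  \<open>i\<close> is the number of steps before the step of the first entrance and \<open>j\<close>
  the number after it.\<close>

lemma suminf_triangle_ennreal:
  fixes a :: "nat \<Rightarrow> nat \<Rightarrow> ennreal"
  shows "(\<Sum>k. \<Sum>i\<le>k. a i (k - i)) = (\<Sum>i. \<Sum>j. a i j)"
proof -
  have "(\<Sum>i\<le>k. a i (k - i)) = (\<Sum>i. if i \<le> k then a i (k - i) else 0)" for k
    using suminf_finite[of "{..k}" "\<lambda>i. if i \<le> k then a i (k - i) else 0"] by simp
  then have "(\<Sum>k. \<Sum>i\<le>k. a i (k - i)) = (\<Sum>k. \<Sum>i. if i \<le> k then a i (k - i) else 0)"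
    by simp
  also have "\<dots> = (\<Sum>i. \<Sum>k. if i \<le> k then a i (k - i) else 0)"
    by (rule suminf_swap_ennreal)
  also have "\<dots> = (\<Sum>i. \<Sum>j. a i j)"
  proof (rule arg_cong[where f = suminf], rule ext)
    fix i
    show "(\<Sum>k. if i \<le> k then a i (k - i) else 0) = (\<Sum>j. a i j)"
      using suminf_offset[of "\<lambda>k. if i \<le> k then a i (k - i) else 0" i] by simp
  qed
  finally show ?thesis .
qed

context real_distribution
begin

lemma passage_op_measurable [measurable]:
  assumes [measurable]: "A \<in> sets borel" "f \<in> borel_measurable borel"
  shows "passage_op M A k n f \<in> borel_measurable borel"
proof (induction k arbitrary: n)
  case (Suc k)
  note Suc[measurable]
  show ?case by simp
qed simp

lemma passage_op_mono:
  assumes "\<And>y. f y \<le> g y"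
  shows "passage_op M A k n f x \<le> passage_op M A k n g x"
proof (induction k arbitrary: n x)
  case (Suc k)
  then show ?case by (auto intro!: add_mono step_op_mono)
qed (use assms in auto)

lemma passage_op_suminf:
  assumes [measurable]: "A \<in> sets borel" "\<And>i. f i \<in> borel_measurable borel"
  shows "passage_op M A k n (\<lambda>y. \<Sum>i. f i y) x = (\<Sum>i. passage_op M A k n (f i) x)"
proof (induction k arbitrary: n x)
  case (Suc k)
  show ?case
    by (simp add: Suc[abs_def] step_op_suminf suminf_add[symmetric])
qed auto

text \<open>Splits off the last step instead of the first. Path probabilities are computed by
  integrating out the most recent increment, so this is the form that matches
  \<open>nn_integral_entered\<close>.\<close>

lemma passage_op_Suc_right:
  assumes [measurable]: "A \<in> sets borel" "f \<in> borel_measurable borel"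
  shows "passage_op M A (Suc k) n f x = passage_op M A k n (stay_op M A f) x +
    (if n = 0 then 0 else passage_op M A k (n - 1) (enter_op M A f) x)"
proof (induction k arbitrary: n x)
  case 0
  then show ?case by (auto simp: step_op_def)
next
  case (Suc k)
  have *: "passage_op M A (Suc k) n f =
     (\<lambda>x. passage_op M A k n (stay_op M A f) x +
    (if n = 0 then 0 else passage_op M A k (n - 1) (enter_op M A f) x))" for n
    using Suc by blast
  show ?case
    by (subst passage_op.simps(2), subst (1 2) *)
       (auto simp: step_op_add ac_simps)
qed

lemma passage_op_0: "passage_op M A k 0 f = (stay_op M A ^^ k) f"
  by (induction k) auto

text \<open>Decomposition at the first entrance: \<open>i\<close> steps that do not enter, the
  entering step, and \<open>k - i\<close> further steps with \<open>n\<close> entrances.\<close>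

lemma passage_op_Suc_Suc:
  assumes [measurable]: "A \<in> sets borel" "f \<in> borel_measurable borel"
  shows "passage_op M A (Suc k) (Suc n) f x =
    (\<Sum>i\<le>k. (stay_op M A ^^ i) (enter_op M A (passage_op M A (k - i) n f)) x)"
proof (induction k arbitrary: x)
  case 0
  then show ?case by (auto simp: step_op_def)
next
  case (Suc k)
  have "passage_op M A (Suc (Suc k)) (Suc n) f x =
      stay_op M A (\<lambda>x. \<Sum>i\<le>k. (stay_op M A ^^ i) (enter_op M A (passage_op M A (k - i) n f)) x) x
      + enter_op M A (passage_op M A (Suc k) n f) x"
    by (subst passage_op.simps(2), subst Suc[abs_def]) simp
  also have "\<dots> = (\<Sum>i\<le>k. (stay_op M A ^^ Suc i) (enter_op M A (passage_op M A (k - i) n f)) x)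
      + enter_op M A (passage_op M A (Suc k) n f) x"
    by (simp add: step_op_sum)
  finally show ?case by (subst sum.atMost_Suc_shift) (simp add: add.commute)
qed

lemma chain_op_measurable [measurable]:
  assumes [measurable]: "A \<in> sets borel" "f \<in> borel_measurable borel"
  shows "chain_op M A f \<in> borel_measurable borel"
  unfolding chain_op_def by measurable

lemma chain_op_funpow_measurable [measurable]:
  assumes [measurable]: "A \<in> sets borel" "f \<in> borel_measurable borel"
  shows "(chain_op M A ^^ n) f \<in> borel_measurable borel"
  by (induction n) auto

lemma suminf_passage_op_Suc:
  assumes [measurable]: "A \<in> sets borel" "f \<in> borel_measurable borel"
  shows "(\<Sum>k. passage_op M A k (Suc n) f x) = chain_op M A (\<lambda>y. \<Sum>k. passage_op M A k n f y) x"
proof -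
  have funpow_suminf: "(stay_op M A ^^ i) (\<lambda>y. \<Sum>j. g j y) x = (\<Sum>j. (stay_op M A ^^ i) (g j) x)"
    if "\<And>j. g j \<in> borel_measurable borel" for i g x
    using passage_op_suminf[OF assms(1), where f = g and k = i and n = 0 and x = x] that by (simp add: passage_op_0)
  have "(\<Sum>k. passage_op M A k (Suc n) f x) = (\<Sum>k. passage_op M A (Suc k) (Suc n) f x)"
    by (subst suminf_Suc_ennreal) simp
  also have "\<dots> = (\<Sum>i. \<Sum>j. (stay_op M A ^^ i) (enter_op M A (passage_op M A j n f)) x)"
    by (simp only: passage_op_Suc_Suc[OF assms] suminf_triangle_ennreal[of
          "\<lambda>i j. (stay_op M A ^^ i) (enter_op M A (passage_op M A j n f)) x"])
  also have "\<dots> = (\<Sum>i. (stay_op M A ^^ i) (enter_op M A (\<lambda>y. \<Sum>j. passage_op M A j n f y)) x)"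
  proof -
    have "enter_op M A (\<lambda>y. \<Sum>j. passage_op M A j n f y)
        = (\<lambda>y. \<Sum>j. enter_op M A (passage_op M A j n f) y)"
      by (rule ext, rule step_op_suminf) measurable
    then show ?thesis by (simp add: funpow_suminf)
  qed
  finally show ?thesis by (simp add: chain_op_def)
qed

text \<open>Entrance number \<open>n + 1\<close> happens at step \<open>k + 1\<close> exactly when
  the first \<open>k\<close> steps contain \<open>n\<close> entrances and the next step enters, so
  the sum over \<open>k\<close> integrates \<open>f\<close> over the position of that entrance. The
  strong Markov property at the first entrance, \<open>suminf_passage_op_Suc\<close>, turns the sum
  into a power of \<open>chain_op\<close>.\<close>

lemma suminf_passage_op:
  assumes [measurable]: "A \<in> sets borel" "f \<in> borel_measurable borel"
  shows "(\<Sum>k. passage_op M A k n (enter_op M A f) x) = (chain_op M A ^^ Suc n) f x"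
proof (induction n arbitrary: x)
  case 0
  then show ?case by (simp add: passage_op_0 chain_op_def)
next
  case (Suc n)
  show ?case
    by (subst suminf_passage_op_Suc) (auto simp: Suc[abs_def])
qed

lemma passage_op_stay_funpow_le:
  assumes [measurable]: "A \<in> sets borel" "f \<in> borel_measurable borel"
  shows "passage_op M A j n ((stay_op M A ^^ i) f) x \<le> passage_op M A (j + i) n f x"
  using assms(2)
proof (induction i arbitrary: f)
  case (Suc i)
  note Suc(2)[measurable]
  have "passage_op M A j n ((stay_op M A ^^ Suc i) f) x
      \<le> passage_op M A (j + i) n (stay_op M A f) x"
    using Suc(1)[of "stay_op M A f"] by (simp add: funpow_swap1)
  also have "\<dots> \<le> passage_op M A (Suc (j + i)) n f x"
    by (subst passage_op_Suc_right) auto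
  finally show ?case by simp
qed simp

text \<open>After \<open>j\<close> steps with \<open>n\<close> entrances, the next entrance is
  number \<open>n + 1\<close>. Fixing \<open>j\<close> only loses mass: the continuations of such
  paths are part of the series in \<open>suminf_passage_op\<close>. The case \<open>n = 1\<close> is
  the source of the square in the minorization.\<close>

lemma passage_op_chain_op_le:
  assumes [measurable]: "A \<in> sets borel" "f \<in> borel_measurable borel"
  shows "passage_op M A j n (chain_op M A f) x \<le> (chain_op M A ^^ Suc n) f x"
proof -
  have "passage_op M A j n (chain_op M A f) x
      = (\<Sum>i. passage_op M A j n ((stay_op M A ^^ i) (enter_op M A f)) x)"
    unfolding chain_op_def[abs_def] by (rule passage_op_suminf) auto
  also have "\<dots> \<le> (\<Sum>i. passage_op M A (i + j) n (enter_op M A f) x)"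
    by (intro suminf_le) (auto simp: add.commute intro!: order_trans[OF passage_op_stay_funpow_le])
  also have "\<dots> \<le> (\<Sum>k. passage_op M A k n (enter_op M A f) x)"
    by (subst (2) suminf_offset[of _ j]) auto
  finally show ?thesis by (simp add: suminf_passage_op)
qed

end

subsection \<open>Walks on a lattice\<close>

text \<open>Treats \<open>lattice_set d\<close> with its weighted counting measure and the line with
  Lebesgue measure at once. \<open>haar_shift\<close> ties \<open>haar\<close> to addition;
  \<open>haar_interval_pos\<close> and \<open>haar_bounded\<close> give \<open>{0..h}\<close>
  positive finite mass, and by \<open>haar_UNIV\<close> a property valid almost everywhere holds at
  some point outside of it.\<close>

locale haar_walk = real_distribution \<mu> for \<mu> :: "real measure" +
  fixes Z :: "real set" and haar :: "real measure"
  assumes Z_add: "x \<in> Z \<Longrightarrow> y \<in> Z \<Longrightarrow> x + y \<in> Z"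
    and Z_zero: "0 \<in> Z"
    and AE_step: "AE z in \<mu>. z \<in> Z"
    and sets_haar [simp, measurable_cong]: "sets haar = sets borel"
    and sigma_finite_haar: "sigma_finite_measure haar"
    and AE_haar: "AE x in haar. x \<in> Z"
    and haar_shift: "s \<in> Z \<Longrightarrow> f \<in> borel_measurable borel \<Longrightarrow>
      (\<integral>\<^sup>+ y. f (y + s) \<partial>haar) = (\<integral>\<^sup>+ y. f y \<partial>haar)"
    and haar_bounded: "emeasure haar {a..b} < \<infinity>"
    and haar_interval_pos: "0 < b \<Longrightarrow> 0 < emeasure haar {0..b}"
    and haar_UNIV: "emeasure haar UNIV = \<infinity>"

text \<open>The common consequence of the arithmetic and of the spread-out case. Bounded steps
  control how far a path can move; summing over \<open>j \<le> n\<close> instead of fixing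
  \<open>j\<close> accommodates periodic walks; the constants may depend on \<open>l\<close>, but
  not on the starting point.\<close>

locale lattice_walk = haar_walk +
  assumes spread: "\<exists>K n c. 0 < c \<and> (\<forall>x\<in>Z. \<forall>g\<in>borel_measurable borel.
      ennreal c * (\<integral>\<^sup>+ y. g y * indicator {x - l..x + l} y \<partial>haar)
        \<le> (\<Sum>j\<le>n. (into_op \<mu> {-K..K} ^^ j) g x))"

section \<open>Windows moved by steps of controlled size\<close>

context haar_walk
begin

definition window_integral :: "real \<Rightarrow> real \<Rightarrow> (real \<Rightarrow> ennreal) \<Rightarrow> real \<Rightarrow> ennreal" where
  "window_integral p q g x = (\<integral>\<^sup>+ y. g y * indicator {x + p..x + q} y \<partial>haar)"

text \<open>A step \<open>z \<in> B\<close> moves the window by \<open>z\<close>, which is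
  \<open>s\<close> up to \<open>\<eta>\<close>; all windows so moved contain the one displaced by
  \<open>s\<close> and shortened by \<open>\<eta>\<close> at both ends. Length of the window is
  traded for knowledge of its place.\<close>

lemma into_op_window_integral:
  assumes [measurable]: "B \<in> sets borel" "g \<in> borel_measurable borel"
    and B: "B \<subseteq> {s - \<eta>..s + \<eta>}"
  shows "emeasure \<mu> B * window_integral (p + (s + \<eta>)) (q + (s - \<eta>)) g x
    \<le> into_op \<mu> B (window_integral p q g) x"
proof -
  have "emeasure \<mu> B * window_integral (p + (s + \<eta>)) (q + (s - \<eta>)) g x
      = (\<integral>\<^sup>+ z. window_integral (p + (s + \<eta>)) (q + (s - \<eta>)) g x * indicator B z \<partial>\<mu>)"
    by (subst nn_integral_cmult_indicator) (auto simp: mult.commute)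
  also have "\<dots> \<le> (\<integral>\<^sup>+ z. indicator B z * window_integral p q g (x + z) \<partial>\<mu>)"
  proof (rule nn_integral_mono)
    fix z
    have "window_integral (p + (s + \<eta>)) (q + (s - \<eta>)) g x \<le> window_integral p q g (x + z)" if "z \<in> B"
      unfolding window_integral_def
      by (intro nn_integral_mono mult_left_mono) (use that B in \<open>auto simp: indicator_def\<close>)
    then show "window_integral (p + (s + \<eta>)) (q + (s - \<eta>)) g x * indicator B z
        \<le> indicator B z * window_integral p q g (x + z)"
      by (auto simp: indicator_def)
  qed
  finally show ?thesis by (simp add: step_op_def)
qed

lemma window_integral_measurable [measurable]:
  assumes [measurable]: "g \<in> borel_measurable borel"
  shows "window_integral p q g \<in> borel_measurable borel"
proof -
  interpret haar: sigma_finite_measure haar by (rule sigma_finite_haar)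
  have "(\<lambda>(x, y). g y * (if x + p \<le> y \<and> y \<le> x + q then 1 else 0)) \<in> borel_measurable (borel \<Otimes>\<^sub>M haar)"
    by measurable
  then have "(\<lambda>x. \<integral>\<^sup>+ y. g y * (if x + p \<le> y \<and> y \<le> x + q then 1 else 0) \<partial>haar) \<in> borel_measurable borel"
    by (rule haar.borel_measurable_nn_integral)
  also have "(\<lambda>x. \<integral>\<^sup>+ y. g y * (if x + p \<le> y \<and> y \<le> x + q then 1 else 0) \<partial>haar) = window_integral p q g"
    unfolding window_integral_def by (intro ext nn_integral_cong) (auto simp: indicator_def)
  finally show ?thesis .
qed

lemma into_op_funpow_window_integral:
  assumes [measurable]: "B \<in> sets borel" "g \<in> borel_measurable borel"
    and B: "B \<subseteq> {s - \<eta>..s + \<eta>}"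
  shows "emeasure \<mu> B ^ a * window_integral (p + real a * (s + \<eta>)) (q + real a * (s - \<eta>)) g x
    \<le> (into_op \<mu> B ^^ a) (window_integral p q g) x"
proof (induction a arbitrary: x)
  case (Suc a)
  let ?W = "window_integral (p + real a * (s + \<eta>)) (q + real a * (s - \<eta>)) g"
  have "emeasure \<mu> B ^ Suc a * window_integral (p + real (Suc a) * (s + \<eta>)) (q + real (Suc a) * (s - \<eta>)) g x
      = emeasure \<mu> B ^ a * (emeasure \<mu> B * window_integral ((p + real a * (s + \<eta>)) + (s + \<eta>)) ((q + real a * (s - \<eta>)) + (s - \<eta>)) g x)"
    by (simp add: algebra_simps)
  also have "\<dots> \<le> emeasure \<mu> B ^ a * into_op \<mu> B ?W x"
    by (intro mult_left_mono into_op_window_integral B) auto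
  also have "\<dots> = into_op \<mu> B (\<lambda>y. emeasure \<mu> B ^ a * ?W y) x"
    by (subst step_op_cmult) auto
  also have "\<dots> \<le> into_op \<mu> B ((into_op \<mu> B ^^ a) (window_integral p q g)) x"
    by (intro step_op_mono Suc) auto
  finally show ?case by simp
qed simp

text \<open>The same loss of \<open>\<eta>\<close> at each end, now with the step after the
  averaging over the window. Fubini brings the step outside, and for each fixed step the invariance
  of \<open>haar\<close> turns it into a translation of the window.\<close>

lemma window_integral_into_op:
  assumes [measurable]: "B \<in> sets borel" "g \<in> borel_measurable borel"
    and B: "B \<subseteq> {s - \<eta>..s + \<eta>}"
  shows "emeasure \<mu> B * window_integral (p + (s + \<eta>)) (q + (s - \<eta>)) g x
    \<le> window_integral p q (into_op \<mu> B g) x"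
proof -
  interpret haar: sigma_finite_measure haar by (rule sigma_finite_haar)
  interpret pair_sigma_finite haar \<mu> ..
  have "emeasure \<mu> B * window_integral (p + (s + \<eta>)) (q + (s - \<eta>)) g x
      = (\<integral>\<^sup>+ z. window_integral (p + (s + \<eta>)) (q + (s - \<eta>)) g x * indicator B z \<partial>\<mu>)"
    by (subst nn_integral_cmult_indicator) (auto simp: mult.commute)
  also have "\<dots> \<le> (\<integral>\<^sup>+ z. indicator B z *
      (\<integral>\<^sup>+ y. g (y + z) * indicator {x + p..x + q} y \<partial>haar) \<partial>\<mu>)"
  proof (rule nn_integral_mono_AE, use AE_step in eventually_elim)
    fix z assume z: "z \<in> Z"
    have "window_integral (p + (s + \<eta>)) (q + (s - \<eta>)) g x
        \<le> (\<integral>\<^sup>+ y. g (y + z) * indicator {x + p..x + q} y \<partial>haar)" if "z \<in> B"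
    proof -
      have "window_integral (p + (s + \<eta>)) (q + (s - \<eta>)) g x
          \<le> (\<integral>\<^sup>+ y. g y * indicator {x + p + z..x + q + z} y \<partial>haar)"
        unfolding window_integral_def
        by (intro nn_integral_mono mult_left_mono) (use that B in \<open>auto simp: indicator_def\<close>)
      also have "\<dots> = (\<integral>\<^sup>+ y. g (y + z) * indicator {x + p + z..x + q + z} (y + z) \<partial>haar)"
        by (rule haar_shift[OF z, symmetric]) measurable
      also have "\<dots> = (\<integral>\<^sup>+ y. g (y + z) * indicator {x + p..x + q} y \<partial>haar)"
        by (intro nn_integral_cong) (auto simp: indicator_def)
      finally show ?thesis .
    qed
    then show "window_integral (p + (s + \<eta>)) (q + (s - \<eta>)) g x * indicator B z
        \<le> indicator B z * (\<integral>\<^sup>+ y. g (y + z) * indicator {x + p..x + q} y \<partial>haar)"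
      by (auto simp: indicator_def)
  qed
  also have "\<dots> = (\<integral>\<^sup>+ z. (\<integral>\<^sup>+ y. indicator B z * (g (y + z) * indicator {x + p..x + q} y) \<partial>haar) \<partial>\<mu>)"
    by (intro nn_integral_cong nn_integral_cmult[symmetric]) measurable
  also have "\<dots> = (\<integral>\<^sup>+ y. (\<integral>\<^sup>+ z. indicator B z * (g (y + z) * indicator {x + p..x + q} y) \<partial>\<mu>) \<partial>haar)"
    by (subst Fubini') (auto simp: measurable_split_conv)
  also have "\<dots> = (\<integral>\<^sup>+ y. into_op \<mu> B g y * indicator {x + p..x + q} y \<partial>haar)"
    unfolding step_op_def
    by (intro nn_integral_cong, subst nn_integral_multc[symmetric]) (auto simp: mult.assoc)
  finally show ?thesis by (simp add: window_integral_def)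
qed

lemma window_integral_into_op_funpow:
  assumes [measurable]: "B \<in> sets borel" "g \<in> borel_measurable borel"
    and B: "B \<subseteq> {s - \<eta>..s + \<eta>}"
  shows "emeasure \<mu> B ^ b * window_integral (p + real b * (s + \<eta>)) (q + real b * (s - \<eta>)) g x
    \<le> window_integral p q ((into_op \<mu> B ^^ b) g) x"
proof (induction b arbitrary: p q)
  case (Suc b)
  have "emeasure \<mu> B ^ Suc b * window_integral (p + real (Suc b) * (s + \<eta>)) (q + real (Suc b) * (s - \<eta>)) g x
      = emeasure \<mu> B * (emeasure \<mu> B ^ b * window_integral ((p + (s + \<eta>)) + real b * (s + \<eta>)) ((q + (s - \<eta>)) + real b * (s - \<eta>)) g x)"
    by (simp add: algebra_simps)
  also have "\<dots> \<le> emeasure \<mu> B * window_integral (p + (s + \<eta>)) (q + (s - \<eta>)) ((into_op \<mu> B ^^ b) g) x"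
    by (intro mult_left_mono Suc) auto
  also have "\<dots> \<le> window_integral p q (into_op \<mu> B ((into_op \<mu> B ^^ b) g)) x"
    by (intro window_integral_into_op B) auto
  finally show ?case by simp
qed simp

end

section \<open>Recurrence: potentials and subharmonic functions\<close>

locale recurrent_lattice_walk = lattice_walk +
  fixes h :: real and A :: "real set"
  assumes h_pos: "0 < h" and A_eq: "A = {0..h}"
    and green: "(\<Sum>k. (free_op \<mu> ^^ k) (indicator {-1..1}) 0) = \<infinity>"
begin

lemma A_borel [measurable]: "A \<in> sets borel"
  by (simp add: A_eq)

lemma space_haar [simp]: "space haar = UNIV"
  using sets_eq_imp_space_eq[OF sets_haar] by simp

lemma free_op_haar:
  assumes [measurable]: "f \<in> borel_measurable borel"
  shows "(\<integral>\<^sup>+ x. free_op \<mu> f x \<partial>haar) = (\<integral>\<^sup>+ x. f x \<partial>haar)"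
proof -
  interpret haar: sigma_finite_measure haar by (rule sigma_finite_haar)
  interpret pair_sigma_finite haar \<mu> ..
  have "(\<integral>\<^sup>+ x. free_op \<mu> f x \<partial>haar) = (\<integral>\<^sup>+ z. (\<integral>\<^sup>+ x. f (x + z) \<partial>haar) \<partial>\<mu>)"
    unfolding step_op_def by (subst Fubini') (auto simp: measurable_split_conv)
  also have "\<dots> = (\<integral>\<^sup>+ z. (\<integral>\<^sup>+ x. f x \<partial>haar) \<partial>\<mu>)"
    using AE_step by (intro nn_integral_cong_AE) (auto simp: haar_shift)
  finally show ?thesis by (simp add: emeasure_space_1 del: space_eq_univ)
qed

text \<open>Since the walk preserves \<open>haar\<close>, a null set is hit in one step with
  probability 0 from almost every starting point. Hence inequalities that hold almost everywhere
  survive the operator, whatever the weight.\<close>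

lemma step_op_AE_mono:
  assumes [measurable]: "f \<in> borel_measurable borel" "g \<in> borel_measurable borel"
    and fg: "AE y in haar. f y \<le> g y"
  shows "AE x in haar. step_op \<mu> w f x \<le> step_op \<mu> w g x"
proof -
  have "(\<integral>\<^sup>+ x. free_op \<mu> (indicator {y. \<not> f y \<le> g y}) x \<partial>haar) = 0"
    using fg emeasure_eq_0_AE[of "\<lambda>y. \<not> f y \<le> g y" haar] by (subst free_op_haar) auto
  then have "AE x in haar. free_op \<mu> (indicator {y. \<not> f y \<le> g y}) x = 0"
    by (subst (asm) nn_integral_0_iff_AE) auto
  then show ?thesis
  proof eventually_elim
    case (elim x)
    then have "AE z in \<mu>. f (x + z) \<le> g (x + z)"
      unfolding step_op_def by (subst (asm) nn_integral_0_iff_AE) (auto simp: indicator_def)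
    then show ?case
      unfolding step_op_def by (intro nn_integral_mono_AE) (auto intro!: mult_left_mono)
  qed
qed

lemma spread_free:
  "\<exists>n c. 0 < c \<and> (\<forall>x\<in>Z. \<forall>g\<in>borel_measurable borel.
      ennreal c * (\<integral>\<^sup>+ y. g y * indicator {x - l..x + l} y \<partial>haar)
        \<le> (\<Sum>j\<le>n. (free_op \<mu> ^^ j) g x))"
proof -
  obtain K n c where *: "0 < c" "\<And>x g. x \<in> Z \<Longrightarrow> g \<in> borel_measurable borel \<Longrightarrow>
      ennreal c * (\<integral>\<^sup>+ y. g y * indicator {x - l..x + l} y \<partial>haar)
        \<le> (\<Sum>j\<le>n. (into_op \<mu> {-K..K} ^^ j) g x)"
    using spread[of l] by blast
  have "(into_op \<mu> {-K..K} ^^ j) g x \<le> (free_op \<mu> ^^ j) g x" for j g x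
    by (rule step_op_funpow_mono) (auto simp: indicator_def)
  then show ?thesis
    using *(1) by (intro exI[of _ n] exI[of _ c]) (auto intro!: order_trans[OF *(2)] sum_mono)
qed

text \<open>Near the origin, \<open>spread\<close> bounds finitely many terms of the potential of
  \<open>f\<close> below by a multiple of the integral of \<open>f\<close> over a window. If this
  integral were positive, the potential of \<open>f\<close> at 0 would dominate a multiple of the
  infinite sum in \<open>green\<close>.\<close>

lemma finite_potential_imp_AE_zero:
  assumes [measurable]: "f \<in> borel_measurable borel"
    and fin: "(\<Sum>k. (free_op \<mu> ^^ k) f 0) < \<infinity>"
  shows "AE x in haar. f x = 0"
proof -
  have "(\<integral>\<^sup>+ y. f y * indicator {- l..l} y \<partial>haar) = 0" (is "?I = 0") for l
  proof -
    \<comment> \<open>The extra 1 makes the window around any \<open>x \<in> {-1..1}\<close> contain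
      \<open>{- l..l}\<close>.\<close>
    obtain n c where c: "0 < c" "\<And>x g. x \<in> Z \<Longrightarrow> g \<in> borel_measurable borel \<Longrightarrow>
      ennreal c * (\<integral>\<^sup>+ y. g y * indicator {x - (l + 1)..x + (l + 1)} y \<partial>haar)
        \<le> (\<Sum>j\<le>n. (free_op \<mu> ^^ j) g x)"
      using spread_free[of "l + 1"] by blast
    have le: "ennreal c * ?I * indicator {-1..1} x \<le> (\<Sum>j\<le>n. (free_op \<mu> ^^ j) f x)" if "x \<in> Z" for x
    proof (cases "x \<in> {-1..1}")
      case True
      have "?I \<le> (\<integral>\<^sup>+ y. f y * indicator {x - (l + 1)..x + (l + 1)} y \<partial>haar)"
        using True by (intro nn_integral_mono) (auto simp: indicator_def)
      then have "ennreal c * ?I \<le> ennreal c * (\<integral>\<^sup>+ y. f y * indicator {x - (l + 1)..x + (l + 1)} y \<partial>haar)"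
        by (rule mult_left_mono) simp
      also note c(2)[OF that assms(1)]
      finally show ?thesis using True by simp
    qed auto
    have "ennreal c * ?I * (\<Sum>k. (free_op \<mu> ^^ k) (indicator {-1..1}) 0)
        = (\<Sum>k. (free_op \<mu> ^^ k) (\<lambda>x. ennreal c * ?I * indicator {-1..1} x) 0)"
      by (subst step_op_funpow_cmult) auto
    also have "\<dots> \<le> (\<Sum>k. (free_op \<mu> ^^ k) (\<lambda>x. \<Sum>j\<le>n. (free_op \<mu> ^^ j) f x) 0)"
      by (intro suminf_le step_op_funpow_mono_on[OF AE_step Z_add Z_zero] le) auto
    also have "\<dots> = (\<Sum>k. \<Sum>j\<le>n. (free_op \<mu> ^^ (k + j)) f 0)"
      by (subst step_op_funpow_sum) (auto simp: funpow_add)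
    also have "\<dots> = (\<Sum>j\<le>n. \<Sum>k. (free_op \<mu> ^^ (k + j)) f 0)"
      by (rule suminf_sum) auto
    also have "\<dots> \<le> (\<Sum>j\<le>n. \<Sum>k. (free_op \<mu> ^^ k) f 0)"
    proof (intro sum_mono)
      show "(\<Sum>k. (free_op \<mu> ^^ (k + j)) f 0) \<le> (\<Sum>k. (free_op \<mu> ^^ k) f 0)" for j
        by (subst (2) suminf_offset[of _ j]) auto
    qed
    also have "\<dots> < \<infinity>"
      using fin by (simp add: ennreal_mult_less_top of_nat_less_top)
    finally show ?thesis
      using c(1) by (auto simp: green ennreal_mult_eq_top_iff ennreal_mult_top split: if_splits)
  qed
  then have "AE y in haar. f y * indicator {- l..l} y = 0" for l
    by (subst (asm) nn_integral_0_iff_AE) auto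
  then have "AE y in haar. \<forall>l::nat. f y * indicator {- real l..real l} y = 0"
    unfolding AE_all_countable by blast
  then show ?thesis
  proof eventually_elim
    case (elim y)
    obtain l :: nat where "\<bar>y\<bar> \<le> real l" using real_arch_simple by blast
    then show ?case using elim[rule_format, of l] by (auto simp: indicator_def abs_le_iff split: if_splits)
  qed
qed

lemma subharmonic_AE_const:
  fixes u :: "real \<Rightarrow> real"
  assumes [measurable]: "u \<in> borel_measurable borel"
    and u: "\<And>x. 0 \<le> u x" "\<And>x. u x \<le> 1"
    and sub: "\<And>x. ennreal (u x) \<le> free_op \<mu> (\<lambda>y. ennreal (u y)) x"
  obtains C where "0 \<le> C" "C \<le> 1" "AE y in haar. u y = C"
proof -
  let ?P = "\<lambda>j. free_op \<mu> ^^ j"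
  define v where "v = (\<lambda>y. ennreal ((u y)\<^sup>2))"
  have [measurable]: "v \<in> borel_measurable borel" unfolding v_def by measurable
  have v1: "v y \<le> 1" for y using u[of y] by (simp add: v_def power_le_one)
  have sub_j: "ennreal (u x) \<le> ?P j (\<lambda>y. ennreal (u y)) x" for j x
  proof (induction j arbitrary: x)
    case (Suc j)
    have "ennreal (u x) \<le> free_op \<mu> (\<lambda>y. ennreal (u y)) x" by (rule sub)
    also have "\<dots> \<le> free_op \<mu> (?P j (\<lambda>y. ennreal (u y))) x" by (rule step_op_mono) (use Suc in auto)
    finally show ?case by simp
  qed simp
  \<comment> \<open>With \<open>P\<close> the free operator, the expanded square is
    \<open>P^j v - 2 u(x) P^j u + u(x)^2\<close> at \<open>x\<close>, and
    \<open>u \<le> P^j u\<close> makes it at most \<open>P^j v - v\<close>. Terms with a minus sign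
    are moved across, so that only finite quantities are cancelled.\<close>
  have var: "?P j (\<lambda>y. ennreal ((u y - u x)\<^sup>2)) x + v x \<le> ?P j v x" for j x
  proof -
    have "?P j (\<lambda>y. ennreal ((u y - u x)\<^sup>2)) x + v x + v x
        = ?P j (\<lambda>y. ennreal ((u y - u x)\<^sup>2)) x + ennreal (2 * u x) * ennreal (u x)"
      using u by (simp add: v_def power2_eq_square add.assoc flip: ennreal_mult ennreal_plus)
    also have "\<dots> \<le> ?P j (\<lambda>y. ennreal ((u y - u x)\<^sup>2)) x + ennreal (2 * u x) * ?P j (\<lambda>y. ennreal (u y)) x"
      by (intro add_mono mult_left_mono sub_j) auto
    also have "\<dots> = ?P j (\<lambda>y. ennreal ((u y - u x)\<^sup>2) + ennreal (2 * u x) * ennreal (u y)) x"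
      by (subst step_op_funpow_add) (auto simp: step_op_funpow_cmult)
    also have "(\<lambda>y. ennreal ((u y - u x)\<^sup>2) + ennreal (2 * u x) * ennreal (u y)) = (\<lambda>y. v y + v x)"
    proof
      fix y
      have "(u y - u x)\<^sup>2 + 2 * u x * u y = (u y)\<^sup>2 + (u x)\<^sup>2" by algebra
      from arg_cong[where f = ennreal, OF this]
      show "ennreal ((u y - u x)\<^sup>2) + ennreal (2 * u x) * ennreal (u y) = v y + v x"
        using u[of x] u[of y] by (simp add: v_def ennreal_mult)
    qed
    also have "?P j \<dots> x = ?P j v x + v x"
      by (subst step_op_funpow_add) auto
    finally show ?thesis
      by (rule ennreal_add_right_mono_cancel) (simp add: v_def)
  qed
  \<comment> \<open>The potential of this difference telescopes: at most the \<open>j\<close> final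
    terms remain, each at most 1, so the bound \<open>j\<close> is uniform in the cutoff
    \<open>m\<close>.\<close>
  have "AE x in haar. ?P j v x - v x = 0" for j
  proof (rule finite_potential_imp_AE_zero)
    have Pv1: "?P k v x \<le> 1" for k x
      using step_op_funpow_mono[of "\<lambda>_ _. 1" "\<lambda>_ _. 1" v "\<lambda>_. 1" k x] v1 by simp
    have vP: "v x \<le> ?P j v x" for x using var[of j x] by (auto intro: order_trans[rotated])
    have "(\<Sum>k<m. ?P k (\<lambda>x. ?P j v x - v x) 0) \<le> of_nat j" for m
    proof -
      have "?P k (\<lambda>x. ?P j v x - v x) 0 + ?P k v 0 = ?P (k + j) v 0" for k
        by (subst step_op_funpow_add[symmetric]) (auto simp: vP diff_add_cancel_ennreal funpow_add)
      then have "(\<Sum>k<m. ?P k (\<lambda>x. ?P j v x - v x) 0) + (\<Sum>k<m. ?P k v 0) = (\<Sum>k<m. ?P (k + j) v 0)"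
        by (simp add: sum.distrib[symmetric])
      also have "\<dots> \<le> (\<Sum>k<m + j. ?P k v 0)"
      proof -
        have "(\<Sum>k<m. ?P (k + j) v 0) = (\<Sum>k\<in>{j..<m + j}. ?P k v 0)"
          by (rule sum.reindex_bij_witness[of _ "\<lambda>k. k - j" "\<lambda>k. k + j"]) auto
        also have "\<dots> \<le> (\<Sum>k<m + j. ?P k v 0)" by (intro sum_mono2) auto
        finally show ?thesis .
      qed
      also have "\<dots> = (\<Sum>k<m. ?P k v 0) + (\<Sum>k\<in>{m..<m + j}. ?P k v 0)"
        by (subst sum.union_disjoint[symmetric]) (auto simp: ivl_disj_un)
      also have "(\<Sum>k\<in>{m..<m + j}. ?P k v 0) \<le> of_nat j"
        using sum_bounded_above[of "{m..<m + j}" "\<lambda>k. ?P k v 0" 1] Pv1 by simp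
      finally have "(\<Sum>k<m. ?P k (\<lambda>x. ?P j v x - v x) 0) + (\<Sum>k<m. ?P k v 0) \<le> of_nat j + (\<Sum>k<m. ?P k v 0)"
        by (simp add: add.commute add_mono)
      moreover have "(\<Sum>k<m. ?P k v 0) < top"
        using Pv1 by (auto simp: ennreal_sum_less_top intro: le_less_trans[OF Pv1 ennreal_one_less_top])
      ultimately show ?thesis by (rule ennreal_add_right_mono_cancel)
    qed
    then have "(\<Sum>k. ?P k (\<lambda>x. ?P j v x - v x) 0) \<le> of_nat j"
      by (intro suminf_le_const) auto
    then show "(\<Sum>k. ?P k (\<lambda>x. ?P j v x - v x) 0) < \<infinity>"
      by (auto intro: le_less_trans of_nat_less_top)
  qed measurable
  then have "AE x in haar. \<forall>j. ?P j v x - v x = 0" by (simp add: AE_all_countable)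
  with AE_haar have ae: "AE x in haar. x \<in> Z \<and> (\<forall>j. ?P j v x - v x = 0)" by eventually_elim auto
  \<comment> \<open>One good point is enough, because the rest of the argument runs from this single
    \<open>x\<close>. It exists since \<open>haar\<close> has infinite mass.\<close>
  have "\<exists>x. x \<in> Z \<and> (\<forall>j. ?P j v x - v x = 0)"
  proof (rule ccontr)
    assume none: "\<not> ?thesis"
    from ae have "AE x in haar. False" by eventually_elim (use none in auto)
    then show False using haar_UNIV by (auto simp: AE_iff_null null_sets_def)
  qed
  then obtain x where x: "x \<in> Z" "\<And>j. ?P j v x - v x = 0" by blast
  have zero: "?P j (\<lambda>y. ennreal ((u y - u x)\<^sup>2)) x = 0" for j
  proof -
    have "?P j v x \<le> v x" using x(2)[of j] by (simp add: v_def diff_eq_0_iff_ennreal)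
    then have "?P j (\<lambda>y. ennreal ((u y - u x)\<^sup>2)) x + v x \<le> 0 + v x"
      using var[of j x] unfolding add_0 by (rule order_trans[rotated])
    then have "?P j (\<lambda>y. ennreal ((u y - u x)\<^sup>2)) x \<le> 0"
      by (rule ennreal_add_right_mono_cancel) (simp add: v_def)
    then show ?thesis by simp
  qed
  \<comment> \<open>All powers vanish at \<open>x\<close>, so \<open>spread\<close> at
    \<open>x\<close> makes the squared deviation vanish almost everywhere on every window around
    \<open>x\<close>.\<close>
  have "(\<integral>\<^sup>+ y. ennreal ((u y - u x)\<^sup>2) * indicator {x - l..x + l} y \<partial>haar) = 0" for l
  proof -
    obtain n c where "0 < c" "\<And>g. g \<in> borel_measurable borel \<Longrightarrow>
      ennreal c * (\<integral>\<^sup>+ y. g y * indicator {x - l..x + l} y \<partial>haar) \<le> (\<Sum>j\<le>n. ?P j g x)"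
      using spread_free[of l] x(1) by blast
    from this(1) this(2)[of "\<lambda>y. ennreal ((u y - u x)\<^sup>2)"] show ?thesis by (simp add: zero)
  qed
  then have "AE y in haar. ennreal ((u y - u x)\<^sup>2) * indicator {x - l..x + l} y = 0" for l
    by (subst (asm) nn_integral_0_iff_AE) auto
  then have "AE y in haar. \<forall>l::nat. ennreal ((u y - u x)\<^sup>2) * indicator {x - real l..x + real l} y = 0"
    unfolding AE_all_countable by blast
  then have "AE y in haar. u y = u x"
  proof eventually_elim
    case (elim y)
    obtain l :: nat where "\<bar>y - x\<bar> \<le> real l" using real_arch_simple by blast
    then show ?case using elim[rule_format, of l]
      by (auto simp: indicator_def abs_le_iff ennreal_eq_0_iff split: if_splits)
  qed
  with u show ?thesis by (intro that) auto
qed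

end

section \<open>Total mass of the chain operator\<close>

context real_distribution
begin

lemma chain_op_mono_on:
  assumes Z: "AE z in M. z \<in> Z" "\<And>x z. x \<in> Z \<Longrightarrow> z \<in> Z \<Longrightarrow> x + z \<in> Z" "x \<in> Z"
    and f: "\<And>y. y \<in> Z \<Longrightarrow> f y \<le> g y"
  shows "chain_op M A f x \<le> chain_op M A g x"
  unfolding chain_op_def
  by (intro suminf_le summableI step_op_funpow_mono_on[OF Z] step_op_mono_on[OF Z(1,2)] f) auto

lemma chain_op_add:
  assumes [measurable]: "A \<in> sets borel" "f \<in> borel_measurable borel" "g \<in> borel_measurable borel"
  shows "chain_op M A (\<lambda>y. f y + g y) x = chain_op M A f x + chain_op M A g x"
proof -
  have "enter_op M A (\<lambda>y. f y + g y) = (\<lambda>y. enter_op M A f y + enter_op M A g y)"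
    by (rule ext, rule step_op_add) auto
  then show ?thesis
    unfolding chain_op_def by (subst suminf_add) (auto simp: step_op_funpow_add)
qed

lemma chain_op_cmult:
  assumes [measurable]: "A \<in> sets borel" "f \<in> borel_measurable borel"
  shows "chain_op M A (\<lambda>y. c * f y) x = c * chain_op M A f x"
proof -
  have "enter_op M A (\<lambda>y. c * f y) = (\<lambda>y. c * enter_op M A f y)"
    by (rule ext, rule step_op_cmult) auto
  then show ?thesis
    unfolding chain_op_def by (simp add: step_op_funpow_cmult)
qed

lemma chain_op_fixpoint:
  assumes [measurable]: "A \<in> sets borel" "f \<in> borel_measurable borel"
  shows "chain_op M A f x = enter_op M A f x + stay_op M A (chain_op M A f) x"
  unfolding chain_op_def[abs_def]
  by (subst suminf_Suc_ennreal) (simp add: step_op_suminf)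

lemma enter_stay_one:
  assumes [measurable]: "A \<in> sets borel"
  shows "enter_op M A (\<lambda>_. 1) x + stay_op M A (\<lambda>_. 1) x = 1"
  by (simp add: enter_add_stay)

text \<open>Within \<open>m\<close> steps either the first entrance happens, after
  \<open>k < m\<close> steps that do not enter, or no step enters. The mass missing from a partial
  sum of \<open>chain_op\<close> is thus that of the paths that have not entered yet.\<close>

lemma chain_op_telescope:
  assumes [measurable]: "A \<in> sets borel"
  shows "(\<Sum>k<m. (stay_op M A ^^ k) (enter_op M A (\<lambda>_. 1)) x) + (stay_op M A ^^ m) (\<lambda>_. 1) x = 1"
proof (induction m)
  case (Suc m)
  have "(stay_op M A ^^ m) (enter_op M A (\<lambda>_. 1)) x + (stay_op M A ^^ Suc m) (\<lambda>_. 1) x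
      = (stay_op M A ^^ m) (\<lambda>y. enter_op M A (\<lambda>_. 1) y + stay_op M A (\<lambda>_. 1) y) x"
    by (subst step_op_funpow_add) (auto simp: funpow_swap1)
  then show ?case using Suc by (simp add: enter_stay_one add.assoc)
qed simp

lemma chain_op_one_le:
  assumes [measurable]: "A \<in> sets borel"
  shows "chain_op M A (\<lambda>_. 1) x \<le> 1"
  unfolding chain_op_def
proof (intro suminf_le_const summableI)
  fix m
  have "(\<Sum>k<m. (stay_op M A ^^ k) (enter_op M A (\<lambda>_. 1)) x)
      \<le> (\<Sum>k<m. (stay_op M A ^^ k) (enter_op M A (\<lambda>_. 1)) x) + (stay_op M A ^^ m) (\<lambda>_. 1) x"
    by simp
  also have "\<dots> = 1" by (rule chain_op_telescope[OF assms])
  finally show "(\<Sum>k<m. (stay_op M A ^^ k) (enter_op M A (\<lambda>_. 1)) x) \<le> 1" .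
qed

text \<open>After a step that enters, the left side asks for one more entrance while the right side
  is already satisfied; after any other step both agree. So the probability of never entering is
  subharmonic.\<close>

lemma chain_op_one_superharmonic:
  assumes [measurable]: "A \<in> sets borel"
  shows "free_op M (chain_op M A (\<lambda>_. 1)) x \<le> chain_op M A (\<lambda>_. 1) x"
proof -
  have "free_op M (chain_op M A (\<lambda>_. 1)) x
      = enter_op M A (chain_op M A (\<lambda>_. 1)) x + stay_op M A (chain_op M A (\<lambda>_. 1)) x"
    by (simp add: enter_add_stay)
  also have "\<dots> \<le> enter_op M A (\<lambda>_. 1) x + stay_op M A (chain_op M A (\<lambda>_. 1)) x"
    by (intro add_mono step_op_mono chain_op_one_le) auto
  finally show ?thesis by (simp add: chain_op_fixpoint[of A "\<lambda>_. 1"])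
qed

end

context recurrent_lattice_walk
begin

lemma haar_A_pos: "0 < emeasure haar A"
  using haar_interval_pos[OF h_pos] by (simp add: A_eq)

lemma haar_A_finite: "emeasure haar A < \<infinity>"
  using haar_bounded[of 0 h] by (simp add: A_eq)

text \<open>If almost no point could enter, the free operator would map the indicator of
  \<open>A\<close> below itself almost everywhere, and so would all its powers by
  \<open>step_op_AE_mono\<close>. From a suitable point outside, the walk would never be in
  \<open>A\<close>, against \<open>spread\<close>.\<close>

lemma enter_op_not_AE_zero: "\<not> (AE x in haar. enter_op \<mu> A (\<lambda>_. 1) x = 0)"
proof
  assume E0: "AE x in haar. enter_op \<mu> A (\<lambda>_. 1) x = 0"
  have stay_le: "stay_op \<mu> A (indicator A) x \<le> indicator A x" for x
  proof (cases "x \<in> A")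
    case True
    have "stay_op \<mu> A (indicator A) x \<le> free_op \<mu> (\<lambda>_. 1) x"
      by (intro step_op_mono) (auto simp: indicator_def)
    then show ?thesis using True by simp
  next
    case False
    then have "stay_op \<mu> A (indicator A) x = 0"
      unfolding step_op_def by (subst nn_integral_0_iff_AE) (auto simp: indicator_def)
    then show ?thesis by simp
  qed
  have P_le: "AE x in haar. free_op \<mu> (indicator A) x \<le> indicator A x"
    using E0
  proof eventually_elim
    case (elim x)
    have "enter_op \<mu> A (indicator A) x \<le> enter_op \<mu> A (\<lambda>_. 1) x"
      by (intro step_op_mono) (auto simp: indicator_def)
    then show ?case
      using elim stay_le[of x] by (subst enter_add_stay[symmetric, of A]) auto
  qed
  have "AE x in haar. (free_op \<mu> ^^ j) (indicator A) x \<le> indicator A x" for j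
  proof (induction j)
    case (Suc j)
    have "AE x in haar. free_op \<mu> ((free_op \<mu> ^^ j) (indicator A)) x \<le> free_op \<mu> (indicator A) x"
      by (rule step_op_AE_mono[OF _ _ Suc]) auto
    with P_le show ?case by eventually_elim simp
  qed simp
  then have "AE x in haar. \<forall>j. (free_op \<mu> ^^ j) (indicator A) x \<le> indicator A x"
    by (simp add: AE_all_countable)
  with AE_haar have ae: "AE x in haar. x \<in> Z \<and> (\<forall>j. (free_op \<mu> ^^ j) (indicator A) x \<le> indicator A x)"
    by eventually_elim auto
  \<comment> \<open>Such a point exists since \<open>A\<close> has finite and the whole line
    infinite \<open>haar\<close> measure.\<close>
  have "\<exists>x. x \<notin> A \<and> x \<in> Z \<and> (\<forall>j. (free_op \<mu> ^^ j) (indicator A) x \<le> indicator A x)"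
  proof (rule ccontr)
    assume none: "\<not> ?thesis"
    from ae have "AE x in haar. x \<in> A" by eventually_elim (use none in blast)
    then have "emeasure haar UNIV = emeasure haar A"
      by (intro emeasure_eq_AE) auto
    then show False using haar_UNIV haar_A_finite by simp
  qed
  then obtain x where x: "x \<notin> A" "x \<in> Z" "\<And>j. (free_op \<mu> ^^ j) (indicator A) x \<le> indicator A x"
    by blast
  \<comment> \<open>The radius makes the window around \<open>x\<close> contain
    \<open>{0..h}\<close> whatever the sign of \<open>x\<close>.\<close>
  obtain n c where "0 < c" "\<And>g. g \<in> borel_measurable borel \<Longrightarrow>
      ennreal c * (\<integral>\<^sup>+ y. g y * indicator {x - (\<bar>x\<bar> + h)..x + (\<bar>x\<bar> + h)} y \<partial>haar)
        \<le> (\<Sum>j\<le>n. (free_op \<mu> ^^ j) g x)"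
    using spread_free[of "\<bar>x\<bar> + h"] x(2) by blast
  from this(1) this(2)[of "indicator A"]
  have "(\<integral>\<^sup>+ y. indicator A y * indicator {x - (\<bar>x\<bar> + h)..x + (\<bar>x\<bar> + h)} y \<partial>haar) = 0"
    using x(1,3) by simp
  also have "(\<lambda>y. indicator A y * indicator {x - (\<bar>x\<bar> + h)..x + (\<bar>x\<bar> + h)} y) = (indicator A :: real \<Rightarrow> ennreal)"
    by (auto simp: indicator_def fun_eq_iff A_eq)
  finally show False using haar_A_pos by simp
qed

text \<open>The probability \<open>u\<close> of never entering is subharmonic, hence a constant
  \<open>C\<close> almost everywhere. Inserted into the first-step equation, with \<open>e\<close>
  the probability of entering at once, this gives \<open>1 - C = e + (1 - C) * (1 - e)\<close>, that
  is \<open>C * e = 0\<close>; and \<open>e\<close> does not vanish almost everywhere.\<close>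

lemma chain_op_one_AE: "AE x in haar. chain_op \<mu> A (\<lambda>_. 1) x = 1"
proof -
  define F where "F = chain_op \<mu> A (\<lambda>_. 1)"
  have [measurable]: "F \<in> borel_measurable borel" unfolding F_def by measurable
  have F1: "F x \<le> 1" for x unfolding F_def by (rule chain_op_one_le) simp
  define u where "u x = 1 - enn2real (F x)" for x
  have F_u: "F x = ennreal (1 - u x)" for x
    using le_less_trans[OF F1[of x] ennreal_one_less_top] by (simp add: u_def)
  have u01: "0 \<le> u x" "u x \<le> 1" for x
    using F1[of x] enn2real_mono[OF F1[of x]] by (simp_all add: u_def)
  have u_F: "ennreal (u x) + F x = 1" for x
    using u01[of x] by (simp add: F_u flip: ennreal_plus)
  have [measurable]: "u \<in> borel_measurable borel" unfolding u_def by measurable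
  have "ennreal (u x) \<le> free_op \<mu> (\<lambda>y. ennreal (u y)) x" for x
  proof -
    have "ennreal (u x) + F x = free_op \<mu> (\<lambda>y. ennreal (u y) + F y) x"
      by (simp add: u_F)
    also have "\<dots> = free_op \<mu> (\<lambda>y. ennreal (u y)) x + free_op \<mu> F x"
      by (rule step_op_add) measurable
    also have "\<dots> \<le> free_op \<mu> (\<lambda>y. ennreal (u y)) x + F x"
      unfolding F_def by (intro add_mono chain_op_one_superharmonic) auto
    finally show ?thesis
      by (rule ennreal_add_right_mono_cancel) (simp add: F_u)
  qed
  then obtain C where C: "0 \<le> C" "C \<le> 1" "AE y in haar. u y = C"
    using subharmonic_AE_const[of u] u01 by auto
  have "AE x in haar. stay_op \<mu> A F x \<le> stay_op \<mu> A (\<lambda>_. ennreal (1 - C)) x"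
    by (rule step_op_AE_mono) (use C(3) in \<open>auto simp: F_u elim: AE_mp\<close>)
  moreover have "AE x in haar. stay_op \<mu> A (\<lambda>_. ennreal (1 - C)) x \<le> stay_op \<mu> A F x"
    by (rule step_op_AE_mono) (use C(3) in \<open>auto simp: F_u elim: AE_mp\<close>)
  ultimately have "AE x in haar. ennreal C * enter_op \<mu> A (\<lambda>_. 1) x = 0"
    using C(3)
  proof eventually_elim
    case (elim x)
    have stay: "stay_op \<mu> A F x = ennreal (1 - C) * stay_op \<mu> A (\<lambda>_. 1) x"
      using elim step_op_cmult[of "\<lambda>x z. if x \<notin> A \<and> x + z \<in> A then 0 else 1" "\<lambda>_. 1" "ennreal (1 - C)" x]
      by (auto intro: antisym)
    have eq: "ennreal (1 - C) = enter_op \<mu> A (\<lambda>_. 1) x + ennreal (1 - C) * stay_op \<mu> A (\<lambda>_. 1) x"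
      using chain_op_fixpoint[of A "\<lambda>_. 1" x] elim(3) stay by (simp add: F_def[symmetric] F_u)
    have one: "enter_op \<mu> A (\<lambda>_. 1) x + stay_op \<mu> A (\<lambda>_. 1) x = 1"
      by (rule enter_stay_one) simp
    obtain e s where es: "0 \<le> e" "0 \<le> s" "enter_op \<mu> A (\<lambda>_. 1) x = ennreal e" "stay_op \<mu> A (\<lambda>_. 1) x = ennreal s"
      using one by (cases "enter_op \<mu> A (\<lambda>_. 1) x"; cases "stay_op \<mu> A (\<lambda>_. 1) x") auto
    have s: "s = 1 - e"
      using one es by (simp flip: ennreal_plus)
    have "1 - C = e + (1 - C) * s"
      using eq es C by (simp flip: ennreal_plus ennreal_mult)
    then have "C * e = 0" unfolding s by (simp add: algebra_simps)
    then show ?case using C es by (simp flip: ennreal_mult)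
  qed
  then have "C = 0"
    using enter_op_not_AE_zero C(1) by (cases "C = 0") auto
  with C(3) show ?thesis
    by (auto simp: F_def[symmetric] F_u)
qed

text \<open>Single points may be null, so an exceptional set remains to be removed. Averaging over a
  window shows that the entrance probability is bounded away from 0 on all of \<open>Z\<close>. A
  path that has not entered after \<open>m\<close> steps still enters later with at least this
  probability; but the probability of a first entrance after step \<open>m\<close> tends to 0, so
  never entering has probability 0.\<close>

lemma chain_op_one:
  assumes "x \<in> Z"
  shows "chain_op \<mu> A (\<lambda>_. 1) x = 1"
proof -
  define F where "F = chain_op \<mu> A (\<lambda>_. 1)"
  have [measurable]: "F \<in> borel_measurable borel" unfolding F_def by measurable
  have F1: "F x \<le> 1" for x unfolding F_def by (rule chain_op_one_le) simp
  have PF: "(free_op \<mu> ^^ j) F x \<le> F x" for j x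
  proof (induction j arbitrary: x)
    case (Suc j)
    have "free_op \<mu> ((free_op \<mu> ^^ j) F) x \<le> free_op \<mu> F x" by (rule step_op_mono) (use Suc in auto)
    also have "\<dots> \<le> F x" unfolding F_def by (rule chain_op_one_superharmonic) simp
    finally show ?case by simp
  qed simp
  obtain n c where c: "0 < c" "\<And>x g. x \<in> Z \<Longrightarrow> g \<in> borel_measurable borel \<Longrightarrow>
      ennreal c * (\<integral>\<^sup>+ y. g y * indicator {x - h..x + h} y \<partial>haar)
        \<le> (\<Sum>j\<le>n. (free_op \<mu> ^^ j) g x)"
    using spread_free[of h] by blast
  define e where "e = ennreal c * emeasure haar A"
  have e: "0 < e" "e < top"
    using c(1) haar_A_pos haar_A_finite by (auto simp: e_def ennreal_zero_less_mult_iff ennreal_mult_less_top)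
  \<comment> \<open>The window of radius \<open>h\<close> contains the translate
    \<open>{x..x + h}\<close> of \<open>A\<close>, on which \<open>F = 1\<close> almost everywhere;
    superharmonicity then replaces each iterate of \<open>F\<close> by \<open>F\<close>.\<close>
  have lower: "e \<le> of_nat (Suc n) * F x" if "x \<in> Z" for x
  proof -
    have "emeasure haar A = (\<integral>\<^sup>+ y. indicator {x..x + h} (y + x) \<partial>haar)"
    proof -
      have "(\<lambda>y. indicator {x..x + h} (y + x)) = (indicator A :: real \<Rightarrow> ennreal)"
        by (auto simp: indicator_def fun_eq_iff A_eq)
      then show ?thesis by simp
    qed
    also have "\<dots> = (\<integral>\<^sup>+ y. indicator {x..x + h} y \<partial>haar)"
      by (rule haar_shift) (use that in auto)
    also have "\<dots> \<le> (\<integral>\<^sup>+ y. F y * indicator {x - h..x + h} y \<partial>haar)"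
      using chain_op_one_AE h_pos
      by (intro nn_integral_mono_AE) (auto simp: F_def indicator_def elim!: AE_mp)
    finally have "e \<le> ennreal c * (\<integral>\<^sup>+ y. F y * indicator {x - h..x + h} y \<partial>haar)"
      unfolding e_def by (rule mult_left_mono) simp
    also have "\<dots> \<le> (\<Sum>j\<le>n. (free_op \<mu> ^^ j) F x)" using c(2)[OF that, of F] by simp
    also have "\<dots> \<le> of_nat (Suc n) * F x"
      using sum_bounded_above[of "{..n}" "\<lambda>j. (free_op \<mu> ^^ j) F x" "F x"] PF by simp
    finally show ?thesis .
  qed
  define a where "a k = (stay_op \<mu> A ^^ k) (enter_op \<mu> A (\<lambda>_. 1)) x" for k
  have Fx: "F x = (\<Sum>k. a k)" by (simp add: F_def chain_op_def a_def)
  have tail: "(stay_op \<mu> A ^^ m) F x = (\<Sum>k. a (k + m))" for m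
  proof -
    have "(stay_op \<mu> A ^^ m) F x = (\<Sum>k. (stay_op \<mu> A ^^ m) ((stay_op \<mu> A ^^ k) (enter_op \<mu> A (\<lambda>_. 1))) x)"
      unfolding F_def chain_op_def[abs_def] passage_op_0[symmetric] by (rule passage_op_suminf) auto
    moreover have "(stay_op \<mu> A ^^ m) ((stay_op \<mu> A ^^ k) (enter_op \<mu> A (\<lambda>_. 1))) x = a (k + m)" for k
      by (simp add: a_def add.commute[of k] funpow_add)
    ultimately show ?thesis by simp
  qed
  have low_m: "e * (stay_op \<mu> A ^^ m) (\<lambda>_. 1) x \<le> of_nat (Suc n) * (\<Sum>k. a (k + m))" for m
  proof -
    have "e * (stay_op \<mu> A ^^ m) (\<lambda>_. 1) x = (stay_op \<mu> A ^^ m) (\<lambda>_. e * 1) x"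
      by (rule step_op_funpow_cmult[symmetric]) auto
    also have "\<dots> \<le> (stay_op \<mu> A ^^ m) (\<lambda>y. of_nat (Suc n) * F y) x"
      by (rule step_op_funpow_mono_on[OF AE_step Z_add assms]) (use lower in auto)
    also have "\<dots> = of_nat (Suc n) * (stay_op \<mu> A ^^ m) F x"
      by (rule step_op_funpow_cmult) auto
    finally show ?thesis by (simp add: tail)
  qed
  \<comment> \<open>Never entering implies not entering within \<open>m\<close> steps, for every
    \<open>m\<close>.\<close>
  have stay_ge: "1 - F x \<le> (stay_op \<mu> A ^^ m) (\<lambda>_. 1) x" for m
  proof -
    have "1 = (\<Sum>k<m. a k) + (stay_op \<mu> A ^^ m) (\<lambda>_. 1) x"
      unfolding a_def by (rule chain_op_telescope[symmetric]) simp
    also have "\<dots> \<le> F x + (stay_op \<mu> A ^^ m) (\<lambda>_. 1) x"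
      unfolding Fx by (intro add_mono sum_le_suminf summableI) auto
    finally show ?thesis by (simp add: ennreal_minus_le_iff)
  qed
  define r where "r k = enn2real (a k)" for k
  have a_top: "a k < top" for k
  proof -
    have "a k \<le> F x" unfolding Fx using sum_le_suminf[of a "{k}"] by simp
    then show ?thesis using F1[of x] by (auto intro: le_less_trans[OF _ ennreal_one_less_top])
  qed
  then have a_r: "a k = ennreal (r k)" for k by (simp add: r_def)
  have r0: "0 \<le> r k" for k by (simp add: r_def)
  have "(\<Sum>k. ennreal (r k)) \<noteq> top"
    using F1[of x] by (auto simp: Fx a_r[abs_def] top_unique)
  then have summ: "summable r" by (intro summable_suminf_not_top r0)
  have "e * (1 - F x) \<le> of_nat (Suc n) * ennreal d" if d: "0 < d" for d
  proof -
    obtain m where "norm (\<Sum>i. r (i + m)) < d"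
      using suminf_exist_split[OF d summ] by auto
    moreover have "(\<Sum>k. a (k + m)) = ennreal (\<Sum>i. r (i + m))"
      unfolding a_r by (rule suminf_ennreal2) (use summ r0 in \<open>auto simp: summable_iff_shift\<close>)
    ultimately have "(\<Sum>k. a (k + m)) \<le> ennreal d" by (auto intro!: ennreal_leI)
    then have "of_nat (Suc n) * (\<Sum>k. a (k + m)) \<le> of_nat (Suc n) * ennreal d"
      by (rule mult_left_mono) simp
    moreover have "e * (1 - F x) \<le> e * (stay_op \<mu> A ^^ m) (\<lambda>_. 1) x"
      by (intro mult_left_mono stay_ge) simp
    ultimately show ?thesis using low_m[of m] by simp
  qed
  then have eps: "e * (1 - F x) \<le> of_nat (Suc n) * ennreal d" if "0 < d" for d
    using that by blast
  have "e * (1 - F x) \<le> 0"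
  proof (rule ennreal_le_epsilon)
    fix d :: real assume "0 < d"
    then have "e * (1 - F x) \<le> of_nat (Suc n) * ennreal (d / real (Suc n))"
      by (intro eps) simp
    also have "of_nat (Suc n) * ennreal (d / real (Suc n)) = ennreal (real (Suc n) * (d / real (Suc n)))"
      using \<open>0 < d\<close> by (subst ennreal_mult) (auto simp: ennreal_of_nat_eq_real_of_nat)
    finally show "e * (1 - F x) \<le> 0 + ennreal d" by simp
  qed
  then have "e * (1 - F x) = 0" by simp
  then have "1 - F x = 0" using e by auto
  then have "1 \<le> F x" by (simp add: diff_eq_0_iff_ennreal)
  then show ?thesis using F1[of x] by (simp add: F_def)
qed

subsection \<open>Invariant measure and minorization\<close>

text \<open>
  Up to normalization, \<open>flux\<close> is integration against \<open>\<pi>\<^sub>h\<close>: the mass that a walk started from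
  \<open>haar\<close> carries into \<open>A\<close> in one step.
\<close>

definition flux :: "(real \<Rightarrow> ennreal) \<Rightarrow> ennreal" where
  "flux g = (\<integral>\<^sup>+ x. enter_op \<mu> A g x \<partial>haar)"

lemma flux_mono:
  assumes "\<And>y. y \<in> Z \<inter> A \<Longrightarrow> f y \<le> g y"
  shows "flux f \<le> flux g"
  unfolding flux_def
proof (rule nn_integral_mono_AE, use AE_haar in eventually_elim)
  fix x assume x: "x \<in> Z"
  show "enter_op \<mu> A f x \<le> enter_op \<mu> A g x"
    unfolding step_op_def
    by (rule nn_integral_mono_AE, use AE_step in eventually_elim) (use x Z_add assms in auto)
qed

text \<open>The chain evaluates its argument only at positions of entrance, which almost surely lie
  in \<open>Z \<inter> A\<close>.\<close>

lemma chain_op_mono_entrance: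
  assumes x: "x \<in> Z" and fg: "\<And>y. y \<in> Z \<inter> A \<Longrightarrow> f y \<le> g y"
  shows "chain_op \<mu> A f x \<le> chain_op \<mu> A g x"
  unfolding chain_op_def
proof (intro suminf_le summableI step_op_funpow_mono_on[OF AE_step Z_add x])
  fix y assume y: "y \<in> Z"
  show "enter_op \<mu> A f y \<le> enter_op \<mu> A g y"
    unfolding step_op_def
    by (rule nn_integral_mono_AE, use AE_step in eventually_elim) (use y Z_add fg in auto)
qed auto

lemma flux_add:
  assumes [measurable]: "f \<in> borel_measurable borel" "g \<in> borel_measurable borel"
  shows "flux (\<lambda>y. f y + g y) = flux f + flux g"
proof -
  have "enter_op \<mu> A (\<lambda>y. f y + g y) = (\<lambda>x. enter_op \<mu> A f x + enter_op \<mu> A g x)"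
    by (rule ext, rule step_op_add) auto
  then show ?thesis unfolding flux_def by (simp add: nn_integral_add)
qed

lemma flux_cmult:
  assumes [measurable]: "f \<in> borel_measurable borel"
  shows "flux (\<lambda>y. c * f y) = c * flux f"
proof -
  have "enter_op \<mu> A (\<lambda>y. c * f y) = (\<lambda>x. c * enter_op \<mu> A f x)"
    by (rule ext, rule step_op_cmult) auto
  then show ?thesis unfolding flux_def by (simp add: nn_integral_cmult)
qed

lemma flux_one_finite: "flux (\<lambda>_. 1) < \<infinity>"
proof -
  have "flux (\<lambda>_. 1) \<le> (\<integral>\<^sup>+ x. free_op \<mu> (indicator A) x \<partial>haar)"
    unfolding flux_def step_op_def by (intro nn_integral_mono) (auto simp: indicator_def)
  also have "\<dots> = emeasure haar A" by (subst free_op_haar) auto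
  finally show ?thesis using haar_A_finite by (rule le_less_trans)
qed

lemma flux_one_pos: "0 < flux (\<lambda>_. 1)"
  using enter_op_not_AE_zero unfolding flux_def
  by (subst zero_less_iff_neq_zero, subst nn_integral_0_iff_AE) auto

text \<open>Conservation of mass. Write \<open>f n\<close> for the partial sums of
  \<open>chain_op\<close> and \<open>N\<close> for \<open>stay_op\<close>; invariance of
  \<open>haar\<close> gives \<open>flux (f n) + \<integral> N (f n) = \<integral> f n \<le>
  \<integral> f (Suc n) = flux g + \<integral> N (f n)\<close>. The cutoff matters: the integral of
  the full series can be infinite and could not be cancelled.\<close>

lemma flux_chain_op_le:
  assumes [measurable]: "g \<in> borel_measurable borel" and g: "\<And>y. g y \<le> 1"
  shows "flux (chain_op \<mu> A g) \<le> flux g"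
proof -
  define f where "f n x = (\<Sum>k<n. (stay_op \<mu> A ^^ k) (enter_op \<mu> A g) x)" for n x
  have [measurable]: "f n \<in> borel_measurable borel" for n unfolding f_def by measurable
  have f_Suc: "f (Suc n) x = enter_op \<mu> A g x + stay_op \<mu> A (f n) x" for n x
  proof -
    have "f n = (\<lambda>x. \<Sum>k<n. (stay_op \<mu> A ^^ k) (enter_op \<mu> A g) x)"
      by (simp add: f_def fun_eq_iff)
    then have "stay_op \<mu> A (f n) x = (\<Sum>k<n. (stay_op \<mu> A ^^ Suc k) (enter_op \<mu> A g) x)"
      by (simp add: step_op_sum)
    then show ?thesis
      unfolding f_def by (subst sum.lessThan_Suc_shift) simp
  qed
  have free: "flux (f n) + (\<integral>\<^sup>+ x. stay_op \<mu> A (f n) x \<partial>haar) = (\<integral>\<^sup>+ x. f n x \<partial>haar)" for n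
    unfolding flux_def by (subst nn_integral_add[symmetric]) (auto simp: enter_add_stay free_op_haar)
  have int_Suc: "(\<integral>\<^sup>+ x. f (Suc n) x \<partial>haar) = flux g + (\<integral>\<^sup>+ x. stay_op \<mu> A (f n) x \<partial>haar)" for n
    unfolding flux_def f_Suc by (rule nn_integral_add) auto
  have flux_g: "flux g < top"
    using le_less_trans[OF flux_mono flux_one_finite, of g] g by simp
  have int_fin: "(\<integral>\<^sup>+ x. f n x \<partial>haar) < top" for n
  proof (induction n)
    case (Suc n)
    have "(\<integral>\<^sup>+ x. stay_op \<mu> A (f n) x \<partial>haar) \<le> (\<integral>\<^sup>+ x. f n x \<partial>haar)"
      unfolding free[of n, symmetric] by simp
    with Suc flux_g show ?case by (auto simp: int_Suc)
  qed (simp add: f_def)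
  have le: "flux (f n) \<le> flux g" for n
  proof -
    have "(\<integral>\<^sup>+ x. f n x \<partial>haar) \<le> (\<integral>\<^sup>+ x. f (Suc n) x \<partial>haar)"
      by (intro nn_integral_mono) (simp add: f_def)
    then have "flux (f n) + (\<integral>\<^sup>+ x. stay_op \<mu> A (f n) x \<partial>haar)
        \<le> flux g + (\<integral>\<^sup>+ x. stay_op \<mu> A (f n) x \<partial>haar)"
      by (simp only: free int_Suc)
    moreover have "(\<integral>\<^sup>+ x. stay_op \<mu> A (f n) x \<partial>haar) < top"
      using int_fin[of "Suc n"] by (auto simp: int_Suc)
    ultimately show ?thesis by (rule ennreal_add_right_mono_cancel)
  qed
  have "flux (chain_op \<mu> A g) = (\<Sum>k. flux ((stay_op \<mu> A ^^ k) (enter_op \<mu> A g)))"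
  proof -
    have "enter_op \<mu> A (chain_op \<mu> A g)
        = (\<lambda>x. \<Sum>k. enter_op \<mu> A ((stay_op \<mu> A ^^ k) (enter_op \<mu> A g)) x)"
      unfolding chain_op_def[abs_def] by (rule ext, rule step_op_suminf) auto
    then show ?thesis unfolding flux_def by (simp add: nn_integral_suminf)
  qed
  also have "\<dots> \<le> flux g"
  proof (intro suminf_le_const summableI)
    fix n
    have "(\<Sum>k<n. flux ((stay_op \<mu> A ^^ k) (enter_op \<mu> A g))) = flux (f n)"
    proof -
      have "f n = (\<lambda>x. \<Sum>k<n. (stay_op \<mu> A ^^ k) (enter_op \<mu> A g) x)"
        by (simp add: f_def fun_eq_iff)
      then have "enter_op \<mu> A (f n) = (\<lambda>x. \<Sum>k<n. enter_op \<mu> A ((stay_op \<mu> A ^^ k) (enter_op \<mu> A g)) x)"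
        by (intro ext) (simp add: step_op_sum)
      then show ?thesis
        unfolding flux_def by (simp add: nn_integral_sum)
    qed
    then show "(\<Sum>k<n. flux ((stay_op \<mu> A ^^ k) (enter_op \<mu> A g))) \<le> flux g" using le by simp
  qed
  finally show ?thesis .
qed

text \<open>The bounds for \<open>g\<close> and for \<open>1 - g\<close> add up to an equality,
  because the chain preserves the constant 1 on \<open>Z\<close>; so neither of them can be
  strict.\<close>

lemma flux_chain_op:
  assumes [measurable]: "g \<in> borel_measurable borel" and g: "\<And>y. g y \<le> 1"
  shows "flux (chain_op \<mu> A g) = flux g"
proof (rule antisym)
  have one: "g y + (1 - g y) = 1" for y using g[of y] by (rule add_diff_inverse_ennreal)
  have fin: "flux g < top" if "\<And>y. g y \<le> 1" for g :: "real \<Rightarrow> ennreal"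
    using le_less_trans[OF flux_mono flux_one_finite, of g] that by simp
  have "flux g + flux (\<lambda>y. 1 - g y) = flux (\<lambda>_. 1)"
    by (subst flux_add[symmetric]) (auto simp: one)
  also have "\<dots> \<le> flux (chain_op \<mu> A (\<lambda>_. 1))"
    by (rule flux_mono) (auto simp: chain_op_one)
  also have "\<dots> = flux (chain_op \<mu> A (\<lambda>y. g y + (1 - g y)))" by (simp add: one)
  also have "chain_op \<mu> A (\<lambda>y. g y + (1 - g y)) = (\<lambda>x. chain_op \<mu> A g x + chain_op \<mu> A (\<lambda>y. 1 - g y) x)"
    by (rule ext, rule chain_op_add) auto
  also have "flux \<dots> = flux (chain_op \<mu> A g) + flux (chain_op \<mu> A (\<lambda>y. 1 - g y))"
    by (rule flux_add) auto
  also have "\<dots> \<le> flux (chain_op \<mu> A g) + flux (\<lambda>y. 1 - g y)"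
    by (intro add_left_mono flux_chain_op_le) auto
  finally show "flux g \<le> flux (chain_op \<mu> A g)"
    by (rule ennreal_add_right_mono_cancel) (rule fin, simp)
qed (rule flux_chain_op_le[OF assms])

end

section \<open>Paths with exactly one entrance\<close>

text \<open>Points of the support on both sides of 0: steps can be prescribed up to any
  \<open>\<eta>\<close> with positive probability, which makes climbs and descents of controlled
  length available.\<close>

locale two_sided_lattice_walk = recurrent_lattice_walk +
  assumes up: "\<exists>s>0. \<forall>\<eta>>0. 0 < emeasure \<mu> {s - \<eta><..<s + \<eta>}"
    and down: "\<exists>s>0. \<forall>\<eta>>0. 0 < emeasure \<mu> {- s - \<eta><..<- s + \<eta>}"
begin

lemma passage_op_Suc_Suc_eq:
  assumes [measurable]: "f \<in> borel_measurable borel"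
  shows "passage_op \<mu> A (Suc k) (Suc n) f x =
    (\<integral>\<^sup>+ z. (if x \<notin> A \<and> x + z \<in> A then passage_op \<mu> A k n f (x + z)
      else passage_op \<mu> A k (Suc n) f (x + z)) \<partial>\<mu>)"
  by (simp add: step_op_def, subst nn_integral_add[symmetric]) (auto intro!: nn_integral_cong)

text \<open>No step goes up, so a path that falls below 0 stays there and is lost, as
  \<open>f\<close> vanishes off \<open>A\<close>. A surviving path from above \<open>h\<close> thus
  crosses into \<open>A\<close> once, and one started in \<open>A\<close> stays in it. The claims
  are proved together since the one for \<open>y > h\<close> uses the other two.\<close>

lemma into_op_funpow_descent_le:
  assumes [measurable]: "D \<in> sets borel" "f \<in> borel_measurable borel"
    and D: "D \<subseteq> {..0}" and f: "\<And>y. y \<notin> A \<Longrightarrow> f y = 0"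
  shows "(y < 0 \<longrightarrow> (into_op \<mu> D ^^ b) f y = 0) \<and>
    (y \<in> A \<longrightarrow> (into_op \<mu> D ^^ b) f y \<le> passage_op \<mu> A b 0 f y) \<and>
    (y > h \<longrightarrow> (into_op \<mu> D ^^ b) f y \<le> passage_op \<mu> A b 1 f y)"
proof (induction b arbitrary: y)
  case 0
  then show ?case using f by (auto simp: A_eq)
next
  case (Suc b)
  have z0: "z \<le> 0" if "z \<in> D" for z using D that by auto
  have neg: "(into_op \<mu> D ^^ b) f y = 0" if "y < 0" for y using Suc that by blast
  have inside: "(into_op \<mu> D ^^ b) f y \<le> passage_op \<mu> A b 0 f y" if "y \<in> A" for y using Suc that by blast
  have above: "(into_op \<mu> D ^^ b) f y \<le> passage_op \<mu> A b 1 f y" if "y > h" for y using Suc that by blast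
  show ?case
  proof (intro conjI impI)
    assume "y < 0"
    then have "indicator D z * (into_op \<mu> D ^^ b) f (y + z) = 0" for z
      using D neg[of "y + z"] by (auto simp: indicator_def)
    then have "(\<integral>\<^sup>+ z. indicator D z * (into_op \<mu> D ^^ b) f (y + z) \<partial>\<mu>) = (\<integral>\<^sup>+ z. 0 \<partial>\<mu>)"
      by (rule nn_integral_cong)
    then show "(into_op \<mu> D ^^ Suc b) f y = 0" by (simp add: step_op_def)
  next
    assume y: "y \<in> A"
    have "indicator D z * (into_op \<mu> D ^^ b) f (y + z)
        \<le> (if y \<notin> A \<and> y + z \<in> A then 0 else 1) * passage_op \<mu> A b 0 f (y + z)" for z
      using z0[of z] y neg[of "y + z"] inside[of "y + z"]
      by (cases "y + z < 0") (auto simp: indicator_def A_eq not_le)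
    then show "(into_op \<mu> D ^^ Suc b) f y \<le> passage_op \<mu> A (Suc b) 0 f y"
      unfolding funpow.simps comp_apply passage_op.simps step_op_def by (simp add: nn_integral_mono)
  next
    assume y: "y > h"
    have "indicator D z * (into_op \<mu> D ^^ b) f (y + z)
        \<le> (if y \<notin> A \<and> y + z \<in> A then passage_op \<mu> A b 0 f (y + z) else passage_op \<mu> A b (Suc 0) f (y + z))" for z
      using D y neg[of "y + z"] inside[of "y + z"] above[of "y + z"]
      by (auto simp: indicator_def A_eq not_le)
    then show "(into_op \<mu> D ^^ Suc b) f y \<le> passage_op \<mu> A (Suc b) 1 f y"
      unfolding One_nat_def by (subst passage_op_Suc_Suc_eq) (auto simp: step_op_def[of \<mu> "\<lambda>x z. indicator D z"] intro!: nn_integral_mono)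
  qed
qed

text \<open>Each of the \<open>j\<close> steps lowers the position by at most \<open>K\<close>, so a
  start above \<open>h + j * K\<close> stays above \<open>h\<close> during this phase, and the
  single entrance is left to the descent.\<close>

lemma into_op_funpow_spread_le:
  assumes [measurable]: "D \<in> sets borel" "f \<in> borel_measurable borel"
    and D: "D \<subseteq> {..0}" and f: "\<And>y. y \<notin> A \<Longrightarrow> f y = 0" and y: "y > h + real j * K"
  shows "(into_op \<mu> {-K..K} ^^ j) ((into_op \<mu> D ^^ b) f) y \<le> passage_op \<mu> A (j + b) 1 f y"
  using y
proof (induction j arbitrary: y)
  case 0
  then show ?case using into_op_funpow_descent_le[OF assms(1-4), of y b] by simp
next
  case (Suc j)
  let ?g = "(into_op \<mu> {-K..K} ^^ j) ((into_op \<mu> D ^^ b) f)"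
  have "indicator {-K..K} z * ?g (y + z)
      \<le> (if y \<notin> A \<and> y + z \<in> A then passage_op \<mu> A (j + b) 0 f (y + z) else passage_op \<mu> A (j + b) (Suc 0) f (y + z))" for z
  proof (cases "z \<in> {-K..K}")
    case True
    \<comment> \<open>For negative \<open>K\<close> the set \<open>{-K..K}\<close> is empty, so a
      step in it settles the sign.\<close>
    then have "0 \<le> K" by simp
    then have "0 \<le> real j * K" by simp
    moreover have "y > h + real j * K + K" using Suc(2) by (simp add: algebra_simps)
    moreover have "- K \<le> z" using True by simp
    ultimately have "y + z > h" "y + z > h + real j * K" by linarith+
    then show ?thesis using Suc(1)[of "y + z"] True by (auto simp: A_eq)
  qed auto
  then show ?case
    unfolding One_nat_def add_Suc by (subst passage_op_Suc_Suc_eq) (auto simp: step_op_def[of \<mu> "\<lambda>x z. indicator {-K..K} z"] intro!: nn_integral_mono)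
qed

text \<open>Upward steps from \<open>x \<ge> 0\<close> never enter: they may stay in
  \<open>A\<close> or leave it at the top, and above \<open>h\<close> they only lead higher. The
  start is allowed to lie in \<open>A\<close>, where the minorization is needed.\<close>

lemma into_op_funpow_ascent_le:
  assumes [measurable]: "D \<in> sets borel" "U \<in> sets borel" "f \<in> borel_measurable borel"
    and D: "D \<subseteq> {..0}" and f: "\<And>y. y \<notin> A \<Longrightarrow> f y = 0"
    and U: "U \<subseteq> {\<eta>..}" "0 < \<eta>" and x: "0 \<le> x" "x + real a * \<eta> > h + real j * K"
  shows "(into_op \<mu> U ^^ a) ((into_op \<mu> {-K..K} ^^ j) ((into_op \<mu> D ^^ b) f)) x
    \<le> passage_op \<mu> A (a + j + b) 1 f x"
  using x
proof (induction a arbitrary: x)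
  case 0
  then show ?case using into_op_funpow_spread_le[OF assms(1,3) D f, of j K x b] by simp
next
  case (Suc a)
  let ?g = "(into_op \<mu> U ^^ a) ((into_op \<mu> {-K..K} ^^ j) ((into_op \<mu> D ^^ b) f))"
  have "indicator U z * ?g (x + z)
      \<le> (if x \<notin> A \<and> x + z \<in> A then passage_op \<mu> A (a + j + b) 0 f (x + z) else passage_op \<mu> A (a + j + b) (Suc 0) f (x + z))" for z
  proof (cases "z \<in> U")
    case True
    then have z: "\<eta> \<le> z" using U by auto
    then have "x + z + real a * \<eta> > h + real j * K"
      using Suc(3) by (auto simp: algebra_simps)
    then show ?thesis using Suc(1)[of "x + z"] True Suc(2) z U(2) by (auto simp: A_eq)
  qed auto
  then show ?case
    unfolding One_nat_def add_Suc by (subst passage_op_Suc_Suc_eq) (auto simp: step_op_def[of \<mu> "\<lambda>x z. indicator U z"] intro!: nn_integral_mono)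
qed

text \<open>
  Doeblin minorization: climbing above \<open>h\<close>, spreading out there and then descending back
  into \<open>[0, h]\<close> is a path with exactly one entrance.
\<close>

lemma chain_op_minorization:
  "\<exists>e > 0. \<forall>x\<in>Z \<inter> A. \<forall>g\<in>borel_measurable borel.
      e * (\<integral>\<^sup>+ y. chain_op \<mu> A g y * indicator A y \<partial>haar) \<le> (chain_op \<mu> A ^^ 2) g x"
proof -
  obtain s where s: "0 < s" "\<And>\<eta>. 0 < \<eta> \<Longrightarrow> 0 < emeasure \<mu> {s - \<eta><..<s + \<eta>}" using up by blast
  obtain t where t: "0 < t" "\<And>\<eta>. 0 < \<eta> \<Longrightarrow> 0 < emeasure \<mu> {- t - \<eta><..<- t + \<eta>}" using down by blast
  \<comment> \<open>One \<open>t\<close> will pay for the mismatch between climb and descent, the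
    other for the accumulated inaccuracy \<open>(a + b) * \<eta>\<close> of the steps.\<close>
  define l where "l = h + 2 * t"
  obtain K0 n c where c0: "0 < c" "\<And>x g. x \<in> Z \<Longrightarrow> g \<in> borel_measurable borel \<Longrightarrow>
      ennreal c * (\<integral>\<^sup>+ y. g y * indicator {x - l..x + l} y \<partial>haar)
        \<le> (\<Sum>j\<le>n. (into_op \<mu> {-K0..K0} ^^ j) g x)"
    using spread[of l] by blast
  define K where "K = max K0 0"
  have K: "0 \<le> K" by (simp add: K_def)
  have c: "ennreal c * window_integral (- l) l g x \<le> (\<Sum>j\<le>n. (into_op \<mu> {-K..K} ^^ j) g x)"
    if "x \<in> Z" "g \<in> borel_measurable borel" for x g
  proof -
    have "(into_op \<mu> {-K0..K0} ^^ j) g x \<le> (into_op \<mu> {-K..K} ^^ j) g x" for j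
      by (rule step_op_funpow_mono) (auto simp: indicator_def K_def)
    then show ?thesis
      using c0(2)[OF that] by (auto simp: window_integral_def intro: order_trans[OF _ sum_mono])
  qed
  \<comment> \<open>Climbing steps will be at least \<open>s / 2\<close> long, so \<open>a\<close>
    of them lead above \<open>h + n * K\<close>, high enough for the spreading phase.\<close>
  obtain a :: nat where a: "h + real n * K < real a * (s / 2)"
    using reals_Archimedean3[OF half_gt_zero[OF s(1)]] by blast
  \<comment> \<open>Descending steps are close to \<open>- t\<close>; \<open>b\<close> of them take
    back the climb \<open>a * s\<close> up to an error between 0 and \<open>t\<close>.\<close>
  define b where "b = nat \<lfloor>real a * s / t\<rfloor>"
  have b: "0 \<le> real a * s - real b * t" "real a * s - real b * t \<le> t"
  proof -
    have "real b = of_int \<lfloor>real a * s / t\<rfloor>" using s(1) t(1) by (simp add: b_def)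
    then have "real b \<le> real a * s / t" "real a * s / t \<le> real b + 1" by linarith+
    then show "0 \<le> real a * s - real b * t" "real a * s - real b * t \<le> t"
      using t(1) by (simp_all add: field_simps)
  qed
  \<comment> \<open>The first bound keeps climbing steps above \<open>s / 2\<close>; the second
    limits the total inaccuracy to \<open>t\<close> and keeps descending steps from being
    positive.\<close>
  define \<eta> where "\<eta> = min (s / 2) (t / real (a + b + 1))"
  have \<eta>: "0 < \<eta>" "\<eta> \<le> s / 2"
  proof -
    show "0 < \<eta>" unfolding \<eta>_def using s(1) t(1) by simp
    show "\<eta> \<le> s / 2" unfolding \<eta>_def by (rule min.cobounded1)
  qed
  have "real (a + b + 1) * \<eta> \<le> real (a + b + 1) * (t / real (a + b + 1))"
    by (intro mult_left_mono) (auto simp: \<eta>_def)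
  then have ab\<eta>1: "real (a + b + 1) * \<eta> \<le> t" by simp
  then have ab\<eta>: "real a * \<eta> + real b * \<eta> \<le> t" "\<eta> \<le> t"
  proof -
    have "real (a + b + 1) * \<eta> = real a * \<eta> + real b * \<eta> + \<eta>" by (simp add: algebra_simps)
    moreover have "0 \<le> real a * \<eta>" "0 \<le> real b * \<eta>" using \<eta>(1) by auto
    ultimately show "real a * \<eta> + real b * \<eta> \<le> t" "\<eta> \<le> t" using ab\<eta>1 \<eta>(1) by linarith+
  qed
  define U where "U = {s - \<eta><..<s + \<eta>}"
  define D where "D = {- t - \<eta><..<- t + \<eta>}"
  have [measurable]: "U \<in> sets borel" "D \<in> sets borel" by (auto simp: U_def D_def)
  have UD: "U \<subseteq> {s - \<eta>..s + \<eta>}" "D \<subseteq> {- t - \<eta>..- t + \<eta>}" "U \<subseteq> {s / 2..}" "D \<subseteq> {..0}"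
    using \<eta> ab\<eta> by (auto simp: U_def D_def)
  \<comment> \<open>All \<open>n + 1\<close> summands of \<open>spread\<close> are bounded by the
    same value, whence the division.\<close>
  define e where "e = ennreal c * (emeasure \<mu> U ^ a * emeasure \<mu> D ^ b) / of_nat (Suc n)"
  have main: "e * (\<integral>\<^sup>+ y. chain_op \<mu> A g y * indicator A y \<partial>haar) \<le> (chain_op \<mu> A ^^ 2) g x"
    if x: "x \<in> Z \<inter> A" and [measurable]: "g \<in> borel_measurable borel" for x g
  proof -
    \<comment> \<open>The path ends in \<open>A\<close>, but not necessarily at an entrance. What is
      carried along is therefore the expectation of \<open>g\<close> at the next entrance.\<close>
    define f where "f y = chain_op \<mu> A g y * indicator A y" for y
    have [measurable]: "f \<in> borel_measurable borel" unfolding f_def by measurable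
    have f0: "f y = 0" if "y \<notin> A" for y using that by (simp add: f_def)
    let ?f' = "(into_op \<mu> D ^^ b) f"
    define p where "p = (- l + real a * (s + \<eta>)) + real b * (- t + \<eta>)"
    define q where "q = (l + real a * (s - \<eta>)) + real b * (- t - \<eta>)"
    \<comment> \<open>For every \<open>x \<in> A\<close> the window from \<open>x + p\<close> to
      \<open>x + q\<close> then covers all of \<open>A\<close>.\<close>
    have pq: "p \<le> - h" "h \<le> q"
      using b ab\<eta> by (auto simp: p_def q_def l_def algebra_simps)
    have "(\<integral>\<^sup>+ y. f y \<partial>haar) \<le> window_integral p q f x"
      unfolding window_integral_def
      by (intro nn_integral_mono) (use x pq in \<open>auto simp: f_def indicator_def A_eq\<close>)
    then have "ennreal c * (emeasure \<mu> U ^ a * emeasure \<mu> D ^ b) * (\<integral>\<^sup>+ y. f y \<partial>haar)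
        \<le> ennreal c * (emeasure \<mu> U ^ a * (emeasure \<mu> D ^ b * window_integral p q f x))"
      unfolding mult.assoc by (intro mult_left_mono) auto
    also have "\<dots> \<le> ennreal c * (emeasure \<mu> U ^ a *
        window_integral (- l + real a * (s + \<eta>)) (l + real a * (s - \<eta>)) ?f' x)"
      unfolding p_def q_def
      by (intro mult_left_mono window_integral_into_op_funpow) (use UD in auto)
    also have "\<dots> \<le> ennreal c * (into_op \<mu> U ^^ a) (window_integral (- l) l ?f') x"
      by (intro mult_left_mono into_op_funpow_window_integral) (use UD in auto)
    also have "\<dots> = (into_op \<mu> U ^^ a) (\<lambda>y. ennreal c * window_integral (- l) l ?f' y) x"
      by (rule step_op_funpow_cmult[symmetric]) auto
    also have "\<dots> \<le> (into_op \<mu> U ^^ a) (\<lambda>y. \<Sum>j\<le>n. (into_op \<mu> {-K..K} ^^ j) ?f' y) x"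
      by (rule step_op_funpow_mono_on[OF AE_step Z_add]) (use x c in auto)
    also have "\<dots> = (\<Sum>j\<le>n. (into_op \<mu> U ^^ a) ((into_op \<mu> {-K..K} ^^ j) ?f') x)"
      by (rule step_op_funpow_sum) auto
    also have "\<dots> \<le> (\<Sum>j\<le>n. (chain_op \<mu> A ^^ 2) g x)"
    proof (rule sum_mono)
      fix j assume "j \<in> {..n}"
      then have "real j * K \<le> real n * K" using K by (intro mult_right_mono) auto
      then have "(into_op \<mu> U ^^ a) ((into_op \<mu> {-K..K} ^^ j) ?f') x \<le> passage_op \<mu> A (a + j + b) 1 f x"
        using x a s(1) UD f0 by (intro into_op_funpow_ascent_le[where \<eta> = "s / 2"]) (auto simp: A_eq)
      also have "\<dots> \<le> passage_op \<mu> A (a + j + b) 1 (chain_op \<mu> A g) x"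
        by (rule passage_op_mono) (auto simp: f_def indicator_def)
      also have "\<dots> \<le> (chain_op \<mu> A ^^ Suc 1) g x"
        by (rule passage_op_chain_op_le) auto
      finally show "(into_op \<mu> U ^^ a) ((into_op \<mu> {-K..K} ^^ j) ?f') x \<le> (chain_op \<mu> A ^^ 2) g x"
        by (simp add: numeral_2_eq_2)
    qed
    also have "\<dots> = of_nat (Suc n) * (chain_op \<mu> A ^^ 2) g x" by simp
    finally have "ennreal c * (emeasure \<mu> U ^ a * emeasure \<mu> D ^ b) * (\<integral>\<^sup>+ y. f y \<partial>haar) / of_nat (Suc n)
        \<le> of_nat (Suc n) * (chain_op \<mu> A ^^ 2) g x / of_nat (Suc n)"
      by (rule divide_right_mono_ennreal)
    also have "of_nat (Suc n) * (chain_op \<mu> A ^^ 2) g x / of_nat (Suc n) = (chain_op \<mu> A ^^ 2) g x"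
      by (subst mult.commute, rule ennreal_mult_divide_eq) (auto simp del: of_nat_Suc)
    finally show ?thesis
      unfolding e_def f_def divide_ennreal_def by (simp add: mult_ac del: of_nat_Suc)
  qed
  have "emeasure \<mu> U \<noteq> 0"
    using s(2)[OF \<eta>(1)] unfolding U_def by (rule gr_implies_not_zero)
  moreover have "emeasure \<mu> D \<noteq> 0"
    using t(2)[OF \<eta>(1)] unfolding D_def by (rule gr_implies_not_zero)
  moreover have "ennreal c \<noteq> 0" using c0(1) by simp
  ultimately have "ennreal c * (emeasure \<mu> U ^ a * emeasure \<mu> D ^ b) \<noteq> 0"
    unfolding mult_eq_0_iff power_eq_0_iff by blast
  moreover have "of_nat (Suc n) \<noteq> (top :: ennreal)"
    unfolding less_top by (rule of_nat_less_top)
  ultimately have "e \<noteq> 0"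
    unfolding e_def ennreal_divide_eq_0_iff by blast
  then have "0 < e" unfolding zero_less_iff_neq_zero .
  then show ?thesis using main by blast
qed

subsection \<open>Geometric ergodicity\<close>

lemma chain_op_funpow_const:
  assumes "x \<in> Z"
  shows "(chain_op \<mu> A ^^ n) (\<lambda>_. c) x = c"
  using assms
proof (induction n arbitrary: x)
  case (Suc n)
  have "chain_op \<mu> A ((chain_op \<mu> A ^^ n) (\<lambda>_. c)) x = chain_op \<mu> A (\<lambda>_. c) x"
    by (intro antisym chain_op_mono_on[OF AE_step Z_add]) (use Suc in auto)
  then show ?case using chain_op_cmult[of A "\<lambda>_. 1" c x] chain_op_one[OF Suc(2)] by simp
qed simp

lemma chain_op_funpow_add:
  assumes [measurable]: "f \<in> borel_measurable borel" "g \<in> borel_measurable borel"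
  shows "(chain_op \<mu> A ^^ n) (\<lambda>y. f y + g y) x = (chain_op \<mu> A ^^ n) f x + (chain_op \<mu> A ^^ n) g x"
proof (induction n arbitrary: x)
  case (Suc n)
  then have "(chain_op \<mu> A ^^ n) (\<lambda>y. f y + g y)
      = (\<lambda>y. (chain_op \<mu> A ^^ n) f y + (chain_op \<mu> A ^^ n) g y)" by blast
  then show ?case by (simp add: chain_op_add)
qed simp

text \<open>After one application the chain has moved into \<open>A\<close>, so bounds on
  \<open>Z \<inter> A\<close> suffice for every start in \<open>Z\<close>. This makes the later
  estimates uniform in the starting point.\<close>

lemma chain_op_funpow_bounds:
  assumes fab: "\<And>y. y \<in> Z \<inter> A \<Longrightarrow> ennreal a \<le> f y \<and> f y \<le> ennreal b"
    and x: "x \<in> Z" and n: "0 < n \<or> x \<in> A"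
  shows "ennreal a \<le> (chain_op \<mu> A ^^ n) f x \<and> (chain_op \<mu> A ^^ n) f x \<le> ennreal b"
  using x n
proof (induction n arbitrary: x)
  case 0
  then show ?case using fab by auto
next
  case (Suc n)
  have "chain_op \<mu> A (\<lambda>_. ennreal a) x \<le> chain_op \<mu> A ((chain_op \<mu> A ^^ n) f) x"
    by (rule chain_op_mono_entrance) (use Suc in auto)
  moreover have "chain_op \<mu> A ((chain_op \<mu> A ^^ n) f) x \<le> chain_op \<mu> A (\<lambda>_. ennreal b) x"
    by (rule chain_op_mono_entrance) (use Suc in auto)
  ultimately show ?case
    using chain_op_funpow_const[OF Suc(2), of 1] by simp
qed

text \<open>The minorizing functional \<open>J\<close> multiplies constants by
  \<open>\<delta>\<close>. Removing this common part from two applications of the chain leaves a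
  kernel of mass \<open>1 - \<delta>\<close> on \<open>Z \<inter> A\<close>, so values between
  \<open>a\<close> and \<open>b\<close> are mapped into an interval shorter by that factor.\<close>

lemma oscillation_contraction:
  "\<exists>\<delta>. 0 < \<delta> \<and> \<delta> \<le> 1 \<and> (\<forall>f\<in>borel_measurable borel. \<forall>a b. 0 \<le> a \<longrightarrow> a \<le> b \<longrightarrow>
      (\<forall>y\<in>Z \<inter> A. ennreal a \<le> f y \<and> f y \<le> ennreal b) \<longrightarrow>
      (\<exists>a' b'. 0 \<le> a' \<and> a' \<le> b' \<and> b' - a' = (1 - \<delta>) * (b - a) \<and>
        (\<forall>x\<in>Z \<inter> A. ennreal a' \<le> (chain_op \<mu> A ^^ 2) f x \<and> (chain_op \<mu> A ^^ 2) f x \<le> ennreal b')))"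
proof -
  obtain e :: ennreal where e: "0 < e"
    "\<And>x g. x \<in> Z \<inter> A \<Longrightarrow> g \<in> borel_measurable borel \<Longrightarrow>
      e * (\<integral>\<^sup>+ y. chain_op \<mu> A g y * indicator A y \<partial>haar) \<le> (chain_op \<mu> A ^^ 2) g x"
    using chain_op_minorization by blast
  define J where "J g = e * (\<integral>\<^sup>+ y. chain_op \<mu> A g y * indicator A y \<partial>haar)" for g
  have J_add: "J (\<lambda>y. f y + g y) = J f + J g"
    if [measurable]: "f \<in> borel_measurable borel" "g \<in> borel_measurable borel" for f g
    unfolding J_def
    by (simp add: chain_op_add distrib_right nn_integral_add distrib_left)
  have J_const: "J (\<lambda>_. c) = e * emeasure haar A * c" for c
  proof -
    have "(\<integral>\<^sup>+ y. chain_op \<mu> A (\<lambda>_. c) y * indicator A y \<partial>haar) = (\<integral>\<^sup>+ y. c * indicator A y \<partial>haar)"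
      by (rule nn_integral_cong_AE, use AE_haar in eventually_elim)
         (use chain_op_funpow_const[of _ 1 c] in auto)
    then show ?thesis by (simp add: J_def nn_integral_cmult_indicator mult_ac)
  qed
  have J_mono: "J f \<le> J g" if "\<And>y. y \<in> Z \<inter> A \<Longrightarrow> f y \<le> g y" for f g
    unfolding J_def
    by (intro mult_left_mono nn_integral_mono_AE, use AE_haar in eventually_elim)
       (auto intro!: mult_right_mono chain_op_mono_entrance that)
  obtain x0 where x0: "x0 \<in> Z \<inter> A" using Z_zero h_pos that[of 0] by (auto simp: A_eq)
  \<comment> \<open>The minorization at any point, applied to the constant 1, shows that
    \<open>\<delta>\<close> is at most 1.\<close>
  have J1: "J (\<lambda>_. 1) \<le> 1"
    using e(2)[OF x0, of "\<lambda>_. 1"] chain_op_funpow_const[of x0 2 1] x0 by (simp add: J_def)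
  define \<delta> where "\<delta> = enn2real (J (\<lambda>_. 1))"
  have J_top: "J (\<lambda>_. 1) < top" using J1 by (auto intro: le_less_trans[OF _ ennreal_one_less_top])
  then have J_\<delta>: "J (\<lambda>_. c) = ennreal \<delta> * c" for c
    using J_const[of 1] J_const[of c] by (simp add: \<delta>_def)
  have "0 < J (\<lambda>_. 1)"
    using e(1) haar_A_pos by (simp add: J_const ennreal_zero_less_mult_iff)
  then have \<delta>: "0 < \<delta>" "\<delta> \<le> 1"
    using J_top enn2real_mono[OF J1] by (auto simp: \<delta>_def enn2real_positive_iff)
  have step: "\<exists>a' b'. 0 \<le> a' \<and> a' \<le> b' \<and> b' - a' = (1 - \<delta>) * (b - a) \<and>
        (\<forall>x\<in>Z \<inter> A. ennreal a' \<le> (chain_op \<mu> A ^^ 2) f x \<and> (chain_op \<mu> A ^^ 2) f x \<le> ennreal b')"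
    if [measurable]: "f \<in> borel_measurable borel" and ab: "0 \<le> a" "a \<le> b"
      and fab: "\<And>y. y \<in> Z \<inter> A \<Longrightarrow> ennreal a \<le> f y \<and> f y \<le> ennreal b" for f a b
  proof -
    have "J f \<le> J (\<lambda>_. ennreal b)" by (rule J_mono) (use fab in auto)
    then have "J f < top" using ab by (auto simp: J_\<delta> ennreal_mult_less_top intro: le_less_trans)
    then obtain m where m: "0 \<le> m" "J f = ennreal m" by (cases "J f") auto
    have "J (\<lambda>_. ennreal a) \<le> J f" by (rule J_mono) (use fab in auto)
    then have am: "\<delta> * a \<le> m" using ab \<delta> m by (simp add: J_\<delta> flip: ennreal_mult)
    have bm: "m \<le> \<delta> * b" using \<open>J f \<le> J (\<lambda>_. ennreal b)\<close> ab \<delta> m by (simp add: J_\<delta> flip: ennreal_mult)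
    \<comment> \<open>With \<open>Q\<close> the chain, \<open>Q^2 (f - a) \<ge> J (f - a)\<close>
      yields \<open>Q^2 f \<ge> a + m - \<delta> * a\<close>; the upper bound comes from
      \<open>b - f\<close> in the same way.\<close>
    define a' where "a' = (1 - \<delta>) * a + m"
    define b' where "b' = (1 - \<delta>) * b + m"
    have "ennreal a' \<le> (chain_op \<mu> A ^^ 2) f x \<and> (chain_op \<mu> A ^^ 2) f x \<le> ennreal b'"
      if x: "x \<in> Z \<inter> A" for x
    proof
      let ?Q = "chain_op \<mu> A ^^ 2"
      define g where "g y = f y - ennreal a" for y
      have [measurable]: "g \<in> borel_measurable borel" unfolding g_def by measurable
      have ga: "g y + ennreal a = f y" if "y \<in> Z \<inter> A" for y
        using fab[OF that] by (auto simp: g_def diff_add_cancel_ennreal)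
      have "ennreal m \<le> J (\<lambda>y. g y + ennreal a)"
        unfolding m(2)[symmetric] by (rule J_mono) (simp add: ga)
      also have "\<dots> = J g + ennreal (\<delta> * a)"
        using ab \<delta> by (subst J_add) (auto simp: J_\<delta> ennreal_mult)
      finally have "ennreal m + ennreal ((1 - \<delta>) * a) \<le> J g + (ennreal (\<delta> * a) + ennreal ((1 - \<delta>) * a))"
        by (simp add: add.assoc[symmetric] add_right_mono)
      also have "ennreal (\<delta> * a) + ennreal ((1 - \<delta>) * a) = ennreal a"
      proof -
        have "\<delta> * a + (1 - \<delta>) * a = a" by (simp add: algebra_simps)
        moreover have "0 \<le> \<delta> * a" "0 \<le> (1 - \<delta>) * a" using ab \<delta> by simp_all
        ultimately show ?thesis by (metis ennreal_plus)
      qed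
      also have "J g + ennreal a \<le> ?Q g x + ?Q (\<lambda>_. ennreal a) x"
        using e(2)[OF x, of g] x by (auto simp: J_def chain_op_funpow_const intro: add_mono)
      also have "\<dots> = ?Q (\<lambda>y. g y + ennreal a) x"
        by (rule chain_op_funpow_add[symmetric]) auto
      also have "\<dots> \<le> ?Q f x"
      proof -
        have "chain_op \<mu> A (\<lambda>y. g y + ennreal a) y \<le> chain_op \<mu> A f y" if "y \<in> Z" for y
          by (rule chain_op_mono_entrance[OF that]) (simp add: ga)
        note le = this
        show ?thesis
          unfolding numeral_2_eq_2 funpow.simps comp_apply id_apply
          by (rule chain_op_mono_on[OF AE_step Z_add]) (use x le in auto)
      qed
      finally show "ennreal a' \<le> ?Q f x"
        using m(1) ab \<delta> by (simp add: a'_def add.commute)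
    next
      let ?Q = "chain_op \<mu> A ^^ 2"
      define g where "g y = ennreal b - f y" for y
      have [measurable]: "g \<in> borel_measurable borel" unfolding g_def by measurable
      have gb: "g y + f y = ennreal b" if "y \<in> Z \<inter> A" for y
        using fab[OF that] by (auto simp: g_def diff_add_cancel_ennreal)
      have "ennreal (\<delta> * b) \<le> J (\<lambda>y. g y + f y)"
      proof -
        have "ennreal (\<delta> * b) = J (\<lambda>_. ennreal b)" using ab \<delta> by (simp add: J_\<delta> ennreal_mult)
        also have "\<dots> \<le> J (\<lambda>y. g y + f y)" by (rule J_mono) (simp add: gb)
        finally show ?thesis .
      qed
      also have "\<dots> = J g + ennreal m"
        by (subst J_add) (auto simp: m)
      also have "J g \<le> ?Q g x" using e(2)[OF x, of g] by (simp add: J_def)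
      finally have "ennreal (\<delta> * b) + ?Q f x \<le> (?Q g x + ennreal m) + ?Q f x"
        by (simp add: add_right_mono)
      also have "\<dots> = ?Q (\<lambda>y. g y + f y) x + ennreal m"
        by (subst chain_op_funpow_add) (auto simp: ac_simps)
      also have "\<dots> \<le> ?Q (\<lambda>_. ennreal b) x + ennreal m"
      proof (rule add_right_mono)
        show "?Q (\<lambda>y. g y + f y) x \<le> ?Q (\<lambda>_. ennreal b) x"
      proof -
        have "chain_op \<mu> A (\<lambda>y. g y + f y) y \<le> chain_op \<mu> A (\<lambda>_. ennreal b) y" if "y \<in> Z" for y
          by (rule chain_op_mono_entrance[OF that]) (simp add: gb)
        note le = this
        show ?thesis
          unfolding numeral_2_eq_2 funpow.simps comp_apply id_apply
          by (rule chain_op_mono_on[OF AE_step Z_add]) (use x le in auto)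
      qed
      qed
      also have "?Q (\<lambda>_. ennreal b) x = ennreal b" using x by (simp add: chain_op_funpow_const)
      also have "ennreal b + ennreal m = ennreal b' + ennreal (\<delta> * b)"
      proof -
        have "b + m = b' + \<delta> * b" by (simp add: b'_def algebra_simps)
        moreover have "0 \<le> b'" "0 \<le> \<delta> * b" "0 \<le> b" using ab \<delta> m(1) by (simp_all add: b'_def)
        ultimately show ?thesis using m(1) by (metis ennreal_plus)
      qed
      finally have "?Q f x + ennreal (\<delta> * b) \<le> ennreal b' + ennreal (\<delta> * b)"
        by (simp only: add.commute[of "?Q f x"])
      then show "?Q f x \<le> ennreal b'"
        by (rule ennreal_add_right_mono_cancel) simp
    qed
    moreover have "0 \<le> a'" using ab \<delta> m by (simp add: a'_def)
    moreover have "b' - a' = (1 - \<delta>) * (b - a)" by (simp add: a'_def b'_def algebra_simps)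
    moreover have "a' \<le> b'" using ab \<delta> by (simp add: a'_def b'_def mult_left_mono)
    ultimately show ?thesis by blast
  qed
  show ?thesis
    by (rule exI[of _ \<delta>]) (use \<delta> step in auto)
qed

text \<open>By invariance, the normalized flux of the indicator is also an average of its image
  under \<open>2 * j\<close> applications of the chain. It therefore lies in the same interval of
  length \<open>(1 - \<delta>) ^ j\<close> as the values of the chain itself.\<close>

lemma geometric_ergodicity:
  obtains r c :: real where "0 < r" "r < 1" "1 \<le> c"
    "\<And>x n B. x \<in> Z \<Longrightarrow> B \<in> sets borel \<Longrightarrow>
      \<bar>enn2real ((chain_op \<mu> A ^^ Suc n) (indicator B) x)
        - enn2real (flux (indicator B) / flux (\<lambda>_. 1))\<bar> \<le> c * r ^ Suc n"
proof -
  obtain \<delta> :: real where \<delta>: "0 < \<delta>" "\<delta> \<le> 1" and contr: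
    "\<forall>f\<in>borel_measurable borel. \<forall>a b. 0 \<le> a \<longrightarrow> a \<le> b \<longrightarrow>
      (\<forall>y\<in>Z \<inter> A. ennreal a \<le> f y \<and> f y \<le> ennreal b) \<longrightarrow>
      (\<exists>a' b'. 0 \<le> a' \<and> a' \<le> b' \<and> b' - a' = (1 - \<delta>) * (b - a) \<and>
        (\<forall>x\<in>Z \<inter> A. ennreal a' \<le> (chain_op \<mu> A ^^ 2) f x \<and> (chain_op \<mu> A ^^ 2) f x \<le> ennreal b'))"
    using oscillation_contraction by blast
  \<comment> \<open>The maximum with \<open>1 / 2\<close> keeps the rate positive if
    \<open>\<delta> = 1\<close>.\<close>
  define \<rho> where "\<rho> = max (1 / 2) (1 - \<delta>)"
  have \<rho>: "1 / 2 \<le> \<rho>" "\<rho> < 1" "1 - \<delta> \<le> \<rho>" using \<delta> by (auto simp: \<rho>_def)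
  \<comment> \<open>Contraction is known for two applications, hence the square root.\<close>
  define r where "r = sqrt \<rho>"
  have r: "0 < r" "r < 1" "r ^ 2 = \<rho>" using \<rho> by (auto simp: r_def)
  have osc: "\<exists>a b. 0 \<le> a \<and> a \<le> b \<and> b - a = (1 - \<delta>) ^ j \<and>
      (\<forall>x\<in>Z \<inter> A. ennreal a \<le> (chain_op \<mu> A ^^ (2 * j)) (indicator B) x \<and>
        (chain_op \<mu> A ^^ (2 * j)) (indicator B) x \<le> ennreal b)"
    if [measurable]: "B \<in> sets borel" for j B
  proof (induction j)
    case 0
    show ?case by (rule exI[of _ 0], rule exI[of _ 1]) (auto simp: indicator_def)
  next
    case (Suc j)
    then obtain a b where ab: "0 \<le> a" "a \<le> b" "b - a = (1 - \<delta>) ^ j"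
      "\<And>x. x \<in> Z \<inter> A \<Longrightarrow> ennreal a \<le> (chain_op \<mu> A ^^ (2 * j)) (indicator B) x \<and>
        (chain_op \<mu> A ^^ (2 * j)) (indicator B) x \<le> ennreal b" by blast
    have "(chain_op \<mu> A ^^ (2 * j)) (indicator B) \<in> borel_measurable borel" by measurable
    from contr[rule_format, OF this ab(1,2,4)] ab(3)
    have "\<exists>a' b'. 0 \<le> a' \<and> a' \<le> b' \<and> b' - a' = (1 - \<delta>) * (1 - \<delta>) ^ j \<and>
        (\<forall>x\<in>Z \<inter> A. ennreal a' \<le> (chain_op \<mu> A ^^ 2) ((chain_op \<mu> A ^^ (2 * j)) (indicator B)) x \<and>
          (chain_op \<mu> A ^^ 2) ((chain_op \<mu> A ^^ (2 * j)) (indicator B)) x \<le> ennreal b')"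
      by metis
    moreover have "(chain_op \<mu> A ^^ 2) ((chain_op \<mu> A ^^ (2 * j)) f) = (chain_op \<mu> A ^^ (2 * Suc j)) f" for f
      by (simp add: numeral_2_eq_2)
    ultimately show ?case by simp
  qed
  have flux_fun: "flux ((chain_op \<mu> A ^^ n) (indicator B)) = flux (indicator B)"
    if [measurable]: "B \<in> sets borel" for n B
  proof (induction n)
    case (Suc n)
    have [measurable]: "(chain_op \<mu> A ^^ n) (indicator B) \<in> borel_measurable borel" by measurable
    have le1: "(chain_op \<mu> A ^^ n) (indicator B) y \<le> 1" for y
    proof (induction n arbitrary: y)
      case (Suc n)
      have "chain_op \<mu> A ((chain_op \<mu> A ^^ n) (indicator B)) y \<le> chain_op \<mu> A (\<lambda>_. 1) y"
        by (rule chain_op_mono_on[of UNIV]) (use Suc in auto)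
      also have "\<dots> \<le> 1" by (rule chain_op_one_le) simp
      finally show ?case by simp
    qed (simp add: indicator_def)
    have "flux (chain_op \<mu> A ((chain_op \<mu> A ^^ n) (indicator B))) = flux ((chain_op \<mu> A ^^ n) (indicator B))"
      by (rule flux_chain_op) (use le1 in auto)
    with Suc show ?case by simp
  qed simp
  obtain w where w: "0 < w" "flux (\<lambda>_. 1) = ennreal w"
    using flux_one_pos flux_one_finite by (cases "flux (\<lambda>_. 1)") auto
  have main: "\<bar>enn2real ((chain_op \<mu> A ^^ Suc n) (indicator B) x)
        - enn2real (flux (indicator B) / flux (\<lambda>_. 1))\<bar> \<le> (1 / \<rho>) * r ^ Suc n"
    if x: "x \<in> Z" and B [measurable]: "B \<in> sets borel" for x n B
  proof -
    \<comment> \<open>One or two of the \<open>n + 1\<close> applications are held back to bring an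
      arbitrary \<open>x \<in> Z\<close> into \<open>A\<close>; as
      \<open>n + 1 \<le> 2 * j + 2\<close>, this costs only the factor
      \<open>1 / \<rho>\<close>.\<close>
    define j where "j = n div 2"
    obtain a b where ab: "0 \<le> a" "a \<le> b" "b - a = (1 - \<delta>) ^ j"
      "\<And>x. x \<in> Z \<inter> A \<Longrightarrow> ennreal a \<le> (chain_op \<mu> A ^^ (2 * j)) (indicator B) x \<and>
        (chain_op \<mu> A ^^ (2 * j)) (indicator B) x \<le> ennreal b" using osc[OF B, of j] by blast
    have n: "Suc n = (Suc n - 2 * j) + 2 * j" "0 < Suc n - 2 * j" by (auto simp: j_def)
    have "ennreal a \<le> (chain_op \<mu> A ^^ Suc n) (indicator B) x \<and> (chain_op \<mu> A ^^ Suc n) (indicator B) x \<le> ennreal b"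
      using chain_op_funpow_bounds[OF ab(4) x, where n = "Suc n - 2 * j"] n(2)
      by (subst (1 2) n(1), unfold funpow_add) simp
    then have Q: "a \<le> enn2real ((chain_op \<mu> A ^^ Suc n) (indicator B) x)"
      "enn2real ((chain_op \<mu> A ^^ Suc n) (indicator B) x) \<le> b"
      using ab(1,2) by (cases "(chain_op \<mu> A ^^ Suc n) (indicator B) x"; auto simp: top_unique)+
    have "flux (\<lambda>_. ennreal a) \<le> flux ((chain_op \<mu> A ^^ (2 * j)) (indicator B))"
      by (rule flux_mono) (use ab in auto)
    moreover have "flux ((chain_op \<mu> A ^^ (2 * j)) (indicator B)) \<le> flux (\<lambda>_. ennreal b)"
      by (rule flux_mono) (use ab in auto)
    ultimately have "ennreal a * ennreal w \<le> flux (indicator B)" "flux (indicator B) \<le> ennreal b * ennreal w"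
      using flux_cmult[of "\<lambda>_. 1" "ennreal a"] flux_cmult[of "\<lambda>_. 1" "ennreal b"]
      by (simp_all add: flux_fun w)
    then have "a \<le> enn2real (flux (indicator B) / flux (\<lambda>_. 1))" "enn2real (flux (indicator B) / flux (\<lambda>_. 1)) \<le> b"
      using ab(1,2) w
      by (cases "flux (indicator B)"; auto simp: divide_ennreal field_simps top_unique simp flip: ennreal_mult)+
    then have "\<bar>enn2real ((chain_op \<mu> A ^^ Suc n) (indicator B) x)
        - enn2real (flux (indicator B) / flux (\<lambda>_. 1))\<bar> \<le> (1 - \<delta>) ^ j"
      using Q ab(3) by linarith
    also have "\<dots> \<le> \<rho> ^ j" using \<delta> \<rho> by (intro power_mono) auto
    also have "\<dots> = r ^ (2 * j)" using r(3) by (simp add: power_mult)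
    also have "\<dots> = (1 / \<rho>) * r ^ (2 * j + 2)" using \<rho> by (simp only: power_add r(3)) simp
    also have "\<dots> \<le> (1 / \<rho>) * r ^ Suc n"
      using \<rho> r by (intro mult_left_mono power_decreasing) (auto simp: j_def)
    finally show ?thesis .
  qed
  have "1 \<le> 1 / \<rho>" using \<rho> by (simp add: field_simps)
  from that[OF r(1,2) this main] show thesis .
qed

end

subsection \<open>Lattices and the span\<close>

lemma lattice_set_pos: "d \<noteq> 0 \<Longrightarrow> lattice_set d = range (\<lambda>k::int. d * of_int k)"
  by (simp add: lattice_set_def)

lemma lattice_set_zero: "lattice_set 0 = UNIV"
  by (simp add: lattice_set_def)

lemma lattice_set_borel [measurable]: "lattice_set d \<in> sets borel"
proof (cases "d = 0")
  case False
  show ?thesis unfolding lattice_set_pos[OF False] by (rule sets.countable) auto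
qed (simp add: lattice_set_zero)

lemma zero_in_lattice_set: "0 \<in> lattice_set d"
  using range_eqI[of 0 "\<lambda>k::int. d * of_int k" 0] by (simp add: lattice_set_def)

lemma add_in_lattice_set: "x \<in> lattice_set d \<Longrightarrow> y \<in> lattice_set d \<Longrightarrow> x + y \<in> lattice_set d"
proof (cases "d = 0")
  case False
  assume "x \<in> lattice_set d" "y \<in> lattice_set d"
  then obtain k l :: int where "x = d * of_int k" "y = d * of_int l"
    unfolding lattice_set_pos[OF False] by blast
  then have "x + y = d * of_int (k + l)" by (simp add: distrib_left)
  then show ?thesis unfolding lattice_set_pos[OF False] by blast
qed (simp add: lattice_set_zero)

lemma uminus_in_lattice_set: "x \<in> lattice_set d \<Longrightarrow> - x \<in> lattice_set d"
proof (cases "d = 0")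
  case False
  assume "x \<in> lattice_set d"
  then obtain k where "x = d * of_int k" using False by (auto simp: lattice_set_def)
  then have "- x = d * of_int (- k)" by simp
  then show ?thesis using False unfolding lattice_set_pos[OF False] by blast
qed (simp add: lattice_set_def)

lemma mult_in_lattice_set: "d * of_int k \<in> lattice_set d"
  by (auto simp: lattice_set_def)

lemma finite_lattice_set_Int:
  fixes a b d :: real
  assumes "0 < d"
  shows "finite {k::int. d * of_int k \<in> {a..b}}"
proof (rule finite_subset)
  show "{k::int. d * of_int k \<in> {a..b}} \<subseteq> {\<lfloor>a / d\<rfloor>..\<lceil>b / d\<rceil>}"
  proof
    fix k :: int assume "k \<in> {k. d * of_int k \<in> {a..b}}"
    then have "a / d \<le> of_int k" "of_int k \<le> b / d" using assms by (auto simp: field_simps)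
    then show "k \<in> {\<lfloor>a / d\<rfloor>..\<lceil>b / d\<rceil>}" by (auto simp: floor_le_iff le_ceiling_iff)
  qed
qed simp

lemma sets_haar_lattice [simp, measurable_cong]: "sets (haar_lattice d) = sets borel"
  by (simp add: haar_lattice_def)

lemma nn_integral_haar_lattice:
  assumes "0 < d" and [measurable]: "f \<in> borel_measurable borel"
  shows "(\<integral>\<^sup>+ x. f x \<partial>haar_lattice d) = ennreal d * (\<integral>\<^sup>+ x. f x \<partial>count_space (lattice_set d))"
proof -
  have "(\<integral>\<^sup>+ x. f x \<partial>distr (count_space (lattice_set d)) borel (\<lambda>x. x))
      = (\<integral>\<^sup>+ x. f x \<partial>count_space (lattice_set d))"
    by (rule nn_integral_distr) auto
  then show ?thesis
    using assms by (simp add: haar_lattice_def nn_integral_scale_measure)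
qed

lemma nn_integral_haar_lattice_window:
  assumes d: "0 < d" and x: "x \<in> lattice_set d" and [measurable]: "g \<in> borel_measurable borel"
  shows "(\<integral>\<^sup>+ y. g y * indicator {x + a..x + b} y \<partial>haar_lattice d)
    = ennreal d * (\<Sum>k | d * of_int k \<in> {a..b}. g (x + d * of_int k))"
proof -
  let ?T = "{k::int. d * of_int k \<in> {a..b}}"
  have inj: "inj_on (\<lambda>k::int. x + d * of_int k) ?T" using d by (auto simp: inj_on_def)
  have "(\<integral>\<^sup>+ y. g y * indicator {x + a..x + b} y \<partial>count_space (lattice_set d))
      = (\<Sum>y\<in>(\<lambda>k::int. x + d * of_int k) ` ?T. g y * indicator {x + a..x + b} y)"
  proof (rule nn_integral_count_space')
    show "finite ((\<lambda>k::int. x + d * of_int k) ` ?T)" using finite_lattice_set_Int[OF d] by simp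
    show "(\<lambda>k::int. x + d * of_int k) ` ?T \<subseteq> lattice_set d"
      by (auto intro!: add_in_lattice_set[OF x] mult_in_lattice_set)
    fix y assume y: "y \<in> lattice_set d" "y \<notin> (\<lambda>k::int. x + d * of_int k) ` ?T"
    have "y - x \<in> lattice_set d"
      using add_in_lattice_set[OF y(1) uminus_in_lattice_set[OF x]] by simp
    then obtain k :: int where k: "y - x = d * of_int k" using d by (auto simp: lattice_set_pos)
    then have "y = x + d * of_int k" by simp
    with y(2) have "d * of_int k \<notin> {a..b}" by blast
    then show "g y * indicator {x + a..x + b} y = 0" using k by (auto simp: indicator_def)
  qed
  also have "\<dots> = (\<Sum>k\<in>?T. g (x + d * of_int k))"
    by (subst sum.reindex[OF inj]) (auto simp: indicator_def intro!: sum.cong)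
  finally show ?thesis using d by (subst nn_integral_haar_lattice) auto
qed

lemma emeasure_haar_lattice_interval:
  assumes "0 < d"
  shows "emeasure (haar_lattice d) {a..b} = ennreal (d * card {k::int. d * of_int k \<in> {a..b}})"
proof -
  have "emeasure (haar_lattice d) {a..b} = (\<integral>\<^sup>+ y. 1 * indicator {0 + a..0 + b} y \<partial>haar_lattice d)"
    by simp
  also have "\<dots> = ennreal d * (\<Sum>k | d * of_int k \<in> {a..b}. 1)"
    by (rule nn_integral_haar_lattice_window[OF assms zero_in_lattice_set]) simp
  finally show ?thesis using assms by (simp add: ennreal_mult ennreal_of_nat_eq_real_of_nat)
qed

lemma haar_walk_haar_lattice:
  assumes "real_distribution \<mu>" and d: "0 \<le> d" and "measure \<mu> (lattice_set d) = 1"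
  shows "haar_walk \<mu> (lattice_set d) (haar_lattice d)"
proof -
  interpret real_distribution \<mu> by fact
  have AE: "AE z in \<mu>. z \<in> lattice_set d"
    using assms(3) AE_in_set_eq_1[of "lattice_set d"] by simp
  show ?thesis
  proof (cases "d = 0")
    case True
    show ?thesis
    proof (unfold True lattice_set_zero, intro haar_walk.intro haar_walk_axioms.intro assms(1))
      show "(\<integral>\<^sup>+ y. f (y + s) \<partial>haar_lattice 0) = (\<integral>\<^sup>+ y. f y \<partial>haar_lattice 0)"
        if "f \<in> borel_measurable borel" for f :: "real \<Rightarrow> ennreal" and s
        using nn_integral_real_affine[of f 1 s] that by (simp add: haar_lattice_def add.commute)
      show "sigma_finite_measure (haar_lattice 0)"
        by (simp add: haar_lattice_def lborel.sigma_finite_measure_axioms)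
    qed (auto simp: haar_lattice_def emeasure_lborel_Icc_eq)
  next
    case False
    with d have d: "0 < d" by simp
    show ?thesis
    proof (intro haar_walk.intro haar_walk_axioms.intro assms(1))
      have sp: "space (haar_lattice d) = UNIV"
        using sets_eq_imp_space_eq[OF sets_haar_lattice[of d]] by simp
      have fin: "emeasure (haar_lattice d) {a..b} < \<infinity>" for a b
        using d by (simp add: emeasure_haar_lattice_interval)
      then show "emeasure (haar_lattice d) {a..b} < \<infinity>" for a b .
      show "sigma_finite_measure (haar_lattice d)"
      proof (rule sigma_finite_measure.intro, intro exI conjI)
        show "countable (range (\<lambda>n::nat. {- real n..real n}))" by simp
        show "\<Union> (range (\<lambda>n::nat. {- real n..real n})) = space (haar_lattice d)"
        proof -
          have "\<exists>n::nat. x \<in> {- real n..real n}" for x :: real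
          proof -
            obtain n :: nat where "\<bar>x\<bar> \<le> real n" using real_arch_simple by blast
            then show ?thesis by (intro exI[of _ n]) auto
          qed
          then show ?thesis unfolding sp by blast
        qed
        show "\<forall>a\<in>range (\<lambda>n::nat. {- real n..real n}). emeasure (haar_lattice d) a \<noteq> \<infinity>"
          using fin by (auto simp: less_top)
      qed auto
      show "AE x in haar_lattice d. x \<in> lattice_set d"
      proof -
        have "(\<integral>\<^sup>+ x. indicator (- lattice_set d) x \<partial>count_space (lattice_set d)) = (\<integral>\<^sup>+ x. 0 \<partial>count_space (lattice_set d))"
          by (intro nn_integral_cong) auto
        then have "(\<integral>\<^sup>+ x. indicator (- lattice_set d) x \<partial>haar_lattice d) = 0"
          using d by (subst nn_integral_haar_lattice) auto
        then show ?thesis by (subst (asm) nn_integral_0_iff_AE) (auto simp: indicator_def)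
      qed
      show "(\<integral>\<^sup>+ y. f (y + s) \<partial>haar_lattice d) = (\<integral>\<^sup>+ y. f y \<partial>haar_lattice d)"
        if s: "s \<in> lattice_set d" and [measurable]: "f \<in> borel_measurable borel" for s and f :: "real \<Rightarrow> ennreal"
      proof -
        have "bij_betw (\<lambda>y. y + s) (lattice_set d) (lattice_set d)"
          by (rule bij_betw_byWitness[where f' = "\<lambda>y. y - s"])
             (use add_in_lattice_set[OF _ s] add_in_lattice_set[OF _ uminus_in_lattice_set[OF s]] in auto)
        then show ?thesis
          using d nn_integral_bij_count_space[of "\<lambda>y. y + s" "lattice_set d" "lattice_set d" f]
          by (subst (1 2) nn_integral_haar_lattice) auto
      qed
      show "0 < emeasure (haar_lattice d) {0..b}" if "0 < b" for b
      proof -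
        have "0 \<in> {k::int. d * of_int k \<in> {0..b}}" using that by simp
        then have "0 < card {k::int. d * of_int k \<in> {0..b}}"
          using finite_lattice_set_Int[OF d, of 0 b] card_gt_0_iff by blast
        then show ?thesis using d by (simp add: emeasure_haar_lattice_interval)
      qed
      show "emeasure (haar_lattice d) UNIV = \<infinity>"
      proof -
        have "infinite (lattice_set d)"
        proof -
          have "inj (\<lambda>k::int. d * of_int k)" using d by (auto simp: inj_on_def)
          moreover have "lattice_set d = range (\<lambda>k::int. d * of_int k)" using d by (simp add: lattice_set_pos)
          ultimately show ?thesis using finite_imageD infinite_UNIV_int by metis
        qed
        then have "(\<integral>\<^sup>+ x. 1 \<partial>count_space (lattice_set d)) = \<infinity>" by simp
        then have "(\<integral>\<^sup>+ x. 1 \<partial>haar_lattice d) = \<infinity>"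
          using d by (subst nn_integral_haar_lattice) (auto simp: ennreal_mult_top)
        then show ?thesis using sp by simp
      qed
    qed (use AE zero_in_lattice_set add_in_lattice_set in auto)
  qed
qed

context real_distribution
begin

text \<open>A law other than the unit mass at 0 charges some \<open>{- R..R} - {0}\<close>, and
  nonzero points of \<open>lattice_set a\<close> have absolute value at least \<open>a\<close>;
  hence \<open>a \<le> R\<close>. Without such a bound the real \<open>Sup\<close> in
  \<open>law_span\<close> would carry no information.\<close>

lemma law_span_bdd_above:
  assumes "prob {0} \<noteq> 1"
  shows "bdd_above {a. 0 \<le> a \<and> prob (lattice_set a) = 1}"
proof -
  have "\<exists>R::nat. prob ({- real R..real R} - {0}) \<noteq> 0"
  proof (rule ccontr)
    assume "\<not> ?thesis"
    then have null: "AE x in M. x \<notin> {- real R..real R} - {0}" for R :: nat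
      by (subst prob_eq_0[symmetric]) auto
    then have "AE x in M. \<forall>R::nat. x \<notin> {- real R..real R} - {0}"
      by (subst AE_all_countable) auto
    then have "AE x in M. x \<in> {0}"
    proof eventually_elim
      case (elim x)
      obtain R :: nat where "\<bar>x\<bar> \<le> real R" using real_arch_simple by blast
      then show ?case using elim[rule_format, of R] by (auto simp: abs_le_iff)
    qed
    then have "prob {0} = 1" by (subst prob_eq_1) auto
    then show False using assms by simp
  qed
  then obtain R :: nat where R: "prob ({- real R..real R} - {0}) \<noteq> 0" by blast
  have "a \<le> real R" if a: "0 \<le> a" "prob (lattice_set a) = 1" for a
  proof (rule ccontr)
    assume "\<not> a \<le> real R"
    then have aR: "real R < a" by simp
    have "AE x in M. x \<in> lattice_set a"
      using a(2) by (subst (asm) prob_eq_1) auto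
    then have "AE x in M. x \<notin> {- real R..real R} - {0}"
    proof eventually_elim
      case (elim x)
      obtain k :: int where k: "x = a * of_int k" using elim aR by (auto simp: lattice_set_def split: if_splits)
      show ?case
      proof
        assume "x \<in> {- real R..real R} - {0}"
        then have "k \<noteq> 0" "\<bar>x\<bar> \<le> real R" using k by auto
        then have "1 \<le> \<bar>real_of_int k\<bar>" by linarith
        then have "a * 1 \<le> a * \<bar>real_of_int k\<bar>" using a(1) by (rule mult_left_mono)
        then have "a \<le> \<bar>x\<bar>" using k a(1) by (simp add: abs_mult)
        then show False using \<open>\<bar>x\<bar> \<le> real R\<close> aR by linarith
      qed
    qed
    then have "prob ({- real R..real R} - {0}) = 0" by (subst prob_eq_0) auto
    then show False using R by simp
  qed
  then show ?thesis by (auto simp: bdd_above_def)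
qed

lemma le_law_span:
  assumes "prob {0} \<noteq> 1" "0 \<le> a" "prob (lattice_set a) = 1"
  shows "a \<le> law_span M"
  unfolding law_span_def by (rule cSup_upper) (use assms law_span_bdd_above in auto)

lemma law_span_nonneg:
  assumes "prob {0} \<noteq> 1"
  shows "0 \<le> law_span M"
proof (rule le_law_span[OF assms])
  show "prob (lattice_set 0) = 1" using prob_space by (simp add: lattice_set_zero)
qed simp

text \<open>If the span \<open>d\<close> is positive, the law is carried by a countable lattice and
  so has an atom \<open>x \<noteq> 0\<close>. Every admissible \<open>a > d / 2\<close> satisfies
  \<open>x = a * k\<close> for an integer \<open>k\<close>, and \<open>\<bar>k\<bar>\<close> is at
  most \<open>2 * \<bar>x\<bar> / d\<close>. Only finitely many values of \<open>a\<close> remain,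
  and their maximum is the supremum.\<close>

lemma prob_lattice_set_law_span:
  assumes "prob {0} \<noteq> 1"
  shows "prob (lattice_set (law_span M)) = 1"
proof (cases "law_span M = 0")
  case True
  then show ?thesis using prob_space by (simp add: lattice_set_zero)
next
  case False
  define S where "S = {a. 0 \<le> a \<and> prob (lattice_set a) = 1}"
  define d where "d = law_span M"
  have d: "0 < d" using False law_span_nonneg[OF assms] by (simp add: d_def)
  have Sup: "d = Sup S" by (simp add: d_def S_def law_span_def)
  have bdd: "bdd_above S" unfolding S_def by (rule law_span_bdd_above[OF assms])
  have ne: "S \<noteq> {}"
    using prob_space by (auto simp: S_def lattice_set_zero intro!: exI[of _ 0])
  define T where "T = {a \<in> S. d / 2 < a}"
  have "d / 2 < Sup S" using d Sup by simp
  then obtain a0 where a0: "a0 \<in> S" "d / 2 < a0" using less_cSup_iff[OF ne bdd] by blast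
  have AE_T: "AE x in M. x \<in> lattice_set a" if "a \<in> S" for a
    using that unfolding S_def by (subst (asm) prob_eq_1) auto
  have "\<exists>x\<in>lattice_set a0. x \<noteq> 0 \<and> prob {x} \<noteq> 0"
  proof (rule ccontr)
    assume "\<not> ?thesis"
    then have "AE y in M. y \<noteq> x" if "x \<in> lattice_set a0 - {0}" for x
      using that by (subst (asm) prob_eq_0) auto
    moreover have "countable (lattice_set a0 - {0})"
      using a0 d by (auto simp: lattice_set_def)
    ultimately have "AE y in M. \<forall>x\<in>lattice_set a0 - {0}. y \<noteq> x"
      by (subst AE_ball_countable) auto
    with AE_T[OF a0(1)] have "AE y in M. y \<in> {0}" by eventually_elim auto
    then have "prob {0} = 1" by (subst prob_eq_1) auto
    then show False using assms by simp
  qed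
  then obtain x where x: "x \<noteq> 0" "prob {x} \<noteq> 0" by blast
  have "T \<subseteq> (\<lambda>k::int. x / of_int k) ` {k. d / 2 * of_int k \<in> {-\<bar>x\<bar>..\<bar>x\<bar>}}"
  proof
    fix a assume a: "a \<in> T"
    have "x \<in> lattice_set a"
    proof (rule ccontr)
      assume "x \<notin> lattice_set a"
      have "AE y in M. y \<in> lattice_set a" using a AE_T by (auto simp: T_def)
      then have "AE y in M. y \<notin> {x}" by eventually_elim (use \<open>x \<notin> lattice_set a\<close> in auto)
      then have "prob {x} = 0" by (subst prob_eq_0) auto
      then show False using x by simp
    qed
    then obtain k :: int where k: "x = a * of_int k" using a d by (auto simp: lattice_set_def T_def split: if_splits)
    have a_pos: "d / 2 \<le> a" using a by (simp add: T_def)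
    have "\<bar>d / 2 * of_int k\<bar> \<le> \<bar>x\<bar>"
    proof -
      have "d / 2 * \<bar>of_int k\<bar> \<le> a * \<bar>of_int k\<bar>" using a_pos by (rule mult_right_mono) simp
      then show ?thesis using a_pos d by (simp add: k abs_mult)
    qed
    moreover have "k \<noteq> 0" using k x by auto
    ultimately show "a \<in> (\<lambda>k::int. x / of_int k) ` {k. d / 2 * of_int k \<in> {-\<bar>x\<bar>..\<bar>x\<bar>}}"
      using k by (intro image_eqI[of _ _ k]) (auto simp: abs_le_iff)
  qed
  moreover have "finite {k. d / 2 * of_int k \<in> {-\<bar>x\<bar>..\<bar>x\<bar>}}"
    using d by (intro finite_lattice_set_Int) simp
  ultimately have "finite T" by (meson finite_imageI finite_subset)
  have "a0 \<in> T" using a0 by (simp add: T_def)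
  then have max: "Max T \<in> T" "\<And>a. a \<in> T \<Longrightarrow> a \<le> Max T" using Max_in \<open>finite T\<close> by auto
  have "d \<le> Max T"
    unfolding Sup
  proof (rule cSup_least[OF ne])
    fix a assume "a \<in> S"
    then show "a \<le> Max T"
      using max(2)[of a] max(2)[OF \<open>a0 \<in> T\<close>] a0 by (cases "d / 2 < a") (auto simp: T_def)
  qed
  moreover have "Max T \<le> d"
    unfolding Sup using max(1) bdd by (intro cSup_upper) (auto simp: T_def)
  ultimately have "d \<in> S" using max(1) by (auto simp: T_def)
  then show ?thesis by (simp add: S_def d_def)
qed

text \<open>If every point of \<open>S\<close> had a null neighbourhood, countably many of them
  would cover \<open>S\<close> by Lindelof, and \<open>S\<close> would be null.\<close>

lemma exists_support_point:
  assumes "0 < emeasure M S" and S: "S \<in> sets borel"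
  shows "\<exists>s\<in>S. \<forall>\<eta>>0. 0 < emeasure M {s - \<eta><..<s + \<eta>}"
proof (rule ccontr)
  assume "\<not> ?thesis"
  then have "\<forall>s\<in>S. \<exists>\<eta>>0. emeasure M {s - \<eta><..<s + \<eta>} = 0" by (auto simp: not_less)
  then obtain \<eta> where \<eta>: "\<And>s. s \<in> S \<Longrightarrow> 0 < \<eta> s" "\<And>s. s \<in> S \<Longrightarrow> emeasure M {s - \<eta> s<..<s + \<eta> s} = 0"
    by metis
  define F where "F = (\<lambda>s. {s - \<eta> s<..<s + \<eta> s}) ` S"
  obtain F' where F': "F' \<subseteq> F" "countable F'" "\<Union>F' = \<Union>F"
  proof (rule Lindelof[of F])
    show "open B" if "B \<in> F" for B using that by (auto simp: F_def)
  qed blast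
  have "(\<Union>B\<in>F'. B) \<in> null_sets M"
    by (rule null_sets_UN') (use F' \<eta>(2) in \<open>auto simp: F_def null_sets_def\<close>)
  moreover have "S \<subseteq> \<Union>F'" unfolding F'(3) F_def using \<eta>(1) by fastforce
  ultimately have "S \<in> null_sets M" using S by (auto intro: null_sets_subset)
  then show False using assms(1) by auto
qed

subsection \<open>Spreading of arithmetic walks\<close>

text \<open>An operator form of the statement that some number of bounded steps realizes the
  displacement \<open>t\<close> with probability at least \<open>p\<close>. It ranges over all
  \<open>g\<close>, measurable or not, so that two such inequalities compose without side
  conditions.\<close>

definition reachable :: "real \<Rightarrow> bool" where
  "reachable t \<longleftrightarrow> (\<exists>j K p. 0 < p \<and>
     (\<forall>x. \<forall>g::real \<Rightarrow> ennreal. ennreal p * g (x + t) \<le> (into_op M {-K..K} ^^ j) g x))"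

lemma into_op_funpow_mono_radius:
  assumes "K \<le> K'"
  shows "(into_op M {-K..K} ^^ j) g x \<le> (into_op M {-K'..K'} ^^ j) g x"
  by (rule step_op_funpow_mono) (use assms in \<open>auto simp: indicator_def\<close>)

lemma reachable_zero: "reachable 0"
  unfolding reachable_def by (intro exI[of _ 0] exI[of _ 1]) auto

lemma reachable_atom:
  assumes "prob {s} \<noteq> 0"
  shows "reachable s"
  unfolding reachable_def
proof (rule exI[of _ 1], rule exI[of _ "\<bar>s\<bar>"], rule exI[of _ "prob {s}"], intro conjI allI)
  show "0 < prob {s}" using assms by (simp add: zero_less_measure_iff)
  fix x and g :: "real \<Rightarrow> ennreal"
  have "ennreal (prob {s}) * g (x + s) = (\<integral>\<^sup>+ z. g (x + s) * indicator {s} z \<partial>M)"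
    by (subst nn_integral_cmult_indicator) (auto simp: emeasure_eq_measure mult.commute)
  also have "\<dots> \<le> into_op M {-\<bar>s\<bar>..\<bar>s\<bar>} g x"
    unfolding step_op_def by (intro nn_integral_mono) (auto simp: indicator_def)
  finally show "ennreal (prob {s}) * g (x + s) \<le> (into_op M {-\<bar>s\<bar>..\<bar>s\<bar>} ^^ 1) g x" by simp
qed

lemma reachable_add:
  assumes "reachable s" "reachable t"
  shows "reachable (s + t)"
proof -
  obtain j K p where s: "0 < p"
    "\<And>x (g::real \<Rightarrow> ennreal). ennreal p * g (x + s) \<le> (into_op M {-K..K} ^^ j) g x"
    using assms(1) unfolding reachable_def by blast
  obtain i L q where t: "0 < q"
    "\<And>x (g::real \<Rightarrow> ennreal). ennreal q * g (x + t) \<le> (into_op M {-L..L} ^^ i) g x"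
    using assms(2) unfolding reachable_def by blast
  define R where "R = max K L"
  have "ennreal (p * q) * g (x + (s + t)) \<le> (into_op M {-R..R} ^^ (j + i)) g x" for x and g :: "real \<Rightarrow> ennreal"
  proof -
    have "ennreal (p * q) * g (x + (s + t)) = ennreal p * (ennreal q * g ((x + s) + t))"
      using s(1) t(1) by (simp add: ennreal_mult mult.assoc add.assoc)
    also have "\<dots> \<le> ennreal p * (into_op M {-L..L} ^^ i) g (x + s)"
      by (intro mult_left_mono t) simp
    also have "\<dots> \<le> ennreal p * (into_op M {-R..R} ^^ i) g (x + s)"
      by (intro mult_left_mono into_op_funpow_mono_radius) (auto simp: R_def)
    also have "\<dots> \<le> (into_op M {-K..K} ^^ j) ((into_op M {-R..R} ^^ i) g) x"
      by (rule s)
    also have "\<dots> \<le> (into_op M {-R..R} ^^ j) ((into_op M {-R..R} ^^ i) g) x"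
      by (intro into_op_funpow_mono_radius) (auto simp: R_def)
    finally show ?thesis by (simp add: funpow_add)
  qed
  moreover have "0 < p * q" using s(1) t(1) by simp
  ultimately show ?thesis unfolding reachable_def by blast
qed

lemma reachable_of_nat_mult: "reachable s \<Longrightarrow> reachable (real n * s)"
  by (induction n) (auto simp: reachable_zero distrib_right intro: reachable_add)

lemma exists_lattice_atom:
  assumes d: "prob (lattice_set d) = 1" "0 < d" and "0 < emeasure M S" and [measurable]: "S \<in> sets borel"
  shows "\<exists>k::int. d * of_int k \<in> S \<and> prob {d * of_int k} \<noteq> 0"
proof (rule ccontr)
  assume none: "\<not> ?thesis"
  have "AE y in M. d * of_int k \<in> S \<longrightarrow> y \<noteq> d * of_int k" for k :: int
  proof (cases "d * of_int k \<in> S")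
    case True
    then have "prob {d * of_int k} = 0" using none by blast
    then show ?thesis by (subst (asm) prob_eq_0) auto
  qed simp
  then have "AE y in M. \<forall>k::int. d * of_int k \<in> S \<longrightarrow> y \<noteq> d * of_int k"
    by (subst AE_all_countable) auto
  moreover have "AE y in M. y \<in> lattice_set d" using d(1) by (subst (asm) prob_eq_1) auto
  ultimately have "AE y in M. y \<notin> S"
    by eventually_elim (use d(2) in \<open>auto simp: lattice_set_pos\<close>)
  then have "prob S = 0" by (subst prob_eq_0) auto
  then show False using assms(3) by (simp add: emeasure_eq_measure)
qed

text \<open>The reachable multiples form an additive semigroup of integers with elements of both
  signs, hence consist of the multiples of some \<open>m\<close>. All atoms then lie in
  \<open>lattice_set (d * m)\<close>, and maximality of the span forces
  \<open>m = 1\<close>.\<close>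

lemma reachable_lattice:
  assumes ne: "prob {0} \<noteq> 1" and d: "0 < law_span M"
    and pos: "0 < emeasure M {0<..}" and neg: "0 < emeasure M {..<0}"
  shows "reachable (law_span M * of_int k)"
proof -
  define d where "d = law_span M"
  have d_pos: "0 < d" and d1: "prob (lattice_set d) = 1"
    using d prob_lattice_set_law_span[OF ne] by (auto simp: d_def)
  define G where "G = {k::int. reachable (d * of_int k)}"
  have G0: "0 \<in> G" using reachable_zero by (simp add: G_def)
  have G_add: "k + l \<in> G" if "k \<in> G" "l \<in> G" for k l
    using reachable_add[of "d * of_int k" "d * of_int l"] that by (simp add: G_def distrib_left)
  have G_mult: "int n * k \<in> G" if "k \<in> G" for n k
    using reachable_of_nat_mult[of "d * of_int k" n] that by (simp add: G_def mult.left_commute)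
  have G_atom: "k \<in> G" if "prob {d * of_int k} \<noteq> 0" for k
    using reachable_atom[OF that] by (simp add: G_def)
  obtain u where u: "u \<in> G" "0 < u"
    using exists_lattice_atom[OF d1 d_pos pos] d_pos G_atom by (auto simp: zero_less_mult_iff)
  obtain v where v: "v \<in> G" "v < 0"
    using exists_lattice_atom[OF d1 d_pos neg] d_pos G_atom by (auto simp: mult_less_0_iff)
  \<comment> \<open>For \<open>k < 0 < u\<close> the combination
    \<open>(u - 1) * k + (- k) * u\<close> has nonnegative coefficients and equals
    \<open>- k\<close>; for positive \<open>k\<close> the element \<open>v < 0\<close> is used
    likewise.\<close>
  have G_uminus: "- k \<in> G" if k: "k \<in> G" for k
  proof (cases k "0 :: int" rule: linorder_cases)
    case less
    have "int (nat (u - 1)) * k + int (nat (- k)) * u \<in> G"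
      by (intro G_add G_mult k u)
    also have "int (nat (u - 1)) * k + int (nat (- k)) * u = - k"
      using u less by (simp add: algebra_simps)
    finally show ?thesis .
  next
    case greater
    have "int (nat (- v - 1)) * k + int (nat k) * v \<in> G"
      by (intro G_add G_mult k v)
    also have "int (nat (- v - 1)) * k + int (nat k) * v = - k"
      using v greater by (simp add: algebra_simps)
    finally show ?thesis .
  qed (use G0 in simp)
  define m where "m = (LEAST m::nat. 0 < m \<and> int m \<in> G)"
  have m: "0 < m" "int m \<in> G"
  proof -
    have "0 < nat u \<and> int (nat u) \<in> G" using u by simp
    then have "0 < m \<and> int m \<in> G" unfolding m_def by (rule LeastI)
    then show "0 < m" "int m \<in> G" by auto
  qed
  have dvd: "int m dvd k" if k: "k \<in> G" for k
  proof -
    have mult: "l * int m \<in> G" for l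
      using G_mult[OF m(2), of "nat l"] G_mult[OF G_uminus[OF m(2)], of "nat (- l)"]
      by (cases "0 \<le> l") auto
    have "k mod int m = k + (- (k div int m)) * int m"
      using div_mult_mod_eq[of k "int m"] by (simp add: algebra_simps)
    then have "k mod int m \<in> G" by (metis G_add[OF k mult])
    moreover have "0 \<le> k mod int m" "k mod int m < int m" using m by simp_all
    moreover have "\<not> (0 < n \<and> int n \<in> G)" if "n < m" for n
      using not_less_Least[of n "\<lambda>m. 0 < m \<and> int m \<in> G"] that unfolding m_def by blast
    from this[of "nat (k mod int m)"] have "k mod int m \<le> 0 \<or> k mod int m \<notin> G"
      using \<open>k mod int m < int m\<close> \<open>0 \<le> k mod int m\<close> by auto
    ultimately have "k mod int m = 0" by linarith
    then show ?thesis by (simp add: dvd_eq_mod_eq_0)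
  qed
  have "AE y in M. y \<in> lattice_set (d * real m)"
  proof -
    have "AE y in M. \<not> int m dvd k \<longrightarrow> y \<noteq> d * of_int k" for k :: int
    proof (cases "int m dvd k")
      case False
      then have "prob {d * of_int k} = 0" using G_atom dvd by blast
      then show ?thesis by (subst (asm) prob_eq_0) auto
    qed simp
    then have "AE y in M. \<forall>k::int. \<not> int m dvd k \<longrightarrow> y \<noteq> d * of_int k"
      by (subst AE_all_countable) auto
    moreover have "AE y in M. y \<in> lattice_set d" using d1 by (subst (asm) prob_eq_1) auto
    ultimately show ?thesis
    proof eventually_elim
      case (elim y)
      obtain k :: int where k: "y = d * of_int k" using elim(2) d_pos by (auto simp: lattice_set_pos)
      then have "int m dvd k" using elim(1) by blast
      then obtain l where "k = int m * l" by blast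
      then have "y = (d * real m) * of_int l" using k by simp
      then show ?case using mult_in_lattice_set by metis
    qed
  qed
  then have "prob (lattice_set (d * real m)) = 1" by (subst prob_eq_1) auto
  then have "d * real m \<le> d" using le_law_span[OF ne] d_pos by (simp add: d_def)
  then have "m = 1" using d_pos m(1) by simp
  then have "k \<in> G" for k
    using m G_mult[OF m(2), of "nat k"] G_mult[OF G_uminus[OF m(2)], of "nat (- k)"] by (cases "0 \<le> k") auto
  then show ?thesis by (simp add: G_def d_def)
qed

text \<open>A window contains finitely many lattice points, each reached after its own number of
  steps; the sum over step numbers collects them all, with the smallest of the finitely many
  probabilities.\<close>

lemma spread_arithmetic:
  assumes ne: "prob {0} \<noteq> 1" and d: "0 < law_span M"
    and pos: "0 < emeasure M {0<..}" and neg: "0 < emeasure M {..<0}"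
  shows "\<exists>K n c. 0 < c \<and> (\<forall>x\<in>lattice_set (law_span M). \<forall>g\<in>borel_measurable borel.
      ennreal c * (\<integral>\<^sup>+ y. g y * indicator {x - l..x + l} y \<partial>haar_lattice (law_span M))
        \<le> (\<Sum>j\<le>n. (into_op M {-K..K} ^^ j) g x))"
proof -
  define d where "d = law_span M"
  have d_pos: "0 < d" using d by (simp add: d_def)
  define T where "T = {k::int. d * of_int k \<in> {-l..l}}"
  have T: "finite T" unfolding T_def by (rule finite_lattice_set_Int[OF d_pos])
  have "\<forall>k. \<exists>j K p. 0 < p \<and>
     (\<forall>x. \<forall>g::real \<Rightarrow> ennreal. ennreal p * g (x + d * of_int k) \<le> (into_op M {-K..K} ^^ j) g x)"
    using reachable_lattice[OF assms] unfolding reachable_def d_def by blast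
  then obtain j K p where R: "\<And>k::int. 0 < p k"
    "\<And>k x (g::real \<Rightarrow> ennreal). ennreal (p k) * g (x + d * of_int k) \<le> (into_op M {-K k..K k} ^^ j k) g x"
    by metis
  \<comment> \<open>The inserted 0 and 1 take care of an empty window.\<close>
  define n where "n = Max (insert 0 (j ` T))"
  define Q where "Q = Max (insert 0 (K ` T))"
  define q where "q = Min (insert 1 (p ` T))"
  define N where "N = real (Suc (card T))"
  have n: "j k \<le> n" "K k \<le> Q" "q \<le> p k" if "k \<in> T" for k
    using T that by (auto simp: n_def Q_def q_def)
  have q: "0 < q" using T R(1) by (simp add: q_def)
  \<comment> \<open>Chosen so that \<open>c * d\<close> times the number of lattice points in the
    window is at most \<open>q\<close>.\<close>
  define c where "c = q / (d * N)"
  have N: "0 < N" by (simp add: N_def)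
  have c: "0 < c" "c * d = q / N" using q d_pos N by (auto simp: c_def)
  have "ennreal c * (\<integral>\<^sup>+ y. g y * indicator {x - l..x + l} y \<partial>haar_lattice d)
        \<le> (\<Sum>i\<le>n. (into_op M {-Q..Q} ^^ i) g x)" (is "_ \<le> ?V")
    if x: "x \<in> lattice_set d" and [measurable]: "g \<in> borel_measurable borel" for x g
  proof -
    have V: "ennreal q * g (x + d * of_int k) \<le> ?V" if k: "k \<in> T" for k
    proof -
      have "ennreal q * g (x + d * of_int k) \<le> ennreal (p k) * g (x + d * of_int k)"
        by (intro mult_right_mono ennreal_leI n k) simp
      also have "\<dots> \<le> (into_op M {-K k..K k} ^^ j k) g x" by (rule R)
      also have "\<dots> \<le> (into_op M {-Q..Q} ^^ j k) g x" by (intro into_op_funpow_mono_radius n k)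
      also have "\<dots> \<le> ?V" using n(1)[OF k] by (intro member_le_sum) auto
      finally show ?thesis .
    qed
    have "ennreal c * (\<integral>\<^sup>+ y. g y * indicator {x - l..x + l} y \<partial>haar_lattice d)
        = ennreal c * (ennreal d * (\<Sum>k\<in>T. g (x + d * of_int k)))"
      using nn_integral_haar_lattice_window[OF d_pos x, of g "-l" l] by (simp add: T_def)
    also have "\<dots> = ennreal (1 / N) * (\<Sum>k\<in>T. ennreal q * g (x + d * of_int k))"
    proof -
      have "ennreal c * ennreal d = ennreal (1 / N) * ennreal q"
        using c d_pos q N by (simp flip: ennreal_mult)
      then show ?thesis by (simp add: mult.assoc[symmetric] sum_distrib_left[symmetric])
    qed
    also have "\<dots> \<le> ennreal (1 / N) * (\<Sum>k\<in>T. ?V)"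
      by (intro mult_left_mono sum_mono V) auto
    also have "\<dots> \<le> ennreal (1 / N) * (ennreal N * ?V)"
      by (intro mult_left_mono) (auto simp: N_def ennreal_of_nat_eq_real_of_nat[symmetric] intro!: mult_right_mono)
    also have "\<dots> = ?V" using N by (simp add: mult.assoc[symmetric] flip: ennreal_mult)
    finally show ?thesis .
  qed
  then show ?thesis using c(1) unfolding d_def[symmetric] by blast
qed

end

subsection \<open>Spreading of spread-out walks\<close>

text \<open>
  A Steinhaus argument: if \<open>D\<close> is compact and invariant under \<open>y \<mapsto> w - y\<close>, then \<open>D \<inter> (v - D)\<close> is a
  translate-overlap of \<open>D\<close>, which has almost full measure for \<open>v\<close> near \<open>w\<close>.
\<close>

lemma convolution_square_interval:
  assumes [measurable]: "B \<in> sets borel" and B: "0 < emeasure lborel B" "B \<subseteq> {- R..R}"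
  obtains \<epsilon> w \<delta> :: real where "0 < \<epsilon>" "0 < \<delta>"
    "\<And>v. v \<in> {w - \<delta>..w + \<delta>} \<Longrightarrow>
      ennreal \<epsilon> \<le> (\<integral>\<^sup>+ y. indicator B y * indicator B (v - y) \<partial>lborel)"
proof -
  have fin: "emeasure lborel S < top" if "S \<subseteq> {- R..R}" for S
    using emeasure_mono[OF that, of lborel] emeasure_lborel_Icc_eq[of "- R" R]
    by (auto intro: le_less_trans)
  obtain b where b: "0 < b" "emeasure lborel B = ennreal b"
    using B fin[OF B(2)] by (cases "emeasure lborel B") auto
  have "{- R..R} - B \<in> sets borel" "0 < b / 2" using b by auto
  then obtain U where U: "open U" "{- R..R} - B \<subseteq> U" "emeasure lborel (U - ({- R..R} - B)) < b / 2"
    using outer_regular_lborel by metis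
  have [measurable]: "U \<in> sets borel" using U(1) by simp
  \<comment> \<open>Outer regularity of the complement is inner regularity of \<open>B\<close>:
    \<open>C\<close> is a compact subset that loses less than half of the mass.\<close>
  define C where "C = {- R..R} - U"
  have CB: "C \<subseteq> B" using U(2) by (auto simp: C_def)
  have "compact C" unfolding C_def using U(1) by (intro compact_diff) auto
  have [measurable]: "C \<in> sets borel" unfolding C_def by measurable
  have C_pos: "0 < emeasure lborel C"
  proof (rule ccontr)
    assume "\<not> ?thesis"
    then have "emeasure lborel C = 0" by simp
    moreover have "B \<subseteq> C \<union> (U - ({- R..R} - B))" using B(2) by (auto simp: C_def)
    then have "emeasure lborel B \<le> emeasure lborel C + emeasure lborel (U - ({- R..R} - B))"
      by (intro order_trans[OF emeasure_mono emeasure_subadditive]) auto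
    ultimately have "ennreal b < ennreal (b / 2)" using U(3) b(2) by (auto intro: le_less_trans)
    then show False using b(1) by (simp add: ennreal_less_iff)
  qed
  \<comment> \<open>Integrated over all \<open>w\<close>, the overlaps have total mass equal to the
    square of the measure of \<open>C\<close>, so one of them is positive.\<close>
  have "\<exists>w. (\<integral>\<^sup>+ y. indicator C y * indicator C (w - y) \<partial>lborel) \<noteq> (0::ennreal)"
  proof (rule ccontr)
    assume "\<not> ?thesis"
    then have "0 = (\<integral>\<^sup>+ w. \<integral>\<^sup>+ y. indicator C y * indicator C (w - y) \<partial>lborel \<partial>lborel :: ennreal)" by simp
    also have "\<dots> = (\<integral>\<^sup>+ y. \<integral>\<^sup>+ w. indicator C y * indicator C (w - y) \<partial>lborel \<partial>lborel)"
      by (rule lborel_pair.Fubini') (simp add: measurable_split_conv)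
    also have "\<dots> = (\<integral>\<^sup>+ y. indicator C y * emeasure lborel C \<partial>lborel)"
    proof (rule nn_integral_cong)
      fix y :: real
      have "(\<integral>\<^sup>+ w. indicator C (w - y) \<partial>lborel) = emeasure lborel C"
        using nn_integral_real_affine[of "indicator C" 1 "- y"] by simp
      then show "(\<integral>\<^sup>+ w. indicator C y * indicator C (w - y) \<partial>lborel) = indicator C y * emeasure lborel C"
        by (simp add: nn_integral_cmult)
    qed
    also have "\<dots> = emeasure lborel C * emeasure lborel C"
      by (simp add: nn_integral_multc)
    finally show False using C_pos by auto
  qed
  then obtain w where w: "(\<integral>\<^sup>+ y. indicator C y * indicator C (w - y) \<partial>lborel) \<noteq> (0::ennreal)" by blast
  define D where "D = C \<inter> (\<lambda>y. w - y) ` C"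
  have D_iff: "y \<in> D \<longleftrightarrow> y \<in> C \<and> w - y \<in> C" for y
    unfolding D_def by (auto intro: image_eqI[of _ _ "w - y"])
  have "compact D" unfolding D_def
    using \<open>compact C\<close> by (intro compact_Int compact_continuous_image continuous_intros)
  then have [measurable]: "D \<in> sets borel" by (simp add: borel_compact)
  have "D \<subseteq> {- R..R}" using CB B(2) by (auto simp: D_iff)
  have "(\<integral>\<^sup>+ y. indicator C y * indicator C (w - y) \<partial>lborel) = (\<integral>\<^sup>+ y. indicator D y \<partial>lborel)"
    by (intro nn_integral_cong) (auto simp: indicator_def D_iff)
  then have "emeasure lborel D \<noteq> 0" using w by simp
  then obtain e where e: "0 < e" "emeasure lborel D = ennreal e"
    using fin[OF \<open>D \<subseteq> {- R..R}\<close>] by (cases "emeasure lborel D") auto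
  then have "D \<in> sets borel" "0 < e / 2" by auto
  then obtain V where V: "open V" "D \<subseteq> V" "emeasure lborel (V - D) < e / 2"
    using outer_regular_lborel by metis
  have [measurable]: "V \<in> sets borel" using V(1) by simp
  obtain \<delta> where \<delta>: "0 < \<delta>" "(\<Union>x\<in>D. cball x \<delta>) \<subseteq> V"
    using compact_subset_open_imp_cball_epsilon_subset[OF \<open>compact D\<close> V(1,2)] by blast
  \<comment> \<open>If \<open>v - y \<in> D\<close>, then its mirror image
    \<open>w - (v - y)\<close> lies in \<open>D\<close> and within \<open>\<delta>\<close> of
    \<open>y\<close>, so \<open>y \<in> V\<close>. Apart from \<open>V - D\<close>, of measure below
    \<open>e / 2\<close>, both \<open>y\<close> and \<open>v - y\<close> are then in
    \<open>D\<close> and hence in \<open>B\<close>.\<close>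
  have "ennreal (e / 2) \<le> (\<integral>\<^sup>+ y. indicator B y * indicator B (v - y) \<partial>lborel)"
    if v: "v \<in> {w - \<delta>..w + \<delta>}" for v
  proof -
    have sym: "y \<in> D \<longleftrightarrow> w - y \<in> D" for y by (auto simp: D_iff)
    have "(\<integral>\<^sup>+ y. indicator D (v - y) \<partial>lborel) = (\<integral>\<^sup>+ y. indicator D (y - (v - w)) \<partial>lborel)"
    proof (intro nn_integral_cong)
      fix y
      have "v - y \<in> D \<longleftrightarrow> w - (v - y) \<in> D" by (rule sym)
      then show "indicator D (v - y) = (indicator D (y - (v - w)) :: ennreal)"
        by (simp add: indicator_def algebra_simps)
    qed
    also have "\<dots> = ennreal e"
    proof -
      have "y - (v - w) = - (v - w) + 1 * y" for y by simp
      then show ?thesis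
        using nn_integral_real_affine[of "indicator D" 1 "- (v - w)"] by (simp only: e) (simp add: e)
    qed
    finally have shifted: "(\<integral>\<^sup>+ y. indicator D (v - y) \<partial>lborel) = ennreal e" .
    have "indicator D (v - y) \<le> (indicator B y * indicator B (v - y) + indicator (V - D) y :: ennreal)" for y
    proof (cases "v - y \<in> D")
      case True
      then have "w - (v - y) \<in> D" using sym by blast
      moreover have "y \<in> cball (w - (v - y)) \<delta>" using v by (auto simp: dist_real_def abs_le_iff)
      ultimately have "y \<in> V" using \<delta>(2) by blast
      then show ?thesis using True CB by (auto simp: indicator_def D_iff)
    qed simp
    then have "ennreal e \<le> (\<integral>\<^sup>+ y. indicator B y * indicator B (v - y) + indicator (V - D) y \<partial>lborel)"
      unfolding shifted[symmetric] by (intro nn_integral_mono) auto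
    also have "\<dots> = (\<integral>\<^sup>+ y. indicator B y * indicator B (v - y) \<partial>lborel) + emeasure lborel (V - D)"
      by (subst nn_integral_add) auto
    also have "\<dots> \<le> (\<integral>\<^sup>+ y. indicator B y * indicator B (v - y) \<partial>lborel) + ennreal (e / 2)"
      by (intro add_left_mono) (use V(3) in auto)
    finally have "ennreal (e / 2) + ennreal (e / 2)
        \<le> (\<integral>\<^sup>+ y. indicator B y * indicator B (v - y) \<partial>lborel) + ennreal (e / 2)"
      using e(1) by (simp flip: ennreal_plus)
    then show ?thesis by (rule ennreal_add_right_mono_cancel) simp
  qed
  from that[of "e / 2" \<delta> w, OF _ \<delta>(1) this] e(1) show thesis by simp
qed

context real_distribution
begin

text \<open>Truncated steps act by convolution with one finite measure, independent of the start; as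
  a measure it can be compared with Lebesgue measure by a Hahn decomposition.\<close>

lemma into_op_funpow_measure:
  assumes [measurable]: "S \<in> sets borel"
  shows "\<exists>\<rho>. finite_measure \<rho> \<and> sets \<rho> = sets borel \<and>
    (\<forall>g\<in>borel_measurable borel. \<forall>x. (into_op M S ^^ m) g x = (\<integral>\<^sup>+ y. g (x + y) \<partial>\<rho>))"
proof (induction m)
  case 0
  show ?case
    by (rule exI[of _ "return borel 0"])
       (auto simp: nn_integral_return intro!: prob_space.finite_measure prob_space_return)
next
  case (Suc m)
  then obtain \<rho> where "finite_measure \<rho>" and [measurable_cong]: "sets \<rho> = sets borel"
    and \<rho>: "\<And>g x. g \<in> borel_measurable borel \<Longrightarrow> (into_op M S ^^ m) g x = (\<integral>\<^sup>+ y. g (x + y) \<partial>\<rho>)"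
    by blast
  interpret \<rho>: finite_measure \<rho> by fact
  define P where "P = distr (density M (indicator S) \<Otimes>\<^sub>M \<rho>) borel (\<lambda>(z, y). z + y)"
  have P: "(into_op M S ^^ Suc m) g x = (\<integral>\<^sup>+ y. g (x + y) \<partial>P)"
    if [measurable]: "g \<in> borel_measurable borel" for g x
  proof -
    have "(\<integral>\<^sup>+ y. g (x + y) \<partial>P) = (\<integral>\<^sup>+ p. (case p of (z, y) \<Rightarrow> g (x + (z + y))) \<partial>(density M (indicator S) \<Otimes>\<^sub>M \<rho>))"
      unfolding P_def by (subst nn_integral_distr) (auto intro!: nn_integral_cong)
    also have "\<dots> = (\<integral>\<^sup>+ z. \<integral>\<^sup>+ y. g (x + (z + y)) \<partial>\<rho> \<partial>density M (indicator S))"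
      by (subst \<rho>.nn_integral_fst[symmetric]) auto
    also have "\<dots> = (\<integral>\<^sup>+ z. indicator S z * (\<integral>\<^sup>+ y. g (x + (z + y)) \<partial>\<rho>) \<partial>M)"
      by (rule nn_integral_density) auto
    also have "\<dots> = (into_op M S ^^ Suc m) g x"
      by (simp add: step_op_def \<rho> add.assoc)
    finally show ?thesis by simp
  qed
  have "(into_op M S ^^ Suc m) (\<lambda>_. 1) 0 \<le> (free_op M ^^ Suc m) (\<lambda>_. 1) 0"
    by (rule step_op_funpow_mono) (auto simp: indicator_def)
  also have "\<dots> = 1" by (rule free_op_funpow_const)
  finally have "emeasure P (space P) \<le> 1"
    by (subst (asm) P) auto
  then have "finite_measure P"
    by (intro finite_measureI) (auto simp: top_unique)
  moreover have "sets P = sets borel" by (simp add: P_def)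
  ultimately show ?case using P by blast
qed

text \<open>Monotone convergence in the truncation. It carries nonsingularity of the free walk over
  to a walk with bounded steps.\<close>

lemma into_op_funpow_SUP:
  assumes [measurable]: "f \<in> borel_measurable borel"
  shows "(free_op M ^^ m) f x = (SUP K::nat. (into_op M {- real K..real K} ^^ m) f x)"
proof (induction m arbitrary: x)
  case (Suc m)
  let ?u = "\<lambda>K::nat. (into_op M {- real K..real K} ^^ m) f"
  have inc: "?u K y \<le> ?u L y" if "K \<le> L" for K L y
    by (rule into_op_funpow_mono_radius) (use that in simp)
  have "(SUP K::nat. ?u K (x + z)) = (SUP K::nat. indicator {- real K..real K} z * ?u K (x + z))" for z
  proof (rule antisym)
    show "(SUP K::nat. ?u K (x + z)) \<le> (SUP K::nat. indicator {- real K..real K} z * ?u K (x + z))"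
    proof (rule SUP_least)
      fix K :: nat
      obtain L :: nat where L: "\<bar>z\<bar> \<le> real L" using real_arch_simple by blast
      \<comment> \<open>Under the larger bound both the current step and the remaining truncated
        steps are admissible.\<close>
      have "?u K (x + z) \<le> indicator {- real (max K L)..real (max K L)} z * ?u (max K L) (x + z)"
        using inc[of K "max K L" "x + z"] L by (auto simp: indicator_def)
      also have "\<dots> \<le> (SUP K::nat. indicator {- real K..real K} z * ?u K (x + z))"
        by (rule SUP_upper) simp
      finally show "?u K (x + z) \<le> (SUP K::nat. indicator {- real K..real K} z * ?u K (x + z))" .
    qed
    show "(SUP K::nat. indicator {- real K..real K} z * ?u K (x + z)) \<le> (SUP K::nat. ?u K (x + z))"
      by (rule SUP_mono) (auto simp: indicator_def)
  qed
  note SUP_eq = this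
  have "(free_op M ^^ m) f = (\<lambda>y. SUP K::nat. ?u K y)" using Suc by blast
  then have "(free_op M ^^ Suc m) f x = (\<integral>\<^sup>+ z. (SUP K::nat. ?u K (x + z)) \<partial>M)"
    by (simp add: step_op_def[of M "\<lambda>_ _. 1"])
  also have "\<dots> = (\<integral>\<^sup>+ z. (SUP K::nat. indicator {- real K..real K} z * ?u K (x + z)) \<partial>M)"
    by (simp only: SUP_eq)
  also have "\<dots> = (SUP K::nat. \<integral>\<^sup>+ z. indicator {- real K..real K} z * ?u K (x + z) \<partial>M)"
  proof (rule nn_integral_monotone_convergence_SUP)
    show "incseq (\<lambda>(K::nat) z. indicator {- real K..real K} z * ?u K (x + z))"
      unfolding incseq_def le_fun_def by (intro allI impI mult_mono inc) (auto simp: indicator_def)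
  qed measurable
  also have "\<dots> = (SUP K::nat. (into_op M {- real K..real K} ^^ Suc m) f x)"
    by (simp add: step_op_def[of M "\<lambda>x z. indicator S z" for S])
  finally show ?case .
qed simp

text \<open>Each \<open>\<rho> K\<close> is compared, through Hahn sets \<open>Y\<close>, with
  Lebesgue measure on \<open>{- R..R}\<close> divided by \<open>n + 1\<close>. If all sets
  \<open>Y\<close> were null within \<open>{- R..R}\<close>, then off their union \<open>N\<close>
  every \<open>\<rho> K\<close> would lie below all these multiples and vanish, and the free walk at
  time \<open>m\<close> would be carried by the null set \<open>N\<close>.\<close>

lemma nonsingular_imp_density:
  assumes ns: "\<And>N. N \<in> sets borel \<Longrightarrow> emeasure lborel N = 0 \<Longrightarrow>
      (free_op M ^^ m) (indicator (- N)) 0 \<noteq> 0"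
  obtains K R c B where "0 < c" "B \<in> sets borel" "0 < emeasure lborel B" "B \<subseteq> {- R..R}"
    "\<And>g x. g \<in> borel_measurable borel \<Longrightarrow>
      ennreal c * (\<integral>\<^sup>+ y. g (x + y) * indicator B y \<partial>lborel) \<le> (into_op M {- K..K} ^^ m) g x"
proof -
  have "\<forall>K. \<exists>\<rho>. finite_measure \<rho> \<and> sets \<rho> = sets borel \<and>
    (\<forall>g\<in>borel_measurable borel. \<forall>x. (into_op M {- K..K} ^^ m) g x = (\<integral>\<^sup>+ y. g (x + y) \<partial>\<rho>))"
    using into_op_funpow_measure by auto
  then obtain \<rho> where \<rho>: "\<And>K. finite_measure (\<rho> K)" "\<And>K. sets (\<rho> K) = sets borel"
    "\<And>K g x. g \<in> borel_measurable borel \<Longrightarrow> (into_op M {- K..K} ^^ m) g x = (\<integral>\<^sup>+ y. g (x + y) \<partial>\<rho> K)"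
    by metis
  note \<rho>(2)[measurable_cong]
  define \<kappa> where "\<kappa> n R = density lborel (\<lambda>y. ennreal (1 / real (Suc n)) * indicator {- R..R} y)" for n :: nat and R :: real
  have sets_kappa [measurable_cong]: "sets (\<kappa> n R) = sets borel" for n R by (simp add: \<kappa>_def)
  have kappa: "emeasure (\<kappa> n R) E = ennreal (1 / real (Suc n)) * emeasure lborel (E \<inter> {- R..R})"
    if [measurable]: "E \<in> sets borel" for n R E
  proof -
    have "emeasure (\<kappa> n R) E = (\<integral>\<^sup>+ y. ennreal (1 / real (Suc n)) * indicator {- R..R} y * indicator E y \<partial>lborel)"
      unfolding \<kappa>_def by (rule emeasure_density) auto
    also have "\<dots> = (\<integral>\<^sup>+ y. ennreal (1 / real (Suc n)) * indicator (E \<inter> {- R..R}) y \<partial>lborel)"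
      by (intro nn_integral_cong) (auto simp: indicator_def)
    finally show ?thesis by (simp add: nn_integral_cmult_indicator)
  qed
  have fin_kappa: "finite_measure (\<kappa> n R)" for n R
  proof (rule finite_measureI)
    have "space (\<kappa> n R) = UNIV" by (simp add: \<kappa>_def)
    then show "emeasure (\<kappa> n R) (space (\<kappa> n R)) \<noteq> \<infinity>"
      by (simp add: kappa emeasure_lborel_Icc_eq ennreal_mult_eq_top_iff)
  qed
  define pos where "pos K n R Y \<longleftrightarrow> Y \<in> sets borel \<and>
      (\<forall>E\<in>sets borel. E \<subseteq> Y \<longrightarrow> \<kappa> n R E \<le> \<rho> K E) \<and>
      (\<forall>E\<in>sets borel. E \<inter> Y = {} \<longrightarrow> \<rho> K E \<le> \<kappa> n R E)" for K n R Y
  define Y where "Y K n R = (SOME Y. pos K n R Y)" for K n R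
  have "\<exists>Y. pos K n R Y" for K n R
    using finite_unsigned_Hahn_decomposition[of "\<rho> K" "\<kappa> n R"] \<rho>(1,2) fin_kappa sets_kappa
    unfolding pos_def by auto
  then have pos: "pos K n R (Y K n R)" for K n R
    unfolding Y_def by (rule someI_ex)
  then have Y: "\<And>K n R. Y K n R \<in> sets borel"
    "\<And>K n R E. E \<in> sets borel \<Longrightarrow> E \<subseteq> Y K n R \<Longrightarrow> \<kappa> n R E \<le> \<rho> K E"
    "\<And>K n R E. E \<in> sets borel \<Longrightarrow> E \<inter> Y K n R = {} \<Longrightarrow> \<rho> K E \<le> \<kappa> n R E"
    unfolding pos_def by blast+
  note Y(1)[measurable]
  have "\<exists>(K::nat) n (R::nat). emeasure lborel (Y (real K) n (real R) \<inter> {- real R..real R}) \<noteq> 0"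
  proof (rule ccontr)
    assume "\<not> ?thesis"
    then have null: "emeasure lborel (Y (real K) n (real R) \<inter> {- real R..real R}) = 0" for K n R :: nat by blast
    define N where "N = (\<Union>(K::nat) n (R::nat). Y (real K) n (real R) \<inter> {- real R..real R})"
    have N_null: "N \<in> null_sets lborel"
      unfolding N_def by (intro null_sets_UN) (use null in \<open>auto simp: null_sets_def\<close>)
    then have [measurable]: "N \<in> sets borel" by auto
    from N_null have "(free_op M ^^ m) (indicator (- N)) 0 \<noteq> 0" by (intro ns) auto
    moreover have "\<rho> K (- N) = 0" for K :: nat
    proof -
      have "\<rho> K (- N \<inter> {- real R..real R}) = 0" (is "\<rho> K ?E = 0") for R :: nat
      proof -
        have "\<rho> K ?E \<le> ennreal (1 / real (Suc n)) * ennreal (2 * real R)" for n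
        proof -
          have "\<rho> K ?E \<le> \<kappa> n R ?E"
            by (rule Y(3)) (auto simp: N_def)
          also have "\<dots> \<le> ennreal (1 / real (Suc n)) * emeasure lborel {- real R..real R}"
          proof -
            have "emeasure lborel (?E \<inter> {- real R..real R}) \<le> emeasure lborel {- real R..real R}"
              by (rule emeasure_mono) auto
            then show ?thesis by (subst kappa, simp) (rule mult_left_mono, simp_all)
          qed
          finally show ?thesis by (simp add: emeasure_lborel_Icc_eq)
        qed
        then have le: "\<rho> K ?E \<le> ennreal (1 / real (Suc n) * (2 * real R))" for n
          by (subst ennreal_mult) auto
        have "(\<lambda>n. 1 / real (Suc n) * (2 * real R)) \<longlonglongrightarrow> 0 * (2 * real R)"
          by (intro tendsto_mult lim_inverse_n'[THEN LIMSEQ_Suc] tendsto_const)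
        then have "(\<lambda>n. ennreal (1 / real (Suc n) * (2 * real R))) \<longlonglongrightarrow> ennreal 0"
          by (intro tendsto_ennrealI) simp
        then have "\<rho> K ?E \<le> ennreal 0"
          by (rule LIMSEQ_le_const) (use le in auto)
        then show ?thesis by simp
      qed
      then have "(\<Union>R::nat. - N \<inter> {- real R..real R}) \<in> null_sets (\<rho> K)"
        by (intro null_sets_UN) (auto simp: null_sets_def \<rho>(2))
      moreover have "(\<Union>R::nat. - N \<inter> {- real R..real R}) = - N"
      proof -
        have "\<exists>R::nat. y \<in> {- real R..real R}" for y :: real
        proof -
          obtain R :: nat where "\<bar>y\<bar> \<le> real R" using real_arch_simple by blast
          then show ?thesis by (intro exI[of _ R]) auto
        qed
        then show ?thesis by auto
      qed
      ultimately show ?thesis by auto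
    qed
    then have "(into_op M {- real K..real K} ^^ m) (indicator (- N)) 0 = 0" for K :: nat
      by (subst \<rho>(3)) auto
    then have "(free_op M ^^ m) (indicator (- N)) 0 = 0"
      by (subst into_op_funpow_SUP) auto
    ultimately show False by blast
  qed
  then obtain K n R :: nat where KnR: "emeasure lborel (Y (real K) n (real R) \<inter> {- real R..real R}) \<noteq> 0" by blast
  define B where "B = Y (real K) n (real R) \<inter> {- real R..real R}"
  have [measurable]: "B \<in> sets borel" unfolding B_def by measurable
  have "ennreal (1 / real (Suc n)) * (\<integral>\<^sup>+ y. g (x + y) * indicator B y \<partial>lborel) \<le> (into_op M {- real K..real K} ^^ m) g x"
    if [measurable]: "g \<in> borel_measurable borel" for g x
  proof -
    let ?D = "density lborel (\<lambda>y. ennreal (1 / real (Suc n)) * indicator B y)"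
    have "ennreal (1 / real (Suc n)) * (\<integral>\<^sup>+ y. g (x + y) * indicator B y \<partial>lborel) = (\<integral>\<^sup>+ y. g (x + y) \<partial>?D)"
      by (subst nn_integral_density, measurable, subst nn_integral_cmult[symmetric]) (auto intro!: nn_integral_cong simp: mult_ac)
    also have "\<dots> \<le> (\<integral>\<^sup>+ y. g (x + y) \<partial>\<rho> K)"
    proof (rule nn_integral_mono_measure)
      have sp: "space (\<rho> K) = UNIV" using sets_eq_imp_space_eq[OF \<rho>(2)] by simp
      have "?D E \<le> \<rho> K E" for E
      proof (cases "E \<in> sets borel")
        case True
        note True[measurable]
        have "?D E = (\<integral>\<^sup>+ y. ennreal (1 / real (Suc n)) * indicator B y * indicator E y \<partial>lborel)"
          by (rule emeasure_density) auto
        also have "\<dots> = (\<integral>\<^sup>+ y. ennreal (1 / real (Suc n)) * indicator (E \<inter> B) y \<partial>lborel)"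
          by (intro nn_integral_cong) (auto simp: indicator_def)
        also have "\<dots> = \<kappa> n R (E \<inter> B)"
          by (simp add: kappa nn_integral_cmult_indicator B_def Int_ac)
        also have "\<dots> \<le> \<rho> K (E \<inter> B)" by (rule Y(2)) (auto simp: B_def)
        also have "\<dots> \<le> \<rho> K E" by (rule emeasure_mono) (auto simp: \<rho>(2))
        finally show ?thesis .
      qed (simp add: emeasure_notin_sets)
      then show "?D \<le> \<rho> K" by (simp add: le_measure_iff le_fun_def \<rho>(2) sp)
    qed (simp add: \<rho>(2))
    finally show ?thesis by (simp add: \<rho>(3))
  qed
  moreover have "0 < emeasure lborel B" using KnR unfolding B_def by (simp add: zero_less_iff_neq_zero)
  moreover have "B \<subseteq> {- real R..real R}" by (auto simp: B_def)
  ultimately show thesis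
    by (intro that[of "1 / real (Suc n)" B "real R" "real K"]) auto
qed

lemma haar_walk_lborel: "haar_walk M UNIV lborel"
proof -
  have "haar_walk M (lattice_set 0) (haar_lattice 0)"
    by (rule haar_walk_haar_lattice) (use prob_space in \<open>auto simp: lattice_set_zero real_distribution_axioms\<close>)
  then show ?thesis by (simp add: lattice_set_zero haar_lattice_def)
qed

interpretation lborel: haar_walk M UNIV lborel by (rule haar_walk_lborel)

text \<open>Unlike \<open>spread\<close>, this involves a single power and a window that need not
  contain 0: it is what convolution yields, and the window is moved into place only at the
  end.\<close>

definition spread_window :: "real \<Rightarrow> nat \<Rightarrow> real \<Rightarrow> real \<Rightarrow> real \<Rightarrow> bool" where
  "spread_window K n c p q \<longleftrightarrow> 0 < c \<and> (\<forall>g\<in>borel_measurable borel. \<forall>x.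
     ennreal c * lborel.window_integral p q g x \<le> (into_op M {- K..K} ^^ n) g x)"

text \<open>The minorant on \<open>B\<close>, used twice, convolves to a function that is at least
  \<open>\<epsilon>\<close> on an interval, by \<open>convolution_square_interval\<close>. A set of
  positive measure is thus replaced by an interval at the price of doubling the number of
  steps.\<close>

lemma nonsingular_imp_spread_window:
  assumes ns: "\<And>N. N \<in> sets borel \<Longrightarrow> emeasure lborel N = 0 \<Longrightarrow>
      (free_op M ^^ m) (indicator (- N)) 0 \<noteq> 0"
  shows "\<exists>K n c p q. p < q \<and> spread_window K n c p q"
proof -
  obtain K R c B where c: "0 < c" and [measurable]: "B \<in> sets borel" and B: "0 < emeasure lborel B" "B \<subseteq> {- R..R}"
    and low: "\<And>g x. g \<in> borel_measurable borel \<Longrightarrow>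
      ennreal c * (\<integral>\<^sup>+ y. g (x + y) * indicator B y \<partial>lborel) \<le> (into_op M {- K..K} ^^ m) g x"
    by (rule nonsingular_imp_density[OF ns], assumption, assumption, rule that, assumption+)
  obtain \<epsilon> w \<delta> :: real where e: "0 < \<epsilon>" "0 < \<delta>"
    and conv: "\<And>v. v \<in> {w - \<delta>..w + \<delta>} \<Longrightarrow>
      ennreal \<epsilon> \<le> (\<integral>\<^sup>+ y. indicator B y * indicator B (v - y) \<partial>lborel)"
    by (rule convolution_square_interval[OF \<open>B \<in> sets borel\<close> B]) (rule that, assumption+)
  have "ennreal (c * c * \<epsilon>) * lborel.window_integral (w - \<delta>) (w + \<delta>) g x \<le> (into_op M {- K..K} ^^ (m + m)) g x"
    if [measurable]: "g \<in> borel_measurable borel" for g x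
  proof -
    let ?T = "into_op M {- K..K} ^^ m"
    have inner: "(\<integral>\<^sup>+ z. g ((x + y) + z) * indicator B z \<partial>lborel)
        = (\<integral>\<^sup>+ v. g (x + v) * indicator B (v - y) \<partial>lborel)" for y
      using nn_integral_real_affine[of "\<lambda>z. g ((x + y) + z) * indicator B z" 1 "- y"]
      by (simp add: algebra_simps)
    have win: "lborel.window_integral (w - \<delta>) (w + \<delta>) g x
        = (\<integral>\<^sup>+ v. g (x + v) * indicator {w - \<delta>..w + \<delta>} v \<partial>lborel)"
    proof -
      have "lborel.window_integral (w - \<delta>) (w + \<delta>) g x
        = (\<integral>\<^sup>+ v. g (x + 1 * v) * indicator {x + (w - \<delta>)..x + (w + \<delta>)} (x + 1 * v) \<partial>lborel)"
        unfolding lborel.window_integral_def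
        by (subst nn_integral_real_affine[of _ 1 x]) auto
      also have "\<dots> = (\<integral>\<^sup>+ v. g (x + v) * indicator {w - \<delta>..w + \<delta>} v \<partial>lborel)"
        by (intro nn_integral_cong) (auto simp: indicator_def)
      finally show ?thesis .
    qed
    have "ennreal \<epsilon> * lborel.window_integral (w - \<delta>) (w + \<delta>) g x
        = (\<integral>\<^sup>+ v. ennreal \<epsilon> * (g (x + v) * indicator {w - \<delta>..w + \<delta>} v) \<partial>lborel)"
      unfolding win by (rule nn_integral_cmult[symmetric]) measurable
    also have "\<dots> \<le> (\<integral>\<^sup>+ v. (\<integral>\<^sup>+ y. indicator B y * indicator B (v - y) \<partial>lborel) * g (x + v) \<partial>lborel)"
      by (intro nn_integral_mono) (auto simp: indicator_def[of "{w - \<delta>..w + \<delta>}"] intro!: mult_right_mono conv)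
    also have "\<dots> = (\<integral>\<^sup>+ v. \<integral>\<^sup>+ y. indicator B y * (g (x + v) * indicator B (v - y)) \<partial>lborel \<partial>lborel)"
      by (intro nn_integral_cong, subst nn_integral_multc[symmetric]) (auto intro!: nn_integral_cong simp: mult_ac)
    also have "\<dots> = (\<integral>\<^sup>+ y. \<integral>\<^sup>+ v. indicator B y * (g (x + v) * indicator B (v - y)) \<partial>lborel \<partial>lborel)"
      by (rule lborel_pair.Fubini') (simp add: measurable_split_conv)
    also have "\<dots> = (\<integral>\<^sup>+ y. (\<integral>\<^sup>+ z. g ((x + y) + z) * indicator B z \<partial>lborel) * indicator B y \<partial>lborel)"
      unfolding inner by (intro nn_integral_cong, subst nn_integral_cmult) (auto simp: mult.commute)
    finally have step: "ennreal \<epsilon> * lborel.window_integral (w - \<delta>) (w + \<delta>) g x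
        \<le> (\<integral>\<^sup>+ y. (\<integral>\<^sup>+ z. g ((x + y) + z) * indicator B z \<partial>lborel) * indicator B y \<partial>lborel)" .
    have "ennreal c * (ennreal \<epsilon> * lborel.window_integral (w - \<delta>) (w + \<delta>) g x)
        \<le> ennreal c * (\<integral>\<^sup>+ y. (\<integral>\<^sup>+ z. g ((x + y) + z) * indicator B z \<partial>lborel) * indicator B y \<partial>lborel)"
      by (intro mult_left_mono step) simp
    also have "\<dots> = (\<integral>\<^sup>+ y. (ennreal c * (\<integral>\<^sup>+ z. g ((x + y) + z) * indicator B z \<partial>lborel)) * indicator B y \<partial>lborel)"
      by (subst nn_integral_cmult[symmetric]) (auto simp: mult.assoc)
    also have "\<dots> \<le> (\<integral>\<^sup>+ y. ?T g (x + y) * indicator B y \<partial>lborel)"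
      by (intro nn_integral_mono mult_right_mono low) auto
    finally have "ennreal c * (ennreal c * (ennreal \<epsilon> * lborel.window_integral (w - \<delta>) (w + \<delta>) g x))
        \<le> ennreal c * (\<integral>\<^sup>+ y. ?T g (x + y) * indicator B y \<partial>lborel)"
      by (intro mult_left_mono) auto
    also have "\<dots> \<le> ?T (?T g) x" by (rule low) measurable
    finally show ?thesis using c e by (simp add: funpow_add ennreal_mult mult.assoc)
  qed
  then have "spread_window K (m + m) (c * c * \<epsilon>) (w - \<delta>) (w + \<delta>)"
    using c e unfolding spread_window_def by simp
  moreover have "w - \<delta> < w + \<delta>" using e by simp
  ultimately show ?thesis by blast
qed

text \<open>The convolution of a window of width \<open>w\<close> with itself is a tent of width
  \<open>2 * w\<close>. Cutting off \<open>w / 4\<close> at both ends leaves height at least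
  \<open>w / 4\<close> on width \<open>3 / 2 * w\<close>, so iteration produces windows of any
  width.\<close>

lemma spread_window_double:
  assumes s: "spread_window K n c p q" and pq: "p < q"
  shows "\<exists>c'. spread_window K (n + n) c' (2 * p + (q - p) / 4) (2 * q - (q - p) / 4)"
proof -
  define w where "w = q - p"
  have w: "0 < w" using pq by (simp add: w_def)
  have c: "0 < c" using s by (simp add: spread_window_def)
  have low: "ennreal c * lborel.window_integral p q g x \<le> (into_op M {- K..K} ^^ n) g x"
    if "g \<in> borel_measurable borel" for g x
    using s that by (auto simp: spread_window_def)
  have "ennreal (c * c * (w / 4)) * lborel.window_integral (2 * p + w / 4) (2 * q - w / 4) g x
      \<le> (into_op M {- K..K} ^^ (n + n)) g x" if [measurable]: "g \<in> borel_measurable borel" for g x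
  proof -
    let ?T = "into_op M {- K..K} ^^ n"
    have len: "ennreal (w / 4) \<le> (\<integral>\<^sup>+ y. indicator {y + p..y + q} z * indicator {x + p..x + q} y \<partial>lborel)"
      if z: "z \<in> {x + (2 * p + w / 4)..x + (2 * q - w / 4)}" for z
    proof -
      define a where "a = max (x + p) (z - q)"
      define b where "b = min (x + q) (z - p)"
      have "x + (2 * p + w / 4) \<le> z" "z \<le> x + (2 * q - w / 4)" "w = q - p" using z by (auto simp: w_def)
      then have "w / 4 \<le> (x + q) - (x + p)" "w / 4 \<le> (x + q) - (z - q)"
        "w / 4 \<le> (z - p) - (x + p)" "w / 4 \<le> (z - p) - (z - q)"
        using w by linarith+
      then have "w / 4 \<le> b - a" unfolding a_def b_def max_def min_def by presburger
      then have "ennreal (w / 4) \<le> emeasure lborel {a..b}"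
        using w by (auto simp: emeasure_lborel_Icc_eq intro!: ennreal_leI)
      also have "\<dots> = (\<integral>\<^sup>+ y. indicator {a..b} y \<partial>lborel)" by simp
      also have "\<dots> = (\<integral>\<^sup>+ y. indicator {y + p..y + q} z * indicator {x + p..x + q} y \<partial>lborel)"
        by (intro nn_integral_cong) (auto simp: indicator_def a_def b_def)
      finally show ?thesis .
    qed
    have meas: "(\<lambda>(y, z). g z * (indicator {y + p..y + q} z * indicator {x + p..x + q} y)) \<in> borel_measurable (lborel \<Otimes>\<^sub>M lborel)"
    proof -
      have "(\<lambda>(y, z). g z * ((if y + p \<le> z \<and> z \<le> y + q then 1 else 0) * indicator {x + p..x + q} y)) \<in> borel_measurable (lborel \<Otimes>\<^sub>M lborel)"
        by measurable
      also have "(\<lambda>(y, z). g z * ((if y + p \<le> z \<and> z \<le> y + q then 1 else 0) * indicator {x + p..x + q} y))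
          = (\<lambda>(y, z). g z * (indicator {y + p..y + q} z * indicator {x + p..x + q} y))"
        by (auto simp: indicator_def fun_eq_iff)
      finally show ?thesis .
    qed
    have sec: "(\<lambda>y. indicator {y + p..y + q} z * indicator {x + p..x + q} y :: ennreal) \<in> borel_measurable borel" for z
    proof -
      have "(\<lambda>y. indicator {z - q..z - p} y * indicator {x + p..x + q} y :: ennreal) \<in> borel_measurable borel"
        by measurable
      also have "(\<lambda>y. indicator {z - q..z - p} y * indicator {x + p..x + q} y :: ennreal)
          = (\<lambda>y. indicator {y + p..y + q} z * indicator {x + p..x + q} y)"
        by (auto simp: indicator_def fun_eq_iff)
      finally show ?thesis .
    qed
    have "ennreal (w / 4) * lborel.window_integral (2 * p + w / 4) (2 * q - w / 4) g x
        = (\<integral>\<^sup>+ z. ennreal (w / 4) * (g z * indicator {x + (2 * p + w / 4)..x + (2 * q - w / 4)} z) \<partial>lborel)"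
      unfolding lborel.window_integral_def by (rule nn_integral_cmult[symmetric]) measurable
    also have "\<dots> \<le> (\<integral>\<^sup>+ z. g z * (\<integral>\<^sup>+ y. indicator {y + p..y + q} z * indicator {x + p..x + q} y \<partial>lborel) \<partial>lborel)"
    proof (intro nn_integral_mono)
      fix z
      show "ennreal (w / 4) * (g z * indicator {x + (2 * p + w / 4)..x + (2 * q - w / 4)} z)
          \<le> g z * (\<integral>\<^sup>+ y. indicator {y + p..y + q} z * indicator {x + p..x + q} y \<partial>lborel)"
        using len[of z] by (cases "z \<in> {x + (2 * p + w / 4)..x + (2 * q - w / 4)}")
          (auto simp: mult.commute[of "ennreal (w / 4)"] intro!: mult_left_mono)
    qed
    also have "\<dots> = (\<integral>\<^sup>+ z. \<integral>\<^sup>+ y. g z * (indicator {y + p..y + q} z * indicator {x + p..x + q} y) \<partial>lborel \<partial>lborel)"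
      by (intro nn_integral_cong nn_integral_cmult[symmetric]) (use sec in simp)
    also have "\<dots> = (\<integral>\<^sup>+ y. \<integral>\<^sup>+ z. g z * (indicator {y + p..y + q} z * indicator {x + p..x + q} y) \<partial>lborel \<partial>lborel)"
      by (rule lborel_pair.Fubini') (rule meas)
    also have "\<dots> = (\<integral>\<^sup>+ y. lborel.window_integral p q g y * indicator {x + p..x + q} y \<partial>lborel)"
      unfolding lborel.window_integral_def
      by (intro nn_integral_cong, subst nn_integral_multc[symmetric]) (auto simp: mult.assoc)
    finally have step: "ennreal (w / 4) * lborel.window_integral (2 * p + w / 4) (2 * q - w / 4) g x
        \<le> (\<integral>\<^sup>+ y. lborel.window_integral p q g y * indicator {x + p..x + q} y \<partial>lborel)" .
    have "ennreal c * (ennreal (w / 4) * lborel.window_integral (2 * p + w / 4) (2 * q - w / 4) g x)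
        \<le> ennreal c * (\<integral>\<^sup>+ y. lborel.window_integral p q g y * indicator {x + p..x + q} y \<partial>lborel)"
      by (intro mult_left_mono step) simp
    also have "\<dots> = (\<integral>\<^sup>+ y. (ennreal c * lborel.window_integral p q g y) * indicator {x + p..x + q} y \<partial>lborel)"
      by (subst nn_integral_cmult[symmetric]) (auto simp: mult.assoc)
    also have "\<dots> \<le> (\<integral>\<^sup>+ y. ?T g y * indicator {x + p..x + q} y \<partial>lborel)"
      by (intro nn_integral_mono mult_right_mono low) auto
    also have "\<dots> = lborel.window_integral p q (?T g) x" by (simp add: lborel.window_integral_def)
    finally have "ennreal c * (ennreal c * (ennreal (w / 4) * lborel.window_integral (2 * p + w / 4) (2 * q - w / 4) g x))
        \<le> ennreal c * lborel.window_integral p q (?T g) x"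
      by (intro mult_left_mono) auto
    also have "\<dots> \<le> ?T (?T g) x" by (rule low) measurable
    finally show ?thesis
      using c w
      by (subst ennreal_mult, simp, simp, subst ennreal_mult) (auto simp: funpow_add mult.assoc)
  qed
  then have "spread_window K (n + n) (c * c * (w / 4)) (2 * p + w / 4) (2 * q - w / 4)"
    using c w unfolding spread_window_def by simp
  then show ?thesis by (auto simp: w_def)
qed

lemma spread_window_wide:
  assumes "spread_window K n c p q" "p < q"
  shows "\<exists>n c p q. l \<le> q - p \<and> spread_window K n c p q"
proof -
  have grow: "\<exists>n c p' q'. q' - p' = (3 / 2) ^ i * (q - p) \<and> spread_window K n c p' q'" for i
  proof (induction i)
    case 0
    have "q - p = (3 / 2) ^ 0 * (q - p)" by simp
    with assms(1) show ?case by blast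
  next
    case (Suc i)
    then obtain n c p' q' where *: "q' - p' = (3 / 2) ^ i * (q - p)" "spread_window K n c p' q'" by blast
    have "0 < (3 / 2) ^ i * (q - p)" using assms(2) by simp
    then have "p' < q'" unfolding *(1)[symmetric] by simp
    then obtain c' where "spread_window K (n + n) c' (2 * p' + (q' - p') / 4) (2 * q' - (q' - p') / 4)"
      using spread_window_double[OF *(2)] by blast
    moreover have "(2 * q' - (q' - p') / 4) - (2 * p' + (q' - p') / 4) = (3 / 2) ^ Suc i * (q - p)"
    proof -
      have "(2 * q' - (q' - p') / 4) - (2 * p' + (q' - p') / 4) = 3 / 2 * (q' - p')" by (simp add: field_simps)
      then show ?thesis unfolding *(1) by simp
    qed
    ultimately show ?case by blast
  qed
  obtain i where "l / (q - p) < (3 / 2) ^ i" using real_arch_pow[of "3 / 2" "l / (q - p)"] by auto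
  then have "l \<le> (3 / 2) ^ i * (q - p)" using assms(2) by (simp add: field_simps)
  with grow[of i] show ?thesis by metis
qed

text \<open>A window that is wide enough still contains \<open>{- l..l}\<close> after its midpoint
  \<open>m\<close> has been brought near 0 by steps close to \<open>s\<close> or close to
  \<open>- t\<close>.\<close>

lemma spread_spread_out:
  assumes ns: "\<And>N. N \<in> sets borel \<Longrightarrow> emeasure lborel N = 0 \<Longrightarrow>
      (free_op M ^^ m) (indicator (- N)) 0 \<noteq> 0"
    and up: "\<exists>s>0. \<forall>\<eta>>0. 0 < emeasure M {s - \<eta><..<s + \<eta>}"
    and down: "\<exists>s>0. \<forall>\<eta>>0. 0 < emeasure M {- s - \<eta><..<- s + \<eta>}"
  shows "\<exists>K n c. 0 < c \<and> (\<forall>x\<in>UNIV. \<forall>g\<in>borel_measurable borel.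
      ennreal c * (\<integral>\<^sup>+ y. g y * indicator {x - l..x + l} y \<partial>lborel)
        \<le> (\<Sum>j\<le>n. (into_op M {-K..K} ^^ j) g x))"
proof -
  obtain s where s: "0 < s" "\<And>\<eta>. 0 < \<eta> \<Longrightarrow> 0 < emeasure M {s - \<eta><..<s + \<eta>}" using up by blast
  obtain t where t: "0 < t" "\<And>\<eta>. 0 < \<eta> \<Longrightarrow> 0 < emeasure M {- t - \<eta><..<- t + \<eta>}" using down by blast
  \<comment> \<open>Half the width has to cover \<open>l\<close>, the error \<open>s + t\<close> of
    recentring, and a total step inaccuracy of 1.\<close>
  obtain K n c p q where pq: "2 * (l + s + t + 1) \<le> q - p" and win: "spread_window K n c p q"
    using nonsingular_imp_spread_window[OF ns] spread_window_wide by meson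
  have c: "0 < c" and low: "\<And>g x. g \<in> borel_measurable borel \<Longrightarrow>
      ennreal c * lborel.window_integral p q g x \<le> (into_op M {- K..K} ^^ n) g x"
    using win by (auto simp: spread_window_def)
  define m where "m = (p + q) / 2"
  \<comment> \<open>\<open>nat\<close> sends negative numbers to 0, so at most one of
    \<open>a\<close> and \<open>b\<close> is nonzero.\<close>
  define a where "a = nat \<lceil>- m / s\<rceil>"
  define b where "b = nat \<lceil>m / t\<rceil>"
  have ab: "\<bar>m + real a * s - real b * t\<bar> \<le> s + t"
  proof (cases "m \<le> 0")
    case True
    then have "b = 0" using t(1) by (auto simp: b_def divide_nonpos_pos ceiling_le_zero)
    have "real a = of_int \<lceil>- m / s\<rceil>" using True s(1) by (simp add: a_def)
    then have "- m / s \<le> real a" "real a \<le> - m / s + 1" by linarith+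
    then have "- m \<le> real a * s" "real a * s \<le> - m + s" using s(1) by (simp_all add: field_simps)
    then show ?thesis using \<open>b = 0\<close> s(1) t(1) by simp
  next
    case False
    then have "a = 0" using s(1) by (auto simp: a_def divide_nonpos_pos ceiling_le_zero)
    have "real b = of_int \<lceil>m / t\<rceil>" using False t(1) by (simp add: b_def)
    then have "m / t \<le> real b" "real b \<le> m / t + 1" by linarith+
    then have "m \<le> real b * t" "real b * t \<le> m + t" using t(1) by (simp_all add: field_simps)
    then show ?thesis using \<open>a = 0\<close> s(1) t(1) by simp
  qed
  define \<eta> where "\<eta> = 1 / (real a + real b + 1)"
  have \<eta>: "0 < \<eta>" unfolding \<eta>_def by simp
  have "(real a + real b + 1) * \<eta> = 1" unfolding \<eta>_def by simp
  then have ab\<eta>: "real a * \<eta> + real b * \<eta> \<le> 1" using \<eta> by (simp add: algebra_simps)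
  define U where "U = {s - \<eta><..<s + \<eta>}"
  define D where "D = {- t - \<eta><..<- t + \<eta>}"
  have [measurable]: "U \<in> sets borel" "D \<in> sets borel" by (auto simp: U_def D_def)
  have UD: "U \<subseteq> {s - \<eta>..s + \<eta>}" "D \<subseteq> {- t - \<eta>..- t + \<eta>}" by (auto simp: U_def D_def)
  define P where "P = (p + real b * (- t + \<eta>)) + real a * (s + \<eta>)"
  define Q where "Q = (q + real b * (- t - \<eta>)) + real a * (s - \<eta>)"
  have PQ: "P \<le> - l" "l \<le> Q"
  proof -
    have ab': "m + (real a * s - real b * t) \<le> s + t" "- (s + t) \<le> m + (real a * s - real b * t)"
      using ab by (simp_all add: abs_le_iff)
    have half: "l + s + t + 1 \<le> (q - p) / 2" using pq by simp
    have "P = m - (q - p) / 2 + (real a * s - real b * t) + (real a * \<eta> + real b * \<eta>)"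
      by (simp add: P_def m_def field_simps)
    then show "P \<le> - l" using ab'(1) ab\<eta> half by linarith
    have "Q = m + (q - p) / 2 + (real a * s - real b * t) - (real a * \<eta> + real b * \<eta>)"
      by (simp add: Q_def m_def field_simps)
    then show "l \<le> Q" using ab'(2) ab\<eta> half by linarith
  qed
  \<comment> \<open>One bound for the steps of all three phases, as a single truncation is asked
    for.\<close>
  define L where "L = max K (max (s + \<eta>) (t + \<eta>))"
  have "s + \<eta> \<le> L" "t + \<eta> \<le> L" by (auto simp: L_def)
  then have UL: "U \<subseteq> {- L..L}" "D \<subseteq> {- L..L}"
    using s(1) t(1) \<eta> by (auto simp: U_def D_def)
  define v where "v = emeasure M U ^ a * emeasure M D ^ b"
  have "emeasure M U \<noteq> 0"
    using s(2)[OF \<eta>] unfolding U_def by (rule gr_implies_not_zero)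
  moreover have "emeasure M D \<noteq> 0"
    using t(2)[OF \<eta>] unfolding D_def by (rule gr_implies_not_zero)
  ultimately have "v \<noteq> 0" unfolding v_def mult_eq_0_iff power_eq_0_iff by blast
  moreover have "v = ennreal (measure M U ^ a * measure M D ^ b)"
    by (simp add: v_def emeasure_eq_measure ennreal_mult ennreal_power)
  moreover define r where "r = measure M U ^ a * measure M D ^ b"
  ultimately have r: "v = ennreal r" "0 < r"
    by (auto simp: r_def ennreal_eq_0_iff not_le)
  have "ennreal (r * c) * (\<integral>\<^sup>+ y. g y * indicator {x - l..x + l} y \<partial>lborel)
        \<le> (\<Sum>j\<le>a + (b + n). (into_op M {-L..L} ^^ j) g x)"
    if [measurable]: "g \<in> borel_measurable borel" for g x
  proof -
    have "(\<integral>\<^sup>+ y. g y * indicator {x - l..x + l} y \<partial>lborel) \<le> lborel.window_integral P Q g x"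
      unfolding lborel.window_integral_def
      by (intro nn_integral_mono mult_left_mono) (use PQ in \<open>auto simp: indicator_def\<close>)
    then have "ennreal (r * c) * (\<integral>\<^sup>+ y. g y * indicator {x - l..x + l} y \<partial>lborel)
        \<le> ennreal (r * c) * lborel.window_integral P Q g x"
      by (rule mult_left_mono) simp
    also have "\<dots> = ennreal c * (emeasure M D ^ b * (emeasure M U ^ a * lborel.window_integral P Q g x))"
      using r c by (simp add: ennreal_mult r(1)[symmetric] v_def mult_ac)
    also have "\<dots> \<le> ennreal c * (emeasure M D ^ b * (into_op M U ^^ a)
        (lborel.window_integral (p + real b * (- t + \<eta>)) (q + real b * (- t - \<eta>)) g) x)"
      unfolding P_def Q_def
      by (intro mult_left_mono lborel.into_op_funpow_window_integral) (use UD in auto)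
    also have "\<dots> = ennreal c * (into_op M U ^^ a) (\<lambda>y. emeasure M D ^ b *
        lborel.window_integral (p + real b * (- t + \<eta>)) (q + real b * (- t - \<eta>)) g y) x"
      by (subst step_op_funpow_cmult) auto
    also have "\<dots> \<le> ennreal c * (into_op M U ^^ a) ((into_op M D ^^ b) (lborel.window_integral p q g)) x"
      by (intro mult_left_mono step_op_funpow_mono lborel.into_op_funpow_window_integral) (use UD in auto)
    also have "\<dots> = (into_op M U ^^ a) (\<lambda>y. (into_op M D ^^ b) (\<lambda>y. ennreal c * lborel.window_integral p q g y) y) x"
    proof -
      have "(into_op M D ^^ b) (\<lambda>y. ennreal c * lborel.window_integral p q g y)
          = (\<lambda>y. ennreal c * (into_op M D ^^ b) (lborel.window_integral p q g) y)"
        by (rule ext, rule step_op_funpow_cmult) auto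
      then show ?thesis by (simp add: step_op_funpow_cmult)
    qed
    also have "\<dots> \<le> (into_op M U ^^ a) (\<lambda>y. (into_op M D ^^ b) ((into_op M {- K..K} ^^ n) g) y) x"
      by (intro step_op_funpow_mono low) auto
    also have "\<dots> \<le> (into_op M U ^^ a) ((into_op M D ^^ b) ((into_op M {- L..L} ^^ n) g)) x"
      by (intro step_op_funpow_mono into_op_funpow_mono_radius) (auto simp: L_def)
    also have "\<dots> \<le> (into_op M U ^^ a) ((into_op M {- L..L} ^^ b) ((into_op M {- L..L} ^^ n) g)) x"
      by (intro step_op_funpow_mono) (use UL in \<open>auto simp: indicator_def\<close>)
    also have "\<dots> \<le> (into_op M {- L..L} ^^ a) ((into_op M {- L..L} ^^ b) ((into_op M {- L..L} ^^ n) g)) x"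
      by (intro step_op_funpow_mono) (use UL in \<open>auto simp: indicator_def\<close>)
    also have "\<dots> = (into_op M {- L..L} ^^ (a + (b + n))) g x" by (simp add: funpow_add)
    also have "\<dots> \<le> (\<Sum>j\<le>a + (b + n). (into_op M {-L..L} ^^ j) g x)"
      by (rule member_le_sum) auto
    finally show ?thesis .
  qed
  moreover have "0 < r * c" using r c by simp
  ultimately show ?thesis by blast
qed

end

subsection \<open>Walks with i.i.d. increments\<close>

locale iid_walk = prob_space M for M :: "'a measure" +
  fixes X :: "nat \<Rightarrow> 'a \<Rightarrow> real"
  assumes indep: "indep_vars (\<lambda>_. borel) X {1..}"
    and ident: "1 \<le> i \<Longrightarrow> distr M borel (X i) = distr M borel (X 1)"
begin

definition law :: "real measure" where "law = distr M borel (X 1)"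

lemma X_measurable [measurable]: "X (Suc i) \<in> borel_measurable M"
  using indep by (auto simp: indep_vars_def)

lemma X_measurable': "1 \<le> i \<Longrightarrow> X i \<in> borel_measurable M"
  using X_measurable[of "i - 1"] by simp

sublocale law: real_distribution law
  unfolding law_def by (rule real_distribution_distr) (simp add: X_measurable')

lemma walk_Suc: "walk X x \<omega> (Suc k) = walk X x \<omega> k + X (Suc k) \<omega>"
  by (simp add: walk_def)

lemma walk_measurable [measurable]: "(\<lambda>\<omega>. walk X x \<omega> k) \<in> borel_measurable M"
  by (induction k) (auto simp: walk_Suc walk_def[of X x _ 0])

text \<open>Independence of the next increment from the earlier ones, as a product measure, lets it
  be integrated out by \<open>law\<close> with the past held fixed. The past enters as a whole,
  since the number of entrances depends on all of it.\<close>

lemma nn_integral_history: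
  assumes [measurable]: "case_prod G \<in> borel_measurable (PiM {Suc 0..k} (\<lambda>_. borel :: real measure) \<Otimes>\<^sub>M borel)"
  shows "(\<integral>\<^sup>+ \<omega>. G (restrict (\<lambda>i. X i \<omega>) {Suc 0..k}) (X (Suc k) \<omega>) \<partial>M)
    = (\<integral>\<^sup>+ \<omega>. (\<integral>\<^sup>+ z. G (restrict (\<lambda>i. X i \<omega>) {Suc 0..k}) z \<partial>law) \<partial>M)"
proof -
  let ?H = "\<lambda>\<omega>. restrict (\<lambda>i. X i \<omega>) {Suc 0..k}"
  have H [measurable]: "?H \<in> measurable M (PiM {Suc 0..k} (\<lambda>_. borel))"
    by (intro measurable_restrict X_measurable') auto
  let ?Y = "\<lambda>\<omega>. restrict (\<lambda>i. X i \<omega>) {Suc k}"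
  have Y [measurable]: "?Y \<in> measurable M (PiM {Suc k} (\<lambda>_. borel))"
    by (intro measurable_restrict X_measurable') auto
  have "indep_var (PiM {Suc 0..k} (\<lambda>_. borel)) ?H (PiM {Suc k} (\<lambda>_. borel)) ?Y"
    by (rule indep_var_restrict[OF indep]) auto
  then have joint: "distr M (PiM {Suc 0..k} (\<lambda>_. borel)) ?H \<Otimes>\<^sub>M distr M (PiM {Suc k} (\<lambda>_. borel)) ?Y
      = distr M (PiM {Suc 0..k} (\<lambda>_. borel) \<Otimes>\<^sub>M PiM {Suc k} (\<lambda>_. borel)) (\<lambda>\<omega>. (?H \<omega>, ?Y \<omega>))"
    unfolding indep_var_distribution_eq by blast
  have law: "distr M borel (X (Suc k)) = law" unfolding law_def by (rule ident) simp
  interpret Y: prob_space "distr M (PiM {Suc k} (\<lambda>_. borel)) ?Y" by (rule prob_space_distr) measurable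
  have G' [measurable]: "(\<lambda>(f, g). G f (g (Suc k))) \<in> borel_measurable (PiM {Suc 0..k} (\<lambda>_. borel) \<Otimes>\<^sub>M PiM {Suc k} (\<lambda>_. borel))"
  proof -
    have "(\<lambda>p. case_prod G (fst p, snd p (Suc k))) \<in> borel_measurable (PiM {Suc 0..k} (\<lambda>_. borel) \<Otimes>\<^sub>M PiM {Suc k} (\<lambda>_. borel))"
      by measurable
    then show ?thesis by (simp add: case_prod_beta)
  qed
  have "(\<integral>\<^sup>+ \<omega>. G (?H \<omega>) (X (Suc k) \<omega>) \<partial>M)
      = (\<integral>\<^sup>+ p. (case p of (f, g) \<Rightarrow> G f (g (Suc k)))
          \<partial>distr M (PiM {Suc 0..k} (\<lambda>_. borel) \<Otimes>\<^sub>M PiM {Suc k} (\<lambda>_. borel)) (\<lambda>\<omega>. (?H \<omega>, ?Y \<omega>)))"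
    by (subst nn_integral_distr) auto
  also have "\<dots> = (\<integral>\<^sup>+ f. (\<integral>\<^sup>+ g. G f (g (Suc k)) \<partial>distr M (PiM {Suc k} (\<lambda>_. borel)) ?Y)
          \<partial>distr M (PiM {Suc 0..k} (\<lambda>_. borel)) ?H)"
    unfolding joint[symmetric] by (subst Y.nn_integral_fst[symmetric]) auto
  also have "\<dots> = (\<integral>\<^sup>+ f. (\<integral>\<^sup>+ z. G f z \<partial>law) \<partial>distr M (PiM {Suc 0..k} (\<lambda>_. borel)) ?H)"
  proof (rule nn_integral_cong)
    fix f assume "f \<in> space (distr M (PiM {Suc 0..k} (\<lambda>_. borel :: real measure)) ?H)"
    then have f: "f \<in> space (PiM {Suc 0..k} (\<lambda>_. borel :: real measure))" by simp
    have [measurable]: "G f \<in> borel_measurable borel"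
      using measurable_compose_Pair1[OF f assms] by simp
    have "(\<integral>\<^sup>+ g. G f (g (Suc k)) \<partial>distr M (PiM {Suc k} (\<lambda>_. borel)) ?Y) = (\<integral>\<^sup>+ \<omega>. G f (X (Suc k) \<omega>) \<partial>M)"
      by (subst nn_integral_distr) auto
    also have "\<dots> = (\<integral>\<^sup>+ z. G f z \<partial>distr M borel (X (Suc k)))"
      by (subst nn_integral_distr) auto
    finally show "(\<integral>\<^sup>+ g. G f (g (Suc k)) \<partial>distr M (PiM {Suc k} (\<lambda>_. borel)) ?Y) = (\<integral>\<^sup>+ z. G f z \<partial>law)"
      unfolding law .
  qed
  also have "\<dots> = (\<integral>\<^sup>+ \<omega>. (\<integral>\<^sup>+ z. G (?H \<omega>) z \<partial>law) \<partial>M)"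
    by (rule nn_integral_distr) auto
  finally show ?thesis .
qed

lemma nn_integral_walk_step:
  assumes [measurable]: "weight_measurable w" "f \<in> borel_measurable borel"
    "\<Xi> \<in> borel_measurable (PiM {Suc 0..k} (\<lambda>_. borel :: real measure))"
  shows "(\<integral>\<^sup>+ \<omega>. \<Xi> (restrict (\<lambda>i. X i \<omega>) {Suc 0..k}) *
      (w (walk X x \<omega> k) (X (Suc k) \<omega>) * f (walk X x \<omega> (Suc k))) \<partial>M)
    = (\<integral>\<^sup>+ \<omega>. \<Xi> (restrict (\<lambda>i. X i \<omega>) {Suc 0..k}) * step_op law w f (walk X x \<omega> k) \<partial>M)"
proof -
  define S where "S F = x + (\<Sum>i = 1..k. F i)" for F :: "nat \<Rightarrow> real"
  have S: "S (restrict (\<lambda>i. X i \<omega>) {Suc 0..k}) = walk X x \<omega> k" for \<omega>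
    by (simp add: S_def walk_def)
  have [measurable]: "S \<in> borel_measurable (PiM {Suc 0..k} (\<lambda>_. borel))"
    unfolding S_def by measurable
  have [measurable]: "(\<lambda>(F, z). w (S F) z) \<in> borel_measurable (PiM {Suc 0..k} (\<lambda>_. borel) \<Otimes>\<^sub>M borel)"
  proof -
    have "(\<lambda>p. case_prod w (S (fst p), snd p)) \<in> borel_measurable (PiM {Suc 0..k} (\<lambda>_. borel) \<Otimes>\<^sub>M borel)"
      by measurable
    then show ?thesis by (simp add: case_prod_beta)
  qed
  have "(\<integral>\<^sup>+ \<omega>. \<Xi> (restrict (\<lambda>i. X i \<omega>) {Suc 0..k}) *
      (w (walk X x \<omega> k) (X (Suc k) \<omega>) * f (walk X x \<omega> (Suc k))) \<partial>M)
    = (\<integral>\<^sup>+ \<omega>. (\<integral>\<^sup>+ z. \<Xi> (restrict (\<lambda>i. X i \<omega>) {Suc 0..k}) *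
      (w (walk X x \<omega> k) z * f (walk X x \<omega> k + z)) \<partial>law) \<partial>M)"
    using nn_integral_history[of "\<lambda>F z. \<Xi> F * (w (S F) z * f (S F + z))" k]
    by (simp add: S walk_Suc)
  also have "\<dots> = (\<integral>\<^sup>+ \<omega>. \<Xi> (restrict (\<lambda>i. X i \<omega>) {Suc 0..k}) * step_op law w f (walk X x \<omega> k) \<partial>M)"
    unfolding step_op_def
    using law.weight_section[OF assms(1), measurable]
    by (intro nn_integral_cong nn_integral_cmult) measurable
  finally show ?thesis .
qed

lemma free_op_funpow_walk:
  assumes "f \<in> borel_measurable borel"
  shows "(free_op law ^^ k) f x = (\<integral>\<^sup>+ \<omega>. f (walk X x \<omega> k) \<partial>M)"
  using assms
proof (induction k arbitrary: f)
  case 0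
  then show ?case by (simp add: walk_def emeasure_space_1)
next
  case (Suc k)
  note Suc(2)[measurable]
  have "(free_op law ^^ Suc k) f x = (free_op law ^^ k) (free_op law f) x"
    by (simp add: funpow_swap1)
  also have "\<dots> = (\<integral>\<^sup>+ \<omega>. free_op law f (walk X x \<omega> k) \<partial>M)"
    by (rule Suc) measurable
  also have "\<dots> = (\<integral>\<^sup>+ \<omega>. f (walk X x \<omega> (Suc k)) \<partial>M)"
  proof -
    have "(\<lambda>_. 1) \<in> borel_measurable (PiM {Suc 0..k} (\<lambda>_. borel :: real measure))" by measurable
    from nn_integral_walk_step[OF weight_measurable_free Suc(2) this, of x]
    show ?thesis unfolding mult_1 by (rule sym)
  qed
  finally show ?case .
qed

end

section \<open>Entrance times along a fixed path\<close>

text \<open>Counts the entrances during the first \<open>k\<close> steps by recursion on the last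
  one, without infima; the counterpart of \<open>passage_op\<close> for a single path.\<close>

primrec entered :: "real set \<Rightarrow> (nat \<Rightarrow> real) \<Rightarrow> nat \<Rightarrow> nat \<Rightarrow> bool" where
  "entered A s 0 n \<longleftrightarrow> n = 0"
| "entered A s (Suc k) n \<longleftrightarrow>
     (if s k \<notin> A \<and> s (Suc k) \<in> A then 0 < n \<and> entered A s k (n - 1) else entered A s k n)"

lemma entered_cong: "(\<And>j. j \<le> k \<Longrightarrow> s j = s' j) \<Longrightarrow> entered A s k n = entered A s' k n"
  by (induction k arbitrary: n) auto

declare entrance_time.simps(2) [simp del]

lemma entrance_time_Suc_le:
  assumes "entrance_time h s n < enat k" "s (k - 1) \<notin> {0..h}" "s k \<in> {0..h}"
  shows "entrance_time h s (Suc n) \<le> enat k"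
  using assms unfolding entrance_time.simps by (auto intro!: Inf_lower)

lemma Inf_enat_eqD:
  assumes "Inf T = enat k"
  shows "enat k \<in> T"
proof -
  have "T \<noteq> {}" using assms by (auto simp: Inf_enat_def)
  then have "Inf T \<in> T" unfolding Inf_enat_def using LeastI_ex[of "\<lambda>x. x \<in> T"] by auto
  then show ?thesis using assms by simp
qed

lemma entrance_time_Suc_eqD:
  assumes "entrance_time h s (Suc n) = enat k"
  shows "entrance_time h s n < enat k \<and> s (k - 1) \<notin> {0..h} \<and> s k \<in> {0..h}"
proof -
  have "enat k \<in> {enat k | k. entrance_time h s n < enat k \<and> s (k - 1) \<notin> {0..h} \<and> s k \<in> {0..h}}"
    using assms unfolding entrance_time.simps by (rule Inf_enat_eqD)
  then show ?thesis by blast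
qed

lemma entrance_time_less_Suc: "k < entrance_time h s (Suc n)" if "k \<le> entrance_time h s n" "k \<noteq> \<infinity>"
proof (cases "entrance_time h s (Suc n)")
  case (enat j)
  show ?thesis
    unfolding enat using that(1) entrance_time_Suc_eqD[OF enat] by (blast intro: le_less_trans)
next
  case infinity
  then show ?thesis using that(2) by (cases k) auto
qed

text \<open>Induction on time links the infima in \<open>entrance_time\<close> to counting: either
  an entrance occurs at step \<open>k + 1\<close>, and the next entrance time takes this value, or
  no entrance time can be equal to \<open>k + 1\<close>.\<close>

lemma entered_iff:
  "entered {0..h} s k n \<longleftrightarrow> entrance_time h s n \<le> enat k \<and> enat k < entrance_time h s (Suc n)"
proof (induction k arbitrary: n)
  case 0
  have "0 < entrance_time h s (Suc n)" for n
    by (rule entrance_time_less_Suc) auto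
  then show ?case
    by (cases n) (auto simp: zero_enat_def[symmetric])
next
  case (Suc k)
  let ?T = "entrance_time h s"
  show ?case
  proof (cases "s k \<notin> {0..h} \<and> s (Suc k) \<in> {0..h}")
    case True
    have next_T: "?T (Suc m) \<le> enat (Suc k)" if "?T m \<le> enat k" for m
    proof -
      have "?T m < enat (Suc k)" using that by (cases "?T m") auto
      then show ?thesis by (rule entrance_time_Suc_le) (use True in auto)
    qed
    have "entered {0..h} s (Suc k) n \<longleftrightarrow> 0 < n \<and> ?T (n - 1) \<le> enat k \<and> enat k < ?T n"
      using True Suc by (cases n) (auto)
    also have "\<dots> \<longleftrightarrow> ?T n \<le> enat (Suc k) \<and> enat (Suc k) < ?T (Suc n)"
    proof
      assume L: "0 < n \<and> ?T (n - 1) \<le> enat k \<and> enat k < ?T n"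
      then have "?T n \<le> enat (Suc k)" using next_T[of "n - 1"] by simp
      moreover have "enat (Suc k) \<le> ?T n" using L by (cases "?T n") (auto simp: Suc_le_eq)
      then have "enat (Suc k) < ?T (Suc n)" by (rule entrance_time_less_Suc) simp
      ultimately show "?T n \<le> enat (Suc k) \<and> enat (Suc k) < ?T (Suc n)" by blast
    next
      assume R: "?T n \<le> enat (Suc k) \<and> enat (Suc k) < ?T (Suc n)"
      then have "\<not> ?T n \<le> enat k" using next_T[of n] by (auto)
      then have n: "?T n = enat (Suc k)" "enat k < ?T n"
        using R by (cases "?T n"; auto)+
      then have "0 < n" by (cases n) (auto simp: zero_enat_def)
      then obtain m where m: "n = Suc m" by (cases n) auto
      then have "?T m < enat (Suc k)" using entrance_time_Suc_eqD[of h s m "Suc k"] n(1) by simp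
      then have "?T m \<le> enat k" by (cases "?T m") auto
      then show "0 < n \<and> ?T (n - 1) \<le> enat k \<and> enat k < ?T n" using n m by simp
    qed
    finally show ?thesis .
  next
    case False
    have ne: "?T m \<noteq> enat (Suc k)" for m
    proof (cases m)
      case (Suc j)
      then show ?thesis using entrance_time_Suc_eqD[of h s j "Suc k"] False by (auto)
    qed (simp add: zero_enat_def)
    have "entered {0..h} s (Suc k) n \<longleftrightarrow> ?T n \<le> enat k \<and> enat k < ?T (Suc n)"
      using False Suc by (auto)
    also have "\<dots> \<longleftrightarrow> ?T n \<le> enat (Suc k) \<and> enat (Suc k) < ?T (Suc n)"
      using ne[of n] ne[of "Suc n"]
      by (cases "?T n"; cases "?T (Suc n)") (auto)
    finally show ?thesis .
  qed
qed

text \<open>The value of the infimum becomes a condition on the path up to time \<open>k + 1\<close>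
  alone, of the kind that can be integrated step by step.\<close>

lemma entrance_time_Suc_eq_iff:
  "entrance_time h s (Suc n) = enat (Suc k) \<longleftrightarrow>
     entered {0..h} s k n \<and> s k \<notin> {0..h} \<and> s (Suc k) \<in> {0..h}"
proof
  assume L: "entrance_time h s (Suc n) = enat (Suc k)"
  from entrance_time_Suc_eqD[OF this]
  have *: "entrance_time h s n < enat (Suc k)" "s k \<notin> {0..h}" "s (Suc k) \<in> {0..h}" by auto
  then have "entrance_time h s n \<le> enat k" by (cases "entrance_time h s n") auto
  with * L show "entered {0..h} s k n \<and> s k \<notin> {0..h} \<and> s (Suc k) \<in> {0..h}"
    by (simp add: entered_iff)
next
  assume R: "entered {0..h} s k n \<and> s k \<notin> {0..h} \<and> s (Suc k) \<in> {0..h}"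
  then have *: "entrance_time h s n \<le> enat k" "enat k < entrance_time h s (Suc n)"
    by (auto simp: entered_iff)
  have "entrance_time h s (Suc n) \<le> enat (Suc k)"
  proof -
    have "entrance_time h s n < enat (Suc k)" using *(1) by (cases "entrance_time h s n") auto
    then show ?thesis by (rule entrance_time_Suc_le) (use R in auto)
  qed
  with *(2) show "entrance_time h s (Suc n) = enat (Suc k)"
    by (cases "entrance_time h s (Suc n)") (auto)
qed

lemma entrance_time_Suc_nonzero: "entrance_time h s (Suc n) \<noteq> enat 0"
  using entrance_time_Suc_eqD[of h s n 0] by (auto simp: zero_enat_def[symmetric])

section \<open>The law of the entrances\<close>

context iid_walk
begin

lemma entered_measurable [measurable]:
  assumes [measurable]: "A \<in> sets borel"
  shows "Measurable.pred M (\<lambda>\<omega>. entered A (walk X x \<omega>) k n)"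
  by (induction k arbitrary: n) simp_all

text \<open>Whether \<open>entered\<close> holds depends on the first \<open>k\<close> increments
  only, so its indicator is an admissible functional of the past in
  \<open>nn_integral_walk_step\<close>.\<close>

lemma nn_integral_entered_step:
  assumes [measurable]: "A \<in> sets borel" "weight_measurable w" "f \<in> borel_measurable borel"
  shows "(\<integral>\<^sup>+ \<omega>. of_bool (entered A (walk X x \<omega>) k n) *
      (w (walk X x \<omega> k) (X (Suc k) \<omega>) * f (walk X x \<omega> (Suc k))) \<partial>M)
    = (\<integral>\<^sup>+ \<omega>. of_bool (entered A (walk X x \<omega>) k n) * step_op law w f (walk X x \<omega> k) \<partial>M)"
proof -
  define S where "S F j = x + (\<Sum>i = 1..j. F i)" for F :: "nat \<Rightarrow> real" and j
  have S: "S (restrict (\<lambda>i. X i \<omega>) {Suc 0..k}) j = walk X x \<omega> j" if "j \<le> k" for \<omega> j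
    using that by (auto simp: S_def walk_def intro!: sum.cong)
  have S_meas: "(\<lambda>F. S F j) \<in> borel_measurable (PiM {Suc 0..k} (\<lambda>_. borel))" if "j \<le> k" for j
    unfolding S_def using that
    by (intro borel_measurable_add borel_measurable_const borel_measurable_sum measurable_component_singleton) auto
  define \<Xi> where "\<Xi> F = (of_bool (entered A (S F) k n) :: ennreal)" for F
  have \<Xi>: "\<Xi> (restrict (\<lambda>i. X i \<omega>) {Suc 0..k}) = of_bool (entered A (walk X x \<omega>) k n)" for \<omega>
    unfolding \<Xi>_def using entered_cong[of k "S (restrict (\<lambda>i. X i \<omega>) {Suc 0..k})" "walk X x \<omega>" A n] S by simp
  have pred: "Measurable.pred (PiM {Suc 0..k} (\<lambda>_. borel)) (\<lambda>F. entered A (S F) j m)" if "j \<le> k" for j m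
    using that
  proof (induction j arbitrary: m)
    case (Suc j)
    have [measurable]: "(\<lambda>F. S F j) \<in> borel_measurable (PiM {Suc 0..k} (\<lambda>_. borel))"
      "(\<lambda>F. S F (Suc j)) \<in> borel_measurable (PiM {Suc 0..k} (\<lambda>_. borel))"
      using S_meas[of j] S_meas[of "Suc j"] Suc by auto
    have [measurable]: "Measurable.pred (PiM {Suc 0..k} (\<lambda>_. borel)) (\<lambda>F. entered A (S F) j m)" for m
      using Suc by auto
    show ?case by simp
  qed simp
  have [measurable]: "\<Xi> \<in> borel_measurable (PiM {Suc 0..k} (\<lambda>_. borel))"
    using pred[of k n, OF order_refl, measurable] unfolding \<Xi>_def of_bool_def by measurable
  show ?thesis
    using nn_integral_walk_step[of w f \<Xi> k x] by (simp add: \<Xi>)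
qed

lemma nn_integral_entered:
  assumes "A \<in> sets borel" "f \<in> borel_measurable borel"
  shows "(\<integral>\<^sup>+ \<omega>. of_bool (entered A (walk X x \<omega>) k n) * f (walk X x \<omega> k) \<partial>M) = passage_op law A k n f x"
  using assms(2)
proof (induction k arbitrary: n f)
  case 0
  then show ?case by (simp add: walk_def emeasure_space_1)
next
  case (Suc k)
  note assms(1)[measurable] Suc(2)[measurable]
  let ?N = "\<lambda>x z. if x \<notin> A \<and> x + z \<in> A then 0 else 1 :: ennreal"
  let ?E = "\<lambda>x z. if x \<notin> A \<and> x + z \<in> A then 1 else 0 :: ennreal"
  let ?e = "\<lambda>n \<omega>. of_bool (entered A (walk X x \<omega>) k n) :: ennreal"
  have [measurable]: "?e n \<in> borel_measurable M" for n unfolding of_bool_def by measurable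
  have "(\<integral>\<^sup>+ \<omega>. of_bool (entered A (walk X x \<omega>) (Suc k) n) * f (walk X x \<omega> (Suc k)) \<partial>M)
      = (\<integral>\<^sup>+ \<omega>. ?e n \<omega> * (?N (walk X x \<omega> k) (X (Suc k) \<omega>) * f (walk X x \<omega> (Suc k)))
        + of_bool (0 < n) * (?e (n - 1) \<omega> * (?E (walk X x \<omega> k) (X (Suc k) \<omega>) * f (walk X x \<omega> (Suc k)))) \<partial>M)"
    by (intro nn_integral_cong) (auto simp: walk_Suc)
  also have "\<dots> = (\<integral>\<^sup>+ \<omega>. ?e n \<omega> * (?N (walk X x \<omega> k) (X (Suc k) \<omega>) * f (walk X x \<omega> (Suc k))) \<partial>M)
      + of_bool (0 < n) * (\<integral>\<^sup>+ \<omega>. ?e (n - 1) \<omega> * (?E (walk X x \<omega> k) (X (Suc k) \<omega>) * f (walk X x \<omega> (Suc k))) \<partial>M)"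
    by (subst nn_integral_add) (auto simp: nn_integral_cmult)
  also have "\<dots> = (\<integral>\<^sup>+ \<omega>. ?e n \<omega> * stay_op law A f (walk X x \<omega> k) \<partial>M)
      + of_bool (0 < n) * (\<integral>\<^sup>+ \<omega>. ?e (n - 1) \<omega> * enter_op law A f (walk X x \<omega> k) \<partial>M)"
    by (subst (1 2) nn_integral_entered_step) auto
  also have "\<dots> = passage_op law A k n (stay_op law A f) x + of_bool (0 < n) * passage_op law A k (n - 1) (enter_op law A f) x"
    by (subst (1 2) Suc.IH) auto
  also have "\<dots> = passage_op law A (Suc k) n f x"
    by (subst law.passage_op_Suc_right) auto
  finally show ?case .
qed

text \<open>The event that entrance \<open>n + 1\<close> falls in \<open>B\<close> splits disjointly
  according to the step \<open>k + 1\<close> at which it happens; \<open>nn_integral_entered\<close>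
  evaluates each piece, and \<open>suminf_passage_op\<close> sums them up.\<close>

lemma entrance_law_Suc:
  assumes [measurable]: "B \<in> sets borel"
  shows "emeasure (entrance_law M X h x (Suc n)) B = (chain_op law {0..h} ^^ Suc n) (indicator B) x"
proof -
  let ?A = "{0..h}"
  let ?T = "\<lambda>\<omega>. entrance_time h (walk X x \<omega>) (Suc n)"
  let ?V = "\<lambda>\<omega>. walk X x \<omega> (the_enat (?T \<omega>))"
  define E where "E k C = {\<omega> \<in> space M. entered ?A (walk X x \<omega>) k n \<and> walk X x \<omega> k \<notin> ?A \<and> walk X x \<omega> (Suc k) \<in> ?A \<inter> C}" for k C
  have E_sets [measurable]: "E k C \<in> sets M" if [measurable]: "C \<in> sets borel" for k C
    unfolding E_def by measurable
  have T_iff: "?T \<omega> = enat (Suc k) \<longleftrightarrow> \<omega> \<in> E k UNIV" if "\<omega> \<in> space M" for \<omega> k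
    using that by (simp add: E_def entrance_time_Suc_eq_iff)
  have V: "?V \<omega> = walk X x \<omega> (Suc k)" if "\<omega> \<in> E k C" for \<omega> k C
  proof -
    have "?T \<omega> = enat (Suc k)" using that T_iff[of \<omega> k] by (auto simp: E_def)
    then show ?thesis by simp
  qed
  have union: "{\<omega> \<in> space M. ?T \<omega> < \<infinity> \<and> ?V \<omega> \<in> C} = (\<Union>k. E k C)" for C
  proof (intro set_eqI iffI)
    fix \<omega> assume \<omega>: "\<omega> \<in> {\<omega> \<in> space M. ?T \<omega> < \<infinity> \<and> ?V \<omega> \<in> C}"
    then obtain j where j: "?T \<omega> = enat j" by auto
    with entrance_time_Suc_nonzero[of h "walk X x \<omega>" n] obtain k where "j = Suc k" by (cases j) auto
    with j \<omega> have "\<omega> \<in> E k UNIV" using T_iff by auto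
    then have "\<omega> \<in> E k C" using \<omega> V[of \<omega> k UNIV] by (auto simp: E_def)
    then show "\<omega> \<in> (\<Union>k. E k C)" by blast
  next
    fix \<omega> assume "\<omega> \<in> (\<Union>k. E k C)"
    then obtain k where k: "\<omega> \<in> E k C" by blast
    then have "?T \<omega> = enat (Suc k)" using T_iff[of \<omega> k] by (auto simp: E_def)
    with k V[OF k] show "\<omega> \<in> {\<omega> \<in> space M. ?T \<omega> < \<infinity> \<and> ?V \<omega> \<in> C}"
      by (auto simp: E_def)
  qed
  have disj: "disjoint_family (\<lambda>k. E k B)"
  proof (unfold disjoint_family_on_def, intro ballI impI)
    fix j k :: nat assume "j \<noteq> k"
    have "?T \<omega> = enat (Suc j)" if "\<omega> \<in> E j B" for \<omega> j
      using that T_iff[of \<omega> j] by (auto simp: E_def)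
    then show "E j B \<inter> E k B = {}" using \<open>j \<noteq> k\<close> by (metis Int_emptyI enat.inject nat.inject)
  qed
  have union_UNIV: "{\<omega> \<in> space M. ?T \<omega> < \<infinity>} = (\<Union>k. E k UNIV)"
    using union[of UNIV] by simp
  have sp: "{\<omega> \<in> space M. ?T \<omega> < \<infinity>} \<in> sets M" unfolding union_UNIV by measurable
  then have spI: "{\<omega> \<in> space M. ?T \<omega> < \<infinity>} \<inter> space M \<in> sets M" by auto
  \<comment> \<open>Measurability of the position at the random time comes from the same countable
    decomposition, one fixed time per piece.\<close>
  have V_meas: "?V \<in> borel_measurable (restrict_space M {\<omega> \<in> space M. ?T \<omega> < \<infinity>})"
  proof (rule measurableI)
    fix C :: "real set" assume C[measurable]: "C \<in> sets borel"
    have "?V -` C \<inter> space (restrict_space M {\<omega> \<in> space M. ?T \<omega> < \<infinity>}) = {\<omega> \<in> space M. ?T \<omega> < \<infinity> \<and> ?V \<omega> \<in> C}"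
      by (auto simp: space_restrict_space)
    also have "\<dots> \<in> sets (restrict_space M {\<omega> \<in> space M. ?T \<omega> < \<infinity>})"
    proof -
      have "{\<omega> \<in> space M. ?T \<omega> < \<infinity> \<and> ?V \<omega> \<in> C} \<in> sets M" unfolding union by measurable
      then show ?thesis by (subst sets_restrict_space_iff[OF spI]) auto
    qed
    finally show "?V -` C \<inter> space (restrict_space M {\<omega> \<in> space M. ?T \<omega> < \<infinity>})
        \<in> sets (restrict_space M {\<omega> \<in> space M. ?T \<omega> < \<infinity>})" .
  qed simp
  have "emeasure (entrance_law M X h x (Suc n)) B
      = emeasure (restrict_space M {\<omega> \<in> space M. ?T \<omega> < \<infinity>}) (?V -` B \<inter> space (restrict_space M {\<omega> \<in> space M. ?T \<omega> < \<infinity>}))"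
    unfolding entrance_law_def by (rule emeasure_distr[OF V_meas]) simp
  also have "?V -` B \<inter> space (restrict_space M {\<omega> \<in> space M. ?T \<omega> < \<infinity>}) = {\<omega> \<in> space M. ?T \<omega> < \<infinity> \<and> ?V \<omega> \<in> B}"
    by (auto simp: space_restrict_space)
  also have "emeasure (restrict_space M {\<omega> \<in> space M. ?T \<omega> < \<infinity>}) {\<omega> \<in> space M. ?T \<omega> < \<infinity> \<and> ?V \<omega> \<in> B}
      = emeasure M {\<omega> \<in> space M. ?T \<omega> < \<infinity> \<and> ?V \<omega> \<in> B}"
    by (rule emeasure_restrict_space[OF spI]) auto
  also have "\<dots> = (\<Sum>k. emeasure M (E k B))"
    unfolding union by (rule suminf_emeasure[symmetric]) (use disj in auto)
  also have "\<dots> = (\<Sum>k. passage_op law ?A k n (enter_op law ?A (indicator B)) x)"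
  proof (rule arg_cong[where f = suminf], rule ext)
    fix k
    have "emeasure M (E k B) = (\<integral>\<^sup>+ \<omega>. indicator (E k B) \<omega> \<partial>M)" by simp
    also have "\<dots> = (\<integral>\<^sup>+ \<omega>. of_bool (entered ?A (walk X x \<omega>) k n) *
        ((if walk X x \<omega> k \<notin> ?A \<and> walk X x \<omega> k + X (Suc k) \<omega> \<in> ?A then 1 else 0) *
          indicator B (walk X x \<omega> (Suc k))) \<partial>M)"
      by (intro nn_integral_cong) (auto simp: E_def indicator_def walk_Suc)
    also have "\<dots> = (\<integral>\<^sup>+ \<omega>. of_bool (entered ?A (walk X x \<omega>) k n) * enter_op law ?A (indicator B) (walk X x \<omega> k) \<partial>M)"
      by (rule nn_integral_entered_step) auto
    also have "\<dots> = passage_op law ?A k n (enter_op law ?A (indicator B)) x"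
      by (rule nn_integral_entered) auto
    finally show "emeasure M (E k B) = passage_op law ?A k n (enter_op law ?A (indicator B)) x" .
  qed
  also have "\<dots> = (chain_op law ?A ^^ Suc n) (indicator B) x"
    by (rule law.suminf_passage_op) auto
  finally show ?thesis .
qed

subsection \<open>Recurrence of centred walks\<close>

lemma char_walk_average:
  "char (distr M borel (\<lambda>\<omega>. walk X 0 \<omega> n / real n)) t = char law (t / real n) ^ n"
proof -
  have "char (distr M borel (\<lambda>\<omega>. walk X 0 \<omega> n / real n)) t
      = char (distr M borel (\<lambda>\<omega>. walk X 0 \<omega> n)) (t / real n)"
    unfolding char_def by (subst (1 2) integral_distr) auto
  also have "\<dots> = char (distr M borel (\<lambda>\<omega>. \<Sum>i\<in>{1..n}. X i \<omega>)) (t / real n)"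
    by (simp add: walk_def)
  also have "\<dots> = (\<Prod>i\<in>{1..n}. char (distr M borel (X i)) (t / real n))"
    by (rule char_distr_sum, rule indep_vars_subset[OF indep]) auto
  also have "\<dots> = (\<Prod>i\<in>{1..n}. char law (t / real n))"
  proof (rule prod.cong)
    fix i assume "i \<in> {1..n}"
    then have "distr M borel (X i) = law" unfolding law_def by (intro ident) simp
    then show "char (distr M borel (X i)) (t / real n) = char law (t / real n)" by simp
  qed simp
  finally show ?thesis by simp
qed

text \<open>Only a first moment is given, so characteristic functions take the place of variances:
  the distance of their \<open>n\<close>-th power at \<open>t / n\<close> from 1 is at most
  \<open>n\<close> times the distance of the base from 1, and the first-order expansion with mean 0
  makes this tend to 0. Levy continuity gives convergence to the unit mass at 0.\<close>

lemma weak_law_of_large_numbers: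
  assumes int: "integrable law (\<lambda>x. x)" and mean: "(\<integral>x. x \<partial>law) = 0" and \<epsilon>: "0 < \<epsilon>"
  shows "eventually (\<lambda>n. 1 / 2 \<le> measure M {\<omega> \<in> space M. \<bar>walk X 0 \<omega> n\<bar> \<le> \<epsilon> * real n}) sequentially"
proof -
  define D where "D n = distr M borel (\<lambda>\<omega>. walk X 0 \<omega> n / real n)" for n
  have D: "real_distribution (D n)" for n
    unfolding D_def by (rule real_distribution_distr) simp
  have "(\<lambda>n. char (D n) t) \<longlonglongrightarrow> 1" for t
  proof -
    \<comment> \<open>In the minimum, the first entry is an integrable dominating function, while
      the second tends to 0 pointwise.\<close>
    let ?m = "\<lambda>n. law.expectation (\<lambda>x. min (4 * \<bar>x\<bar>) (\<bar>t / real n\<bar> * x\<^sup>2))"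
    have bound: "norm (char (D n) t - 1) \<le> \<bar>t\<bar> / 2 * ?m n" if n: "0 < n" for n
    proof -
      have "norm (char (D n) t - 1) = norm (char law (t / real n) ^ n - 1 ^ n)"
        unfolding D_def char_walk_average by simp
      also have "\<dots> \<le> real n * norm (char law (t / real n) - 1)"
        by (rule norm_power_diff) (auto simp: law.cmod_char_le_1)
      also have "norm (char law (t / real n) - 1) \<le> \<bar>t / real n\<bar> / 2 * ?m n"
      proof -
        have "integrable law (\<lambda>x. x ^ k)" if "k \<le> 1" for k
          using that int by (cases k) auto
        from law.char_approx2[where n = 1 and t = "t / real n", OF this] show ?thesis
          using law.prob_space by (simp add: mean power2_eq_square)
      qed
      also have "real n * (\<bar>t / real n\<bar> / 2 * ?m n) = \<bar>t\<bar> / 2 * ?m n" using n by (simp add: abs_divide)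
      finally show ?thesis by (simp add: mult_left_mono)
    qed
    have "(\<lambda>n. ?m n) \<longlonglongrightarrow> law.expectation (\<lambda>_. 0)"
    proof (rule integral_dominated_convergence[where w = "\<lambda>x. 4 * \<bar>x\<bar>"])
      show "integrable law (\<lambda>x. 4 * \<bar>x\<bar>)" using int by auto
      show "AE x in law. (\<lambda>n. min (4 * \<bar>x\<bar>) (\<bar>t / real n\<bar> * x\<^sup>2)) \<longlonglongrightarrow> 0"
      proof (intro AE_I2)
        fix x :: real
        have "(\<lambda>n. \<bar>t / real n\<bar> * x\<^sup>2) \<longlonglongrightarrow> \<bar>0\<bar> * x\<^sup>2"
          by (intro tendsto_mult tendsto_rabs tendsto_const tendsto_divide_0[OF tendsto_const] filterlim_at_top_imp_at_infinity filterlim_real_sequentially)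
        from tendsto_min[OF tendsto_const this, of "4 * \<bar>x\<bar>"]
        show "(\<lambda>n. min (4 * \<bar>x\<bar>) (\<bar>t / real n\<bar> * x\<^sup>2)) \<longlonglongrightarrow> 0" by simp
      qed
    qed auto
    then have "(\<lambda>n. \<bar>t\<bar> / 2 * ?m n) \<longlonglongrightarrow> \<bar>t\<bar> / 2 * 0" by (intro tendsto_mult tendsto_const) simp
    then have lim: "(\<lambda>n. \<bar>t\<bar> / 2 * ?m n) \<longlonglongrightarrow> 0" by simp
    have "(\<lambda>n. char (D n) t - 1) \<longlonglongrightarrow> 0"
      by (rule Lim_null_comparison[OF _ lim]) (use bound in \<open>auto intro!: eventually_sequentiallyI[of 1]\<close>)
    then show ?thesis by (simp add: LIM_zero_iff)
  qed
  moreover have "char (return borel 0) t = 1" for t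
    by (simp add: char_def integral_return)
  moreover have R: "real_distribution (return borel 0)"
    by (intro real_distribution.intro prob_space_return real_distribution_axioms.intro) auto
  ultimately have conv: "weak_conv_m D (return borel 0)"
    by (intro levy_continuity D) auto
  \<comment> \<open>The limit law has its only atom at 0, so \<open>\<epsilon>\<close> and
    \<open>- \<epsilon>\<close> are continuity points.\<close>
  have cdf_lim: "(\<lambda>n. cdf (D n) y) \<longlonglongrightarrow> cdf (return borel 0) y" if "y \<noteq> 0" for y
  proof -
    have "measure (return borel (0::real)) {y} = 0" using that by (simp add: measure_return)
    then have "isCont (cdf (return borel 0)) y"
      using finite_borel_measure.isCont_cdf[OF real_distribution.finite_borel_measure_M[OF R]] by simp
    then show ?thesis using conv by (auto simp: weak_conv_m_def weak_conv_def)
  qed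
  have "(\<lambda>n. cdf (D n) \<epsilon> - cdf (D n) (- \<epsilon>)) \<longlonglongrightarrow> cdf (return borel 0) \<epsilon> - cdf (return borel 0) (- \<epsilon>)"
    using \<epsilon> by (intro tendsto_diff cdf_lim) auto
  also have "cdf (return borel 0) \<epsilon> - cdf (return borel 0) (- \<epsilon>) = 1"
    using \<epsilon> by (simp add: cdf_def measure_return)
  finally have "eventually (\<lambda>n. 1 / 2 < cdf (D n) \<epsilon> - cdf (D n) (- \<epsilon>)) sequentially"
    by (rule order_tendstoD) simp
  moreover have "eventually (\<lambda>n::nat. 0 < n) sequentially" by (rule eventually_gt_at_top)
  ultimately show ?thesis
  proof eventually_elim
    case (elim n)
    interpret D: real_distribution "D n" by (rule D)
    have "cdf (D n) \<epsilon> - cdf (D n) (- \<epsilon>) = measure (D n) {- \<epsilon><..\<epsilon>}"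
      using \<epsilon> by (intro D.cdf_diff_eq) simp
    also have "\<dots> \<le> measure (D n) {- \<epsilon>..\<epsilon>}"
      by (intro D.finite_measure_mono) auto
    also have "\<dots> = measure M {\<omega> \<in> space M. \<bar>walk X 0 \<omega> n\<bar> \<le> \<epsilon> * real n}"
    proof -
      have "(\<lambda>\<omega>. walk X 0 \<omega> n / real n) -` {- \<epsilon>..\<epsilon>} \<inter> space M = {\<omega> \<in> space M. \<bar>walk X 0 \<omega> n\<bar> \<le> \<epsilon> * real n}"
        using elim(2) by (auto simp: abs_le_iff field_simps)
      then show ?thesis unfolding D_def by (subst measure_distr) auto
    qed
    finally show ?case using elim(1) by simp
  qed
qed

lemma free_op_funpow_shift:
  assumes [measurable]: "f \<in> borel_measurable borel"
  shows "(free_op law ^^ k) f x = (free_op law ^^ k) (\<lambda>y. f (x + y)) 0"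
proof -
  have "walk X x \<omega> k = x + walk X 0 \<omega> k" for \<omega> by (simp add: walk_def)
  then show ?thesis by (simp add: free_op_funpow_walk)
qed

text \<open>
  Only the walk after its first visit counts, and two visits are at distance at most 1.
\<close>

lemma expected_visits_le:
  "(\<Sum>k\<le>n. (free_op law ^^ k) (indicator {y - 1 / 2..y + 1 / 2}) x)
    \<le> (\<Sum>k\<le>n. (free_op law ^^ k) (indicator {- 1..1}) 0)"
proof (induction n arbitrary: x)
  case 0
  then show ?case by (simp add: indicator_def)
next
  case (Suc n)
  let ?I = "{y - 1 / 2..y + 1 / 2}"
  show ?case
  proof (cases "x \<in> ?I")
    case True
    have "(free_op law ^^ k) (indicator ?I) x \<le> (free_op law ^^ k) (indicator {- 1..1}) 0" for k
    proof -
      have "(free_op law ^^ k) (indicator ?I) x = (free_op law ^^ k) (\<lambda>z. indicator ?I (x + z)) 0"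
        by (rule free_op_funpow_shift) simp
      also have "\<dots> \<le> (free_op law ^^ k) (indicator {- 1..1}) 0"
        by (rule law.step_op_funpow_mono) (use True in \<open>auto simp: indicator_def\<close>)
      finally show ?thesis .
    qed
    then show ?thesis by (intro sum_mono)
  next
    case False
    have "(\<Sum>k\<le>Suc n. (free_op law ^^ k) (indicator ?I) x) = (\<Sum>k\<le>n. free_op law ((free_op law ^^ k) (indicator ?I)) x)"
      by (subst sum.atMost_Suc_shift) (use False in simp)
    also have "\<dots> = free_op law (\<lambda>x. \<Sum>k\<le>n. (free_op law ^^ k) (indicator ?I) x) x"
      by (rule law.step_op_sum[symmetric]) auto
    also have "\<dots> \<le> free_op law (\<lambda>_. \<Sum>k\<le>n. (free_op law ^^ k) (indicator {- 1..1}) 0) x"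
      by (intro law.step_op_mono Suc) simp
    also have "\<dots> = (\<Sum>k\<le>n. (free_op law ^^ k) (indicator {- 1..1}) 0)"
      by (rule law.free_op_const)
    also have "\<dots> \<le> (\<Sum>k\<le>Suc n. (free_op law ^^ k) (indicator {- 1..1}) 0)"
      by (intro sum_mono2) auto
    finally show ?thesis .
  qed
qed

text \<open>By the weak law the walk is in \<open>{- a..a}\<close> with probability at least one
  half at all times from \<open>a\<close> to \<open>m * a\<close>, so at least
  \<open>(m - 1) * a / 2\<close> visits are expected. But \<open>2 * a + 1\<close> unit intervals
  cover \<open>{- a..a}\<close>, each with at most \<open>g\<close> expected visits if the sum is a
  finite \<open>g\<close>; for large \<open>m\<close> this is impossible.\<close>

lemma chung_fuchs:
  assumes int: "integrable law (\<lambda>x. x)" and mean: "(\<integral>x. x \<partial>law) = 0"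
  shows "(\<Sum>k. (free_op law ^^ k) (indicator {- 1..1}) 0) = \<infinity>" (is "?g = _")
proof (rule ccontr)
  assume "?g \<noteq> \<infinity>"
  then obtain g where g: "0 \<le> g" "?g = ennreal g" by (cases ?g) auto
  \<comment> \<open>The final comparison reads \<open>m - 1 \<le> 6 * g\<close>, which this choice
    violates.\<close>
  define m :: nat where "m = nat \<lceil>6 * g\<rceil> + 2"
  have m: "6 * g + 1 < real m" "0 < m" using g(1) by (auto simp: m_def) linarith
  obtain N where N: "\<And>n. N \<le> n \<Longrightarrow> 1 / 2 \<le> measure M {\<omega> \<in> space M. \<bar>walk X 0 \<omega> n\<bar> \<le> 1 / real m * real n}"
    using weak_law_of_large_numbers[OF int mean, of "1 / real m"] m(2) by (auto simp: eventually_sequentially)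
  \<comment> \<open>Beyond the threshold of the weak law, and at least 1, so that
    \<open>2 * a + 1 \<le> 3 * a\<close> and \<open>a\<close> can be cancelled.\<close>
  define a where "a = Suc N"
  let ?J = "{- real a..real a}"
  have low: "ennreal (1 / 2) \<le> (free_op law ^^ k) (indicator ?J) 0" if k: "a \<le> k" "k \<le> m * a" for k
  proof -
    have "real k \<le> real m * real a" using k(2) by (metis of_nat_le_iff of_nat_mult)
    then have "1 / real m * real k \<le> real a" using m(2) by (simp add: field_simps)
    have "1 / 2 \<le> measure M {\<omega> \<in> space M. \<bar>walk X 0 \<omega> k\<bar> \<le> 1 / real m * real k}"
      using k(1) by (intro N) (simp add: a_def)
    also have "\<dots> \<le> measure M {\<omega> \<in> space M. walk X 0 \<omega> k \<in> ?J}"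
      by (intro finite_measure_mono) (use \<open>1 / real m * real k \<le> real a\<close> in \<open>auto simp: abs_le_iff\<close>)
    finally have "ennreal (1 / 2) \<le> emeasure M {\<omega> \<in> space M. walk X 0 \<omega> k \<in> ?J}"
      unfolding emeasure_eq_measure by (rule ennreal_leI)
    also have "\<dots> = (\<integral>\<^sup>+ \<omega>. indicator {\<omega> \<in> space M. walk X 0 \<omega> k \<in> ?J} \<omega> \<partial>M)" by simp
    also have "\<dots> = (\<integral>\<^sup>+ \<omega>. indicator ?J (walk X 0 \<omega> k) \<partial>M)"
      by (intro nn_integral_cong) (auto simp: indicator_def)
    finally show ?thesis by (simp add: free_op_funpow_walk)
  qed
  have "ennreal (1 / 2 * real (card {a..m * a})) = ennreal (1 / 2) * of_nat (card {a..m * a})"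
    unfolding ennreal_of_nat_eq_real_of_nat by (rule ennreal_mult) simp_all
  also have "\<dots> = (\<Sum>k\<in>{a..m * a}. ennreal (1 / 2))"
    by (simp add: mult.commute)
  also have "\<dots> \<le> (\<Sum>k\<in>{a..m * a}. (free_op law ^^ k) (indicator ?J) 0)"
    by (intro sum_mono low) auto
  also have "\<dots> \<le> (\<Sum>k\<le>m * a. (free_op law ^^ k) (indicator ?J) 0)"
    by (intro sum_mono2) auto
  also have "\<dots> \<le> (\<Sum>k\<le>m * a. (free_op law ^^ k) (\<lambda>x. \<Sum>i\<in>{- int a..int a}. indicator {of_int i - 1 / 2..of_int i + 1 / 2} x) 0)"
  proof (intro sum_mono law.step_op_funpow_mono)
    fix y :: real
    show "indicator ?J y \<le> (\<Sum>i\<in>{- int a..int a}. indicator {of_int i - 1 / 2..of_int i + 1 / 2} y :: ennreal)"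
    proof (cases "y \<in> ?J")
      case True
      define i where "i = round y"
      have "of_int i - y \<le> 1 / 2" "y - of_int i \<le> 1 / 2"
        using of_int_round_abs_le[of y] unfolding i_def by linarith+
      then have "y \<in> {of_int i - 1 / 2..of_int i + 1 / 2}" "- real a - 1 / 2 \<le> of_int i" "of_int i \<le> real a + 1 / 2"
        using True by (auto simp: algebra_simps)
      moreover from this(2,3) have "i \<in> {- int a..int a}" unfolding atLeastAtMost_iff by linarith
      ultimately show ?thesis
        using member_le_sum[of i "{- int a..int a}" "\<lambda>i. indicator {of_int i - 1 / 2..of_int i + 1 / 2} y :: ennreal"] True
        by auto
    qed auto
  qed auto
  also have "\<dots> = (\<Sum>k\<le>m * a. \<Sum>i\<in>{- int a..int a}. (free_op law ^^ k) (indicator {of_int i - 1 / 2..of_int i + 1 / 2}) 0)"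
    by (intro sum.cong refl law.step_op_funpow_sum) auto
  also have "\<dots> = (\<Sum>i\<in>{- int a..int a}. \<Sum>k\<le>m * a. (free_op law ^^ k) (indicator {of_int i - 1 / 2..of_int i + 1 / 2}) 0)"
    by (rule sum.swap)
  also have "\<dots> \<le> (\<Sum>i\<in>{- int a..int a}. ennreal g)"
  proof (intro sum_mono)
    fix i
    have "(\<Sum>k\<le>m * a. (free_op law ^^ k) (indicator {of_int i - 1 / 2..of_int i + 1 / 2}) 0)
        \<le> (\<Sum>k\<le>m * a. (free_op law ^^ k) (indicator {- 1..1}) 0)"
      by (rule expected_visits_le)
    also have "\<dots> \<le> ?g" by (intro sum_le_suminf) auto
    finally show "(\<Sum>k\<le>m * a. (free_op law ^^ k) (indicator {of_int i - 1 / 2..of_int i + 1 / 2}) 0) \<le> ennreal g"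
      unfolding g(2) .
  qed
  also have "\<dots> = ennreal (real (2 * a + 1) * g)"
    using g(1) by (simp add: ennreal_mult ennreal_of_nat_eq_real_of_nat add.commute)
  finally have "1 / 2 * real (card {a..m * a}) \<le> real (2 * a + 1) * g"
    using g(1) by (subst (asm) ennreal_le_iff) auto
  moreover have "real (card {a..m * a}) = real m * real a + 1 - real a"
  proof -
    have "a \<le> Suc (m * a)" using m(2) by (cases m) auto
    then have "real (Suc (m * a) - a) = real (Suc (m * a)) - real a" by (rule of_nat_diff)
    then show ?thesis by simp
  qed
  ultimately have "1 / 2 * (real m * real a + 1 - real a) \<le> (2 * real a + 1) * g" by (simp add: algebra_simps)
  moreover have "(2 * real a + 1) * g \<le> 3 * real a * g" using g(1) by (intro mult_right_mono) (auto simp: a_def)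
  ultimately have "(real m - 1) * real a \<le> 6 * g * real a" by (simp add: algebra_simps)
  then have "real m - 1 \<le> 6 * g" by (simp add: a_def)
  then show False using m(1) by simp
qed

end

section \<open>The flux as stationary law\<close>

context recurrent_lattice_walk
begin

text \<open>For a fixed step \<open>z\<close> the substitution \<open>y = x + z\<close> preserves
  \<open>haar\<close>, and \<open>y - z\<close> lies outside \<open>{0..h}\<close> iff
  \<open>z\<close> lies outside \<open>{y - h..y}\<close>. Integrating over \<open>z\<close>
  produces the density in \<open>entrance_weight\<close>.\<close>

lemma flux_density:
  assumes [measurable]: "f \<in> borel_measurable borel"
  shows "flux f = (\<integral>\<^sup>+ y. ennreal (indicator {0..h} y * (1 - measure \<mu> {y - h..y})) * f y \<partial>haar)"
proof -
  interpret haar: sigma_finite_measure haar by (rule sigma_finite_haar)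
  interpret pair_sigma_finite haar \<mu> ..
  have "flux f = (\<integral>\<^sup>+ z. (\<integral>\<^sup>+ x. (if x \<notin> A \<and> x + z \<in> A then 1 else 0) * f (x + z) \<partial>haar) \<partial>\<mu>)"
    unfolding flux_def step_op_def by (subst Fubini') (auto simp: measurable_split_conv)
  also have "\<dots> = (\<integral>\<^sup>+ z. (\<integral>\<^sup>+ y. (if y - z \<notin> A \<and> y \<in> A then 1 else 0) * f y \<partial>haar) \<partial>\<mu>)"
  proof (rule nn_integral_cong_AE, use AE_step in eventually_elim)
    fix z assume z: "z \<in> Z"
    show "(\<integral>\<^sup>+ x. (if x \<notin> A \<and> x + z \<in> A then 1 else 0) * f (x + z) \<partial>haar)
        = (\<integral>\<^sup>+ y. (if y - z \<notin> A \<and> y \<in> A then 1 else 0) * f y \<partial>haar)"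
      using haar_shift[OF z, of "\<lambda>y. (if y - z \<notin> A \<and> y \<in> A then 1 else 0) * f y"] by simp
  qed
  also have "\<dots> = (\<integral>\<^sup>+ y. (\<integral>\<^sup>+ z. (if y - z \<notin> A \<and> y \<in> A then 1 else 0) * f y \<partial>\<mu>) \<partial>haar)"
    by (subst Fubini') (auto simp: measurable_split_conv)
  also have "\<dots> = (\<integral>\<^sup>+ y. ennreal (indicator {0..h} y * (1 - measure \<mu> {y - h..y})) * f y \<partial>haar)"
  proof (rule nn_integral_cong)
    fix y
    show "(\<integral>\<^sup>+ z. (if y - z \<notin> A \<and> y \<in> A then 1 else 0) * f y \<partial>\<mu>)
        = ennreal (indicator {0..h} y * (1 - measure \<mu> {y - h..y})) * f y"
    proof (cases "y \<in> A")
      case True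
      have "(\<integral>\<^sup>+ z. (if y - z \<notin> A \<and> y \<in> A then 1 else 0) * f y \<partial>\<mu>)
          = (\<integral>\<^sup>+ z. f y * indicator (UNIV - {y - h..y}) z \<partial>\<mu>)"
        using True by (intro nn_integral_cong) (auto simp: indicator_def A_eq)
      also have "\<dots> = f y * emeasure \<mu> (UNIV - {y - h..y})"
        by (rule nn_integral_cmult_indicator) simp
      also have "emeasure \<mu> (UNIV - {y - h..y}) = ennreal (1 - measure \<mu> {y - h..y})"
        using prob_compl[of "{y - h..y}"] by (simp add: emeasure_eq_measure)
      finally show ?thesis using True by (simp add: A_eq mult.commute)
    next
      case False
      then show ?thesis by (simp add: A_eq[symmetric])
    qed
  qed
  finally show ?thesis .
qed

end

subsection \<open>The entrance chain\<close>

context iid_walk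
begin

text \<open>Entrance 0 is the starting point, on which the chain has not yet acted; the bound for
  \<open>n = 0\<close> uses only that its law is a probability measure.\<close>

lemma entrance_law_0_le: "measure (entrance_law M X h x 0) B \<le> 1"
proof -
  have "(\<lambda>\<omega>. walk X x \<omega> 0) \<in> borel_measurable (restrict_space M {\<omega> \<in> space M. entrance_time h (walk X x \<omega>) 0 < \<infinity>})"
    by (rule measurable_restrict_space1) simp
  moreover have "prob_space (restrict_space M {\<omega> \<in> space M. entrance_time h (walk X x \<omega>) 0 < \<infinity>})"
    by (rule prob_spaceI) (simp add: space_restrict_space emeasure_restrict_space emeasure_space_1 del: space_restrict_space2)
  moreover have "the_enat 0 = 0" by (simp add: zero_enat_def)
  ultimately have "prob_space (entrance_law M X h x 0)"
    unfolding entrance_law_def by (intro prob_space.prob_space_distr) simp_all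
  then show ?thesis by (rule prob_space.prob_le_1)
qed

end

context recurrent_lattice_walk
begin

lemma measure_stationary:
  assumes W: "W = density haar (\<lambda>y. ennreal (indicator {0..h} y * (1 - measure \<mu> {y - h..y})))"
    and [measurable]: "B \<in> sets borel"
  shows "measure (scale_measure (1 / emeasure W UNIV) W) B
    = enn2real (flux (indicator B) / flux (\<lambda>_. 1))"
proof -
  \<comment> \<open>The interval moves with \<open>y\<close>, so measurability goes through the
    integral of a jointly measurable function of \<open>y\<close> and \<open>z\<close>.\<close>
  have [measurable]: "(\<lambda>y. measure \<mu> {y - h..y}) \<in> borel_measurable borel"
  proof -
    have "(\<lambda>y. \<integral>\<^sup>+ z. (if y - h \<le> z \<and> z \<le> y then 1 else 0) \<partial>\<mu>) \<in> borel_measurable borel"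
      by measurable
    also have "(\<lambda>y. \<integral>\<^sup>+ z. (if y - h \<le> z \<and> z \<le> y then 1 else 0) \<partial>\<mu>) = (\<lambda>y. emeasure \<mu> {y - h..y})"
    proof
      fix y
      have "(\<integral>\<^sup>+ z. (if y - h \<le> z \<and> z \<le> y then 1 else 0) \<partial>\<mu>) = (\<integral>\<^sup>+ z. indicator {y - h..y} z \<partial>\<mu>)"
        by (intro nn_integral_cong) (auto simp: indicator_def)
      then show "(\<integral>\<^sup>+ z. (if y - h \<le> z \<and> z \<le> y then 1 else 0) \<partial>\<mu>) = emeasure \<mu> {y - h..y}" by simp
    qed
    finally show ?thesis unfolding measure_def by measurable
  qed
  have W_eq: "emeasure W C = flux (indicator C)" if [measurable]: "C \<in> sets borel" for C
    unfolding W by (subst emeasure_density) (auto simp: flux_density)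
  have "flux (indicator UNIV) = flux (\<lambda>_. 1)" by (intro arg_cong[where f = flux]) auto
  then have UNIV: "emeasure W UNIV = flux (\<lambda>_. 1)" using W_eq[of UNIV] by simp
  have "emeasure (scale_measure (1 / emeasure W UNIV) W) B = 1 / flux (\<lambda>_. 1) * flux (indicator B)"
    by (simp add: UNIV W_eq)
  also have "\<dots> = flux (indicator B) / flux (\<lambda>_. 1)"
    by (simp add: divide_ennreal_def mult.commute)
  finally show ?thesis by (simp add: measure_def)
qed

lemma measure_stationary_le: "enn2real (flux (indicator B) / flux (\<lambda>_. 1)) \<le> 1"
proof -
  have "flux (indicator B) \<le> flux (\<lambda>_. 1)" by (rule flux_mono) (simp add: indicator_def)
  then have "flux (indicator B) / flux (\<lambda>_. 1) \<le> flux (\<lambda>_. 1) / flux (\<lambda>_. 1)"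
    by (rule divide_right_mono_ennreal)
  also have "\<dots> = 1"
    using flux_one_pos flux_one_finite by (intro ennreal_divide_self) auto
  finally show ?thesis using enn2real_mono[of _ 1] by simp
qed

end

theorem mainTheorem4:
  fixes M :: "'a measure" and X :: "nat \<Rightarrow> 'a \<Rightarrow> real" and h :: real
  defines "\<mu> \<equiv> distr M borel (X 1)"
  assumes "h > 0"
    and "iid_increments M X"
    and "integrable M (X 1)"
    and "(\<integral>\<omega>. \<bar>X 1 \<omega>\<bar> \<partial>M) > 0"
    and "(\<integral>\<omega>. X 1 \<omega> \<partial>M) = 0"
    and "arithmetic_law \<mu> \<or> spread_out M X"
  shows "(\<forall>x \<in> lattice_set (law_span \<mu>).
            (\<lambda>n. tv_dist (entrance_law M X h x n) (entrance_stationary \<mu> h)) \<longlonglongrightarrow> 0) \<and>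
         (integrable M (\<lambda>\<omega>. (X 1 \<omega>)\<^sup>2) \<or>
          (\<exists>\<alpha> \<beta>. 1 < \<alpha> \<and> \<alpha> < 2 \<and> \<bar>\<beta>\<bar> < 1 \<and> in_stable_domain M X \<alpha> \<beta>) \<longrightarrow>
          (\<exists>r c. 0 < r \<and> r < 1 \<and> c > 0 \<and>
             (\<forall>x \<in> lattice_set (law_span \<mu>) \<inter> {0..}. \<forall>n.
                tv_dist (entrance_law M X h x n) (entrance_stationary \<mu> h) \<le> c * r ^ n)))"
proof -
  have h: "0 < h" by fact
  interpret iid_walk M X
    using \<open>iid_increments M X\<close> unfolding iid_increments_def
    by (intro iid_walk.intro iid_walk_axioms.intro) blast+
  have \<mu>: "\<mu> = law" by (simp add: \<mu>_def law_def)
  have [measurable]: "X 1 \<in> borel_measurable M" by (simp add: X_measurable')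
  have int: "integrable law (\<lambda>x. x)" and mean: "(\<integral>x. x \<partial>law) = 0"
    using assms(4,6) unfolding law_def by (auto simp: integrable_distr_eq integral_distr)
  have abs_mean: "0 < (\<integral>x. \<bar>x\<bar> \<partial>law)"
    using assms(5) unfolding law_def by (subst integral_distr) auto
  have not_zero: "\<not> (AE x in law. x = 0)"
  proof
    assume "AE x in law. x = 0"
    then have "(\<integral>x. \<bar>x\<bar> \<partial>law) = (\<integral>x. 0 \<partial>law)" by (intro integral_cong_AE) auto
    then show False using abs_mean by simp
  qed
  have ne: "law.prob {0} \<noteq> 1"
  proof
    assume "law.prob {0} = 1"
    then have "AE x in law. x \<in> {0}" by (subst (asm) law.prob_eq_1) auto
    then show False using not_zero by simp
  qed
  \<comment> \<open>A centred law without mass on one side of 0 is the unit mass at 0, which a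
    positive absolute moment excludes.\<close>
  have pos: "0 < emeasure law {0<..}"
  proof (rule ccontr)
    assume "\<not> ?thesis"
    then have "law.prob {0<..} = 0" by (simp add: law.emeasure_eq_measure zero_less_measure_iff)
    then have "AE x in law. x \<notin> {0<..}" by (subst (asm) law.prob_eq_0) auto
    then have AE: "AE x in law. 0 \<le> - x" by eventually_elim auto
    have "AE x in law. - x = 0"
      using integral_nonneg_eq_0_iff_AE[OF integrable_minus[OF int] AE] mean by simp
    then show False using not_zero by simp
  qed
  have neg: "0 < emeasure law {..<0}"
  proof (rule ccontr)
    assume "\<not> ?thesis"
    then have "law.prob {..<0} = 0" by (simp add: law.emeasure_eq_measure zero_less_measure_iff)
    then have "AE x in law. x \<notin> {..<0}" by (subst (asm) law.prob_eq_0) auto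
    then have AE: "AE x in law. 0 \<le> x" by eventually_elim auto
    have "AE x in law. x = 0"
      using integral_nonneg_eq_0_iff_AE[OF int AE] mean by simp
    then show False using not_zero by simp
  qed
  have up: "\<exists>s>0. \<forall>\<eta>>0. 0 < emeasure law {s - \<eta><..<s + \<eta>}"
    using law.exists_support_point[OF pos] by auto
  obtain t where t: "t < 0" "\<forall>\<eta>>0. 0 < emeasure law {t - \<eta><..<t + \<eta>}"
    using law.exists_support_point[OF neg] by auto
  then have down: "\<exists>s>0. \<forall>\<eta>>0. 0 < emeasure law {- s - \<eta><..<- s + \<eta>}"
    by (intro exI[of _ "- t"]) simp
  define d where "d = law_span law"
  have d: "0 \<le> d" unfolding d_def by (rule law.law_span_nonneg[OF ne])
  have haar: "haar_walk law (lattice_set d) (haar_lattice d)"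
    by (rule haar_walk_haar_lattice[OF law.real_distribution_axioms d])
       (simp add: d_def law.prob_lattice_set_law_span[OF ne])
  have spread: "\<exists>K n c. 0 < c \<and> (\<forall>x\<in>lattice_set d. \<forall>g\<in>borel_measurable borel.
      ennreal c * (\<integral>\<^sup>+ y. g y * indicator {x - l..x + l} y \<partial>haar_lattice d)
        \<le> (\<Sum>j\<le>n. (into_op law {-K..K} ^^ j) g x))" for l
  proof (cases "d = 0")
    case False
    then show ?thesis
      using law.spread_arithmetic[OF ne _ pos neg, of l] d by (simp add: d_def)
  next
    case True
    then have "spread_out M X" using assms(7) by (simp add: arithmetic_law_def \<mu> d_def)
    then obtain k where k: "\<not> mutually_singular (distr M borel (\<lambda>\<omega>. walk X 0 \<omega> k)) lborel"
      by (auto simp: spread_out_def)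
    \<comment> \<open>A null set carrying the law of the walk at time \<open>k\<close> would witness
      its singularity.\<close>
    have "(free_op law ^^ k) (indicator (- N)) 0 \<noteq> 0"
      if N: "N \<in> sets borel" "emeasure lborel N = 0" for N
    proof
      note N(1)[measurable]
      assume "(free_op law ^^ k) (indicator (- N)) 0 = 0"
      then have "(\<integral>\<^sup>+ y. indicator (- N) y \<partial>distr M borel (\<lambda>\<omega>. walk X 0 \<omega> k)) = 0"
        by (subst nn_integral_distr) (auto simp: free_op_funpow_walk)
      then have "emeasure (distr M borel (\<lambda>\<omega>. walk X 0 \<omega> k)) (- N) = 0"
        by (subst (asm) nn_integral_indicator) auto
      moreover have "emeasure lborel (space lborel - (- N)) = 0" using N(2) by (simp add: Diff_eq)
      ultimately have "mutually_singular (distr M borel (\<lambda>\<omega>. walk X 0 \<omega> k)) lborel"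
        using N(1) unfolding mutually_singular_def by (intro bexI[of _ "- N"]) auto
      with k show False ..
    qed
    from law.spread_spread_out[OF this up down, of l] show ?thesis
      by (simp add: True lattice_set_zero haar_lattice_def)
  qed
  interpret two_sided_lattice_walk law "lattice_set d" "haar_lattice d" h "{0..h}"
    by (intro two_sided_lattice_walk.intro recurrent_lattice_walk.intro lattice_walk.intro
        lattice_walk_axioms.intro recurrent_lattice_walk_axioms.intro two_sided_lattice_walk_axioms.intro
        haar spread h refl chung_fuchs[OF int mean] up down)
  obtain r c :: real where rc: "0 < r" "r < 1" "1 \<le> c" and geo:
    "\<And>x n B. x \<in> lattice_set d \<Longrightarrow> B \<in> sets borel \<Longrightarrow>
      \<bar>enn2real ((chain_op law {0..h} ^^ Suc n) (indicator B) x)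
        - enn2real (flux (indicator B) / flux (\<lambda>_. 1))\<bar> \<le> c * r ^ Suc n"
    by (rule geometric_ergodicity) (rule that, assumption+)
  have stat: "measure (entrance_stationary law h) B = enn2real (flux (indicator B) / flux (\<lambda>_. 1))"
    if "B \<in> sets borel" for B
    unfolding entrance_stationary_def
    by (rule measure_stationary[OF _ that]) (simp add: entrance_weight_def d_def)
  have tv: "tv_dist (entrance_law M X h x n) (entrance_stationary law h) \<le> c * r ^ n"
    if x: "x \<in> lattice_set d" for x n
    unfolding tv_dist_def
  proof (rule cSUP_least)
    fix B :: "real set" assume B: "B \<in> sets borel"
    show "\<bar>measure (entrance_law M X h x n) B - measure (entrance_stationary law h) B\<bar> \<le> c * r ^ n"
    proof (cases n)
      \<comment> \<open>Here the trivial bound 1 is enough, because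
        \<open>c \<ge> 1\<close>.\<close>
      case 0
      have "0 \<le> measure (entrance_law M X h x 0) B" "0 \<le> measure (entrance_stationary law h) B" by simp_all
      moreover have "measure (entrance_stationary law h) B \<le> 1"
        using stat[OF B] measure_stationary_le[of B] by simp
      ultimately have "\<bar>measure (entrance_law M X h x 0) B - measure (entrance_stationary law h) B\<bar> \<le> c"
        using entrance_law_0_le[of h x B] rc(3) by linarith
      then show ?thesis using 0 by simp
    next
      case (Suc m)
      have "measure (entrance_law M X h x n) B = enn2real ((chain_op law {0..h} ^^ Suc m) (indicator B) x)"
        unfolding Suc measure_def entrance_law_Suc[OF B] ..
      then show ?thesis using geo[OF x B, of m] stat[OF B] Suc by simp
    qed
  qed auto
  have nonneg: "0 \<le> tv_dist (entrance_law M X h x n) (entrance_stationary law h)"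
    if x: "x \<in> lattice_set d" for x n
    unfolding tv_dist_def
  \<comment> \<open>The empty set contributes 0; a real \<open>SUP\<close> is known to be an upper
    bound only for a bounded family, so boundedness has to be shown.\<close>
  proof (rule cSUP_upper2[of _ _ "{}"])
    show "bdd_above ((\<lambda>B. \<bar>measure (entrance_law M X h x n) B - measure (entrance_stationary law h) B\<bar>) ` sets borel)"
    proof (rule bdd_aboveI2)
      fix B :: "real set" assume B: "B \<in> sets borel"
      have "measure (entrance_law M X h x n) B \<le> 1 + c"
      proof (cases n)
        case 0
        then show ?thesis using entrance_law_0_le[of h x B] rc(3) by simp
      next
        case (Suc m)
        have "measure (entrance_law M X h x n) B = enn2real ((chain_op law {0..h} ^^ Suc m) (indicator B) x)"
          unfolding Suc measure_def entrance_law_Suc[OF B] ..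
        moreover have "c * r ^ Suc m \<le> c"
          using rc power_le_one[of r "Suc m"] by (intro mult_left_le) auto
        ultimately show ?thesis using geo[OF x B, of m] measure_stationary_le[of B] by linarith
      qed
      moreover have "measure (entrance_stationary law h) B \<le> 1"
        using stat[OF B] measure_stationary_le[of B] by simp
      moreover have "0 \<le> measure (entrance_law M X h x n) B" "0 \<le> measure (entrance_stationary law h) B" by simp_all
      ultimately show "\<bar>measure (entrance_law M X h x n) B - measure (entrance_stationary law h) B\<bar> \<le> 1 + c"
        using rc(3) by linarith
    qed
  qed auto
  have "(\<lambda>n. tv_dist (entrance_law M X h x n) (entrance_stationary law h)) \<longlonglongrightarrow> 0"
    if x: "x \<in> lattice_set d" for x
  proof (rule real_tendsto_sandwich[where f = "\<lambda>_. 0" and h = "\<lambda>n. c * r ^ n"])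
    have "(\<lambda>n. c * r ^ n) \<longlonglongrightarrow> c * 0"
      using rc by (intro tendsto_mult tendsto_const LIMSEQ_realpow_zero) auto
    then show "(\<lambda>n. c * r ^ n) \<longlonglongrightarrow> 0" by simp
  qed (use tv[OF x] nonneg[OF x] in auto)
  moreover have "\<exists>r c. 0 < r \<and> r < 1 \<and> c > 0 \<and>
      (\<forall>x \<in> lattice_set d \<inter> {0..}. \<forall>n.
        tv_dist (entrance_law M X h x n) (entrance_stationary law h) \<le> c * r ^ n)"
    using rc tv by (intro exI[of _ r] exI[of _ c]) auto
  ultimately show ?thesis unfolding \<mu> d_def by blast
qed

end
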